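(* Let $X_1, X_2$ be complex Banach spaces with $\dim X_i\geq 3$ and let $\mathcal{A}_i$ be a standard operator algebra on $X_i$, $i=1,2$. Let $k\geq 2$ and let $(i_1,i_2,\ldots,i_m)$ be a finite sequence with $\{i_1,i_2,\ldots,i_m\}=\{1,2,\ldots,k\}$ such that there is an index $p$ with $i_p\neq i_q$ for all $q\neq p$. Consider the generalized Jordan product $$T_1\circ T_2\circ\cdots\circ T_k= T_{i_1}T_{i_2}\cdots T_{i_m}+T_{i_m}\cdots T_{i_2}T_{i_1}.$$ Let $\Phi:\mathcal{A}_1\rightarrow\mathcal{A}_2$ be a map (not assumed linear, additive or continuous) whose range contains all operators in $\mathcal{A}_2$ of rank at most three. Then $\Phi$ satisfies $$\sigma_\pi(\Phi(A_1)\circ\cdots\circ\Phi(A_k))=\sigma_\pi(A_1\circ\cdots\circ A_k)$$ for all $A_1,\ldots,A_k\in\mathcal{A}_1$ if and only if one of the following conditions holds. (1) There exist a scalar $\lambda\in\mathbb{C}$ with $\lambda^m=1$ and an invertible operator $T\in\mathcal{B}(X_1,X_2)$ such that $\Phi(A)=\lambda TAT^{-1}$ for all $A\in\mathcal{A}_1$. (2) The spaces $X_1$ and $X_2$ are reflexive, and there exist a scalar $\lambda\in\mathbb{C}$ with $\lambda^m=1$ and an invertible operator $T\in\mathcal{B}(X_1^*,X_2)$ such that $\Phi(A)=\lambda TA^*T^{-1}$ for all $A\in\mathcal{A}_1$.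
   Context: $\mathcal{B}(X,Y)$ is the space of bounded linear operators from $X$ to $Y$, and $\mathcal{B}(X)=\mathcal{B}(X,X)$. A standard operator algebra on a complex Banach space $X$ is a subalgebra of $\mathcal{B}(X)$ containing all continuous finite rank operators on $X$. For $T\in\mathcal{B}(X)$, $\sigma(T)$ denotes the spectrum and $r(T)$ the spectral radius of $T$, and the peripheral spectrum is $\sigma_\pi(T)=\{z\in\sigma(T):|z|=r(T)\}$. $X^*$ is the dual space and $A^*$ is the Banach space adjoint of $A$. *)

theory Defs
  imports "HOL-Analysis.Analysis"
begin

class complex_normed_vector = real_normed_vector +
  fixes scaleC :: "complex \<Rightarrow> 'a \<Rightarrow> 'a"  (infixr "*\<^sub>C" 75)
  assumes scaleC_add_right: "c *\<^sub>C (x + y) = c *\<^sub>C x + c *\<^sub>C y"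
    and scaleC_add_left: "(c + d) *\<^sub>C x = c *\<^sub>C x + d *\<^sub>C x"
    and scaleC_scaleC: "c *\<^sub>C (d *\<^sub>C x) = (c * d) *\<^sub>C x"
    and scaleC_one: "1 *\<^sub>C x = x"
    and scaleR_scaleC: "r *\<^sub>R x = complex_of_real r *\<^sub>C x"
    and norm_scaleC: "norm (c *\<^sub>C x) = cmod c * norm x"

class complex_banach = complex_normed_vector + banach

global_interpretation complex_vector:
  vector_space "scaleC :: complex \<Rightarrow> 'a \<Rightarrow> 'a::complex_normed_vector"
  by unfold_locales
    (simp_all add: scaleC_add_right scaleC_add_left scaleC_scaleC scaleC_one)

instantiation complex :: complex_banach
begin

definition scaleC_complex :: "complex \<Rightarrow> complex \<Rightarrow> complex"
  where "scaleC_complex c x = c * x"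

instance
  by standard (simp_all add: scaleC_complex_def algebra_simps norm_mult scaleR_conv_of_real)

end


subsection \<open>Bounded complex-linear operators\<close>

text \<open>The real bounded operators that commute with complex scalars; the norm and the
  real vector space structure are those of the type of real bounded operators.\<close>

typedef (overloaded) ('a, 'b) cblinfun =
  "{f :: 'a::complex_normed_vector \<Rightarrow>\<^sub>L 'b::complex_normed_vector.
     \<forall>c x. f (c *\<^sub>C x) = c *\<^sub>C f x}"
  morphisms blinfun_of_cblinfun cblinfun_of_blinfun
  by (rule exI[of _ 0]) simp

type_notation cblinfun (infixr "\<Rightarrow>\<^sub>B" 18)

type_synonym 'a dual = "('a, complex) cblinfun"

setup_lifting type_definition_cblinfun

definition cblinfun_apply :: "('a::complex_normed_vector \<Rightarrow>\<^sub>B 'b::complex_normed_vector) \<Rightarrow> 'a \<Rightarrow> 'b"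
  where "cblinfun_apply f = blinfun_apply (blinfun_of_cblinfun f)"

lemma cblinfun_eqI: "(\<And>x. cblinfun_apply f x = cblinfun_apply g x) \<Longrightarrow> f = g"
  by (simp add: cblinfun_apply_def blinfun_eqI blinfun_of_cblinfun_inject[symmetric])

lemma cblinfun_apply_scaleC: "cblinfun_apply f (c *\<^sub>C x) = c *\<^sub>C cblinfun_apply f x"
  using blinfun_of_cblinfun[of f] by (simp add: cblinfun_apply_def)

lemma bounded_linear_cblinfun_apply: "bounded_linear (cblinfun_apply f)"
  by (simp add: cblinfun_apply_def blinfun.bounded_linear_right)

lemma bounded_linear_scaleC: "bounded_linear (\<lambda>x. c *\<^sub>C (x::'a::complex_normed_vector))"
  by (rule bounded_linear_intro[where K = "cmod c"])
    (simp_all add: scaleC_add_right scaleR_scaleC scaleC_scaleC norm_scaleC mult.commute)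

instantiation cblinfun :: (complex_normed_vector, complex_normed_vector) complex_normed_vector
begin

lift_definition zero_cblinfun :: "'a \<Rightarrow>\<^sub>B 'b" is 0
  by simp

lift_definition plus_cblinfun :: "'a \<Rightarrow>\<^sub>B 'b \<Rightarrow> 'a \<Rightarrow>\<^sub>B 'b \<Rightarrow> 'a \<Rightarrow>\<^sub>B 'b" is "(+)"
  by (simp add: blinfun.bilinear_simps complex_vector.scale_right_distrib)

lift_definition minus_cblinfun :: "'a \<Rightarrow>\<^sub>B 'b \<Rightarrow> 'a \<Rightarrow>\<^sub>B 'b \<Rightarrow> 'a \<Rightarrow>\<^sub>B 'b" is "(-)"
  by (simp add: blinfun.bilinear_simps complex_vector.scale_right_diff_distrib)

lift_definition uminus_cblinfun :: "'a \<Rightarrow>\<^sub>B 'b \<Rightarrow> 'a \<Rightarrow>\<^sub>B 'b" is uminus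
  by (simp add: blinfun.bilinear_simps)

lift_definition scaleR_cblinfun :: "real \<Rightarrow> 'a \<Rightarrow>\<^sub>B 'b \<Rightarrow> 'a \<Rightarrow>\<^sub>B 'b" is scaleR
  by (simp add: blinfun.bilinear_simps scaleR_scaleC scaleC_scaleC mult.commute)

lift_definition scaleC_cblinfun :: "complex \<Rightarrow> 'a \<Rightarrow>\<^sub>B 'b \<Rightarrow> 'a \<Rightarrow>\<^sub>B 'b"
  is "\<lambda>c f. Blinfun (\<lambda>x. c *\<^sub>C blinfun_apply f x)"
  by (simp add: bounded_linear_Blinfun_apply bounded_linear_compose[OF bounded_linear_scaleC]
      blinfun.bounded_linear_right scaleC_scaleC mult.commute)

lift_definition norm_cblinfun :: "'a \<Rightarrow>\<^sub>B 'b \<Rightarrow> real" is norm .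

definition dist_cblinfun :: "'a \<Rightarrow>\<^sub>B 'b \<Rightarrow> 'a \<Rightarrow>\<^sub>B 'b \<Rightarrow> real"
  where "dist_cblinfun f g = norm (f - g)"

definition sgn_cblinfun :: "'a \<Rightarrow>\<^sub>B 'b \<Rightarrow> 'a \<Rightarrow>\<^sub>B 'b"
  where "sgn_cblinfun f = inverse (norm f) *\<^sub>R f"

definition uniformity_cblinfun :: "(('a \<Rightarrow>\<^sub>B 'b) \<times> ('a \<Rightarrow>\<^sub>B 'b)) filter"
  where "uniformity_cblinfun = (INF e\<in>{0 <..}. principal {(x, y). dist x y < e})"

definition open_cblinfun :: "('a \<Rightarrow>\<^sub>B 'b) set \<Rightarrow> bool"
  where "open_cblinfun S = (\<forall>x\<in>S. \<forall>\<^sub>F (x', y) in uniformity. x' = x \<longrightarrow> y \<in> S)"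

lemma blinfun_scaleC_apply:
  "blinfun_apply (Blinfun (\<lambda>x. c *\<^sub>C blinfun_apply f x)) x
    = c *\<^sub>C blinfun_apply (f :: 'a \<Rightarrow>\<^sub>L 'b) x"
  by (simp add: bounded_linear_Blinfun_apply bounded_linear_compose[OF bounded_linear_scaleC]
      blinfun.bounded_linear_right)

lemma norm_blinfun_scaleC:
  "norm (Blinfun (\<lambda>x. c *\<^sub>C blinfun_apply f x)) = cmod c * norm (f :: 'a \<Rightarrow>\<^sub>L 'b)"
proof (rule antisym)
  show le: "norm (Blinfun (\<lambda>x. c *\<^sub>C blinfun_apply f x)) \<le> cmod c * norm f" for c and f :: "'a \<Rightarrow>\<^sub>L 'b"
    by (rule norm_blinfun_bound)
      (simp_all add: blinfun_scaleC_apply norm_scaleC norm_blinfun mult_left_mono mult.assoc)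
  show "cmod c * norm f \<le> norm (Blinfun (\<lambda>x. c *\<^sub>C blinfun_apply f x))"
  proof (cases "c = 0")
    case False
    define g where "g = Blinfun (\<lambda>x. c *\<^sub>C blinfun_apply f x)"
    have "f = Blinfun (\<lambda>x. inverse c *\<^sub>C blinfun_apply g x)"
      by (rule blinfun_eqI)
        (simp only: blinfun_scaleC_apply g_def,
          simp add: False scaleC_scaleC scaleC_one blinfun_apply_inverse)
    then have "norm f \<le> cmod (inverse c) * norm g"
      using le[of "inverse c" g] by simp
    then show ?thesis
      using False by (simp add: g_def[symmetric] norm_divide field_simps)
  qed simp
qed

lemma cblinfun_apply_add:
  "cblinfun_apply (f + g) x = cblinfun_apply f x + cblinfun_apply (g :: 'a \<Rightarrow>\<^sub>B 'b) x"
  by (simp add: cblinfun_apply_def plus_cblinfun.rep_eq blinfun.add_left)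

lemma cblinfun_apply_diff:
  "cblinfun_apply (f - g) x = cblinfun_apply f x - cblinfun_apply (g :: 'a \<Rightarrow>\<^sub>B 'b) x"
  by (simp add: cblinfun_apply_def minus_cblinfun.rep_eq blinfun.diff_left)

lemma cblinfun_apply_scaleR:
  "cblinfun_apply (r *\<^sub>R f) x = r *\<^sub>R cblinfun_apply (f :: 'a \<Rightarrow>\<^sub>B 'b) x"
  by (simp add: cblinfun_apply_def scaleR_cblinfun.rep_eq blinfun.scaleR_left)

lemma cblinfun_apply_cscale:
  "cblinfun_apply (c *\<^sub>C f) x = c *\<^sub>C cblinfun_apply (f :: 'a \<Rightarrow>\<^sub>B 'b) x"
  by (simp add: cblinfun_apply_def scaleC_cblinfun.rep_eq blinfun_scaleC_apply)

instance
proof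
  fix x y z :: "'a \<Rightarrow>\<^sub>B 'b" and r s :: real and c d :: complex
  show "x + y + z = x + (y + z)" by transfer simp
  show "x + y = y + x" by transfer simp
  show "0 + x = x" by transfer simp
  show "- x + x = 0" by transfer simp
  show "x - y = x + - y" by transfer simp
  show "r *\<^sub>R (x + y) = r *\<^sub>R x + r *\<^sub>R y" by transfer (simp add: scaleR_right_distrib)
  show "(r + s) *\<^sub>R x = r *\<^sub>R x + s *\<^sub>R x" by transfer (simp add: scaleR_left_distrib)
  show "r *\<^sub>R s *\<^sub>R x = (r * s) *\<^sub>R x" by transfer simp
  show "1 *\<^sub>R x = x" by transfer simp
  show "dist x y = norm (x - y)" by (fact dist_cblinfun_def)
  show "sgn x = inverse (norm x) *\<^sub>R x" by (fact sgn_cblinfun_def)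
  show "uniformity = (INF e\<in>{0 <..}. principal {(x :: 'a \<Rightarrow>\<^sub>B 'b, y). dist x y < e})"
    by (fact uniformity_cblinfun_def)
  show "open U = (\<forall>x\<in>U. \<forall>\<^sub>F (x', y) in uniformity. x' = x \<longrightarrow> y \<in> U)"
    for U :: "('a \<Rightarrow>\<^sub>B 'b) set" by (fact open_cblinfun_def)
  show "norm x = 0 \<longleftrightarrow> x = 0" by transfer simp
  show "norm (x + y) \<le> norm x + norm y" by transfer (rule norm_triangle_ineq)
  show "norm (r *\<^sub>R x) = \<bar>r\<bar> * norm x" by transfer simp
  show "c *\<^sub>C (x + y) = c *\<^sub>C x + c *\<^sub>C y"
    by (rule cblinfun_eqI) (simp add: cblinfun_apply_add cblinfun_apply_cscale cblinfun_apply_scaleR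
        scaleC_add_right)
  show "(c + d) *\<^sub>C x = c *\<^sub>C x + d *\<^sub>C x"
    by (rule cblinfun_eqI) (simp add: cblinfun_apply_add cblinfun_apply_cscale cblinfun_apply_scaleR
        scaleC_add_left)
  show "c *\<^sub>C d *\<^sub>C x = (c * d) *\<^sub>C x"
    by (rule cblinfun_eqI) (simp add: cblinfun_apply_add cblinfun_apply_cscale cblinfun_apply_scaleR
        scaleC_scaleC)
  show "1 *\<^sub>C x = x"
    by (rule cblinfun_eqI) (simp add: cblinfun_apply_add cblinfun_apply_cscale cblinfun_apply_scaleR
        scaleC_one)
  show "r *\<^sub>R x = complex_of_real r *\<^sub>C x"
    by (rule cblinfun_eqI) (simp add: cblinfun_apply_add cblinfun_apply_cscale cblinfun_apply_scaleR
        scaleR_scaleC)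
  show "norm (c *\<^sub>C x) = cmod c * norm x"
    by transfer (rule norm_blinfun_scaleC)
qed

end

lemma norm_cblinfun_apply: "norm (cblinfun_apply f x) \<le> norm f * norm x"
  by (simp add: cblinfun_apply_def norm_cblinfun.rep_eq norm_blinfun)

instance cblinfun :: (complex_normed_vector, complex_banach) complex_banach
proof
  fix X :: "nat \<Rightarrow> 'a \<Rightarrow>\<^sub>B 'b"
  let ?R = "blinfun_of_cblinfun :: ('a \<Rightarrow>\<^sub>B 'b) \<Rightarrow> _"
  assume X: "Cauchy X"
  have d: "dist (?R f) (?R g) = dist f g" for f g
    by (simp add: dist_norm norm_cblinfun.rep_eq minus_cblinfun.rep_eq)
  from X have "Cauchy (\<lambda>n. ?R (X n))"
    by (simp add: Cauchy_def d)
  then obtain L where L: "(\<lambda>n. ?R (X n)) \<longlonglongrightarrow> L"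
    by (auto simp: Cauchy_convergent_iff convergent_def)
  have lim: "(\<lambda>n. ?R (X n) x) \<longlonglongrightarrow> L x" for x
    using L by (intro tendsto_intros)
  have "L (c *\<^sub>C x) = c *\<^sub>C L x" for c x
  proof (rule LIMSEQ_unique[OF lim])
    show "(\<lambda>n. ?R (X n) (c *\<^sub>C x)) \<longlonglongrightarrow> c *\<^sub>C L x"
      using bounded_linear.tendsto[OF bounded_linear_scaleC lim[of x], of c]
      by (simp add: cblinfun_apply_scaleC[unfolded cblinfun_apply_def])
  qed
  then have "?R (cblinfun_of_blinfun L) = L"
    by (simp add: cblinfun_of_blinfun_inverse)
  then have "X \<longlonglongrightarrow> cblinfun_of_blinfun L"
    using L by (simp add: tendsto_iff flip: d)
  then show "convergent X"
    by (auto simp: convergent_def)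
qed

definition cblinfun_id :: "'a::complex_normed_vector \<Rightarrow>\<^sub>B 'a"
  where "cblinfun_id = cblinfun_of_blinfun id_blinfun"

lemma cblinfun_id_apply: "cblinfun_apply cblinfun_id x = x"
  by (simp add: cblinfun_id_def cblinfun_apply_def cblinfun_of_blinfun_inverse)

lift_definition cblinfun_compose ::
  "('b::complex_normed_vector \<Rightarrow>\<^sub>B 'c::complex_normed_vector) \<Rightarrow>
   ('a::complex_normed_vector \<Rightarrow>\<^sub>B 'b) \<Rightarrow> 'a \<Rightarrow>\<^sub>B 'c"  (infixl "o\<^sub>C" 67)
  is "(o\<^sub>L)"
  by simp

lemma cblinfun_compose_apply:
  "cblinfun_apply (f o\<^sub>C g) x = cblinfun_apply f (cblinfun_apply g x)"
  by (simp add: cblinfun_apply_def cblinfun_compose.rep_eq)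

definition is_inverse_operator ::
  "('a::complex_normed_vector \<Rightarrow>\<^sub>B 'b::complex_normed_vector) \<Rightarrow> ('b \<Rightarrow>\<^sub>B 'a) \<Rightarrow> bool"
  where "is_inverse_operator T S \<longleftrightarrow> T o\<^sub>C S = cblinfun_id \<and> S o\<^sub>C T = cblinfun_id"

definition invertible_operator ::
  "('a::complex_normed_vector \<Rightarrow>\<^sub>B 'b::complex_normed_vector) \<Rightarrow> bool"
  where "invertible_operator T \<longleftrightarrow> (\<exists>S. is_inverse_operator T S)"

definition inverse_operator ::
  "('a::complex_normed_vector \<Rightarrow>\<^sub>B 'b::complex_normed_vector) \<Rightarrow> 'b \<Rightarrow>\<^sub>B 'a"
  where "inverse_operator T = (THE S. is_inverse_operator T S)"

lemma inverse_operator_eqI: "is_inverse_operator T S \<Longrightarrow> inverse_operator T = S"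
  unfolding inverse_operator_def is_inverse_operator_def
  by (rule the_equality)
    (auto intro!: cblinfun_eqI, metis cblinfun_compose_apply cblinfun_id_apply)

definition adjoint_operator ::
  "('a::complex_normed_vector \<Rightarrow>\<^sub>B 'b::complex_normed_vector) \<Rightarrow> 'b dual \<Rightarrow>\<^sub>B 'a dual"
  where "adjoint_operator A = cblinfun_of_blinfun (Blinfun (\<lambda>f. f o\<^sub>C A))"

lemma adjoint_operator_apply: "cblinfun_apply (adjoint_operator A) f = f o\<^sub>C A"
proof -
  have "bounded_linear (\<lambda>f :: 'b dual. f o\<^sub>C A)"
  proof (rule bounded_linear_intro[where K = "norm A"])
    show "norm (f o\<^sub>C A) \<le> norm f * norm A" for f :: "'b dual"
      by transfer (rule norm_blinfun_compose)
  qed (transfer, auto intro!: blinfun_eqI simp: blinfun.bilinear_simps)+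
  moreover have "(c *\<^sub>C f) o\<^sub>C A = c *\<^sub>C (f o\<^sub>C A)" for c and f :: "'b dual"
    by (rule cblinfun_eqI) (simp add: cblinfun_compose_apply cblinfun_apply_cscale)
  ultimately show ?thesis
    by (simp add: adjoint_operator_def cblinfun_apply_def cblinfun_of_blinfun_inverse
        bounded_linear_Blinfun_apply)
qed

definition canonical_embedding :: "'a::complex_normed_vector \<Rightarrow> 'a dual dual"
  where "canonical_embedding x = cblinfun_of_blinfun (Blinfun (\<lambda>f. cblinfun_apply f x))"

lemma canonical_embedding_apply:
  "cblinfun_apply (canonical_embedding x) f = cblinfun_apply f x"
proof -
  have "bounded_linear (\<lambda>f :: 'a dual. cblinfun_apply f x)"
  proof (rule bounded_linear_intro[where K = "norm x"])
    show "norm (cblinfun_apply f x) \<le> norm f * norm x" for f :: "'a dual"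
      by (rule norm_cblinfun_apply)
  qed (simp_all add: cblinfun_apply_add cblinfun_apply_cscale scaleR_scaleC)
  then show ?thesis
    by (simp add: canonical_embedding_def cblinfun_apply_def cblinfun_of_blinfun_inverse
        bounded_linear_Blinfun_apply cblinfun_apply_cscale[unfolded cblinfun_apply_def])
qed

definition reflexive_space :: "'a::complex_normed_vector itself \<Rightarrow> bool"
  where "reflexive_space _ \<longleftrightarrow> surj (canonical_embedding :: 'a \<Rightarrow> 'a dual dual)"


subsection \<open>Dimension, rank and standard operator algebras\<close>

text \<open>\<open>complex_vector.dim\<close> is 0 on infinite-dimensional spaces, so lower bounds on the
  dimension go through independent sets and upper bounds on the rank carry \<open>finite_rank\<close>.\<close>

definition complex_dim_ge :: "'a::complex_normed_vector itself \<Rightarrow> nat \<Rightarrow> bool"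
  where "complex_dim_ge _ n \<longleftrightarrow>
    (\<exists>B :: 'a set. complex_vector.independent B \<and> finite B \<and> card B = n)"

definition finite_rank :: "('a::complex_normed_vector \<Rightarrow>\<^sub>B 'b::complex_normed_vector) \<Rightarrow> bool"
  where "finite_rank A \<longleftrightarrow> (\<exists>B. finite B \<and> range (cblinfun_apply A) \<subseteq> complex_vector.span B)"

definition operator_rank :: "('a::complex_normed_vector \<Rightarrow>\<^sub>B 'b::complex_normed_vector) \<Rightarrow> nat"
  where "operator_rank A = complex_vector.dim (range (cblinfun_apply A))"

definition standard_operator_algebra :: "('a::complex_normed_vector \<Rightarrow>\<^sub>B 'a) set \<Rightarrow> bool"
  where "standard_operator_algebra \<A> \<longleftrightarrow>
    complex_vector.subspace \<A> \<and>
    (\<forall>A\<in>\<A>. \<forall>B\<in>\<A>. A o\<^sub>C B \<in> \<A>) \<and>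
    {A. finite_rank A} \<subseteq> \<A>"


subsection \<open>Peripheral spectrum\<close>

definition operator_spectrum :: "('a::complex_normed_vector \<Rightarrow>\<^sub>B 'a) \<Rightarrow> complex set"
  where "operator_spectrum T = {z. \<not> invertible_operator (T - z *\<^sub>C cblinfun_id)}"

definition operator_spectral_radius :: "('a::complex_normed_vector \<Rightarrow>\<^sub>B 'a) \<Rightarrow> real"
  where "operator_spectral_radius T = (SUP z\<in>operator_spectrum T. cmod z)"

definition peripheral_spectrum :: "('a::complex_normed_vector \<Rightarrow>\<^sub>B 'a) \<Rightarrow> complex set"
  where "peripheral_spectrum T =
    {z \<in> operator_spectrum T. cmod z = operator_spectral_radius T}"


subsection \<open>Generalized Jordan product\<close>

definition operator_product :: "('a::complex_normed_vector \<Rightarrow>\<^sub>B 'a) list \<Rightarrow> 'a \<Rightarrow>\<^sub>B 'a"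
  where "operator_product Ts = foldr (o\<^sub>C) Ts cblinfun_id"

definition generalized_jordan_product ::
  "nat list \<Rightarrow> (nat \<Rightarrow> 'a::complex_normed_vector \<Rightarrow>\<^sub>B 'a) \<Rightarrow> 'a \<Rightarrow>\<^sub>B 'a"
  where "generalized_jordan_product is T =
    operator_product (map T is) + operator_product (map T (rev is))"

end

theory Submission
  imports Defs
begin

text \<open>
  With \<open>A\<close> in the unrepeated position and \<open>B\<close> in all others the product is
  \<open>B^r A B^s + B^s A B^r\<close>, where \<open>r \<ge> s\<close> without loss of generality.

  If \<open>s = 0\<close>, then \<open>A\<close> is of the form \<open>x \<otimes> f\<close> with \<open>f x = 0\<close> iff the peripheral spectrum is a
  singleton for every \<open>B\<close> of rank at most two, and it is then \<open>{f (B^r x)}\<close>. If \<open>s > 0\<close>, a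
  non-nilpotent \<open>B\<close> such that the peripheral spectrum is a singleton for every \<open>A\<close> of rank at most
  two determines a rank-one operator \<open>y \<otimes> h\<close> with \<open>h y \<noteq> 0\<close>, and the singleton is
  \<open>{2 h (A y)}\<close>. In both cases the preserver yields a correspondence between rank-one nilpotents
  \<open>x \<otimes> f\<close> and \<open>u \<otimes> g\<close> such that \<open>f (A^r x) = g ((\<Phi> A)^r u)\<close> when \<open>s = 0\<close>, and
  \<open>f (A x) = g (\<Phi> A u)\<close> when \<open>s > 0\<close>.

  If \<open>(\<Phi> A)^r\<close>, respectively \<open>\<Phi> A\<close>, is replaced by \<open>v \<otimes> h\<close>, this trace becomes \<open>g v * h u\<close>, a
  rank-one bilinear form in \<open>(v, h)\<close> that depends bilinearly on \<open>(x, f)\<close>. This forces, up to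
  scalars, either \<open>u\<close> to be linear in \<open>x\<close> and \<open>g\<close> in \<open>f\<close>, or \<open>u\<close> to be linear in \<open>f\<close> and \<open>g\<close> in
  \<open>x\<close>; by uniform boundedness these maps are isomorphisms, and the second case forces reflexivity.
  After composing with them \<open>\<Phi>\<close> acts on a single space, and comparing the peripheral spectra at
  rank-one idempotents shows that it multiplies by a root of unity.
\<close>

text \<open>Additivity of \<open>\<Phi>\<close> is never proved on its own. What is linear from the
  start is the trace \<open>f (A x)\<close> in \<open>x\<close> and in \<open>f\<close>, and the
  images of rank-one operators contribute that the forms in question have rank one. Nilpotents carry
  the argument because, for \<open>s = 0\<close>, the product with \<open>x \<otimes> f\<close> has
  the eigenvalues \<open>f (B^r x) \<plusminus> sqrt (f x * f (B^(2 r) x))\<close>: they merge for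
  every \<open>B\<close> when \<open>f x = 0\<close>, and otherwise suitable \<open>B\<close> pull
  them apart. The price is that traces at nilpotents see an operator only up to multiples of the
  identity. Even after the spaces are identified, an unknown scalar summand has to be excluded by a
  separate spectral test. Dimension three matters in three places: it puts 0 into the spectrum of
  every operator of rank two; it rules out the mixed alternative in which \<open>g\<close> keeps its
  direction both when only \<open>x\<close> varies and when only \<open>f\<close> varies; and it
  leaves room for three peripheral values, one more than an operator of rank two can have.\<close>

declare [[coercion "cblinfun_apply ::
  ('a::complex_normed_vector \<Rightarrow>\<^sub>B 'b::complex_normed_vector) \<Rightarrow> 'a \<Rightarrow> 'b"]]

section \<open>Bounded operators\<close>

declare scaleC_complex_def [simp] scaleC_one [simp] cblinfun_apply_add [simp]
  cblinfun_apply_diff [simp] cblinfun_apply_cscale [simp] cblinfun_id_apply [simp]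
  cblinfun_compose_apply [simp] cblinfun_apply_scaleC [simp] scaleC_scaleC [simp]

lemma cblinfun_linear_simps [simp]:
  fixes f :: "'a::complex_normed_vector \<Rightarrow>\<^sub>B 'b::complex_normed_vector"
  shows "f (x + y) = f x + f y" "f (x - y) = f x - f y" "f (- x) = - f x" "f 0 = 0"
  by (simp_all add: bounded_linear_cblinfun_apply linear_simps)

lemma cblinfun_apply_zero [simp]: "(0 :: 'a::complex_normed_vector \<Rightarrow>\<^sub>B 'b::complex_normed_vector) x = 0"
  by (simp add: cblinfun_apply_def zero_cblinfun.rep_eq)

lemma cblinfun_apply_uminus [simp]: "cblinfun_apply (- f) x = - cblinfun_apply f x"
  by (simp add: cblinfun_apply_def uminus_cblinfun.rep_eq blinfun.minus_left)

lemma cblinfun_cong: "f = g \<Longrightarrow> cblinfun_apply f x = cblinfun_apply g x"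
  by simp

lemma scaleC_zero_simps [simp]: "0 *\<^sub>C x = 0" "c *\<^sub>C 0 = (0::'a::complex_normed_vector)"
  by simp_all

lemma scaleC_minus_simps [simp]:
  "(- c) *\<^sub>C x = - (c *\<^sub>C x)" "c *\<^sub>C (- x) = - (c *\<^sub>C (x::'a::complex_normed_vector))"
  by simp_all

definition cblinfun_of_fun ::
  "('a::complex_normed_vector \<Rightarrow> 'b::complex_normed_vector) \<Rightarrow> 'a \<Rightarrow>\<^sub>B 'b"
  where "cblinfun_of_fun f = cblinfun_of_blinfun (Blinfun f)"

lemma cblinfun_of_fun_apply:
  assumes add: "\<And>x y. f (x + y) = f x + f y" and scale: "\<And>c x. f (c *\<^sub>C x) = c *\<^sub>C f x"
    and bound: "\<And>x. norm (f x) \<le> norm x * M"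
  shows "cblinfun_apply (cblinfun_of_fun f) = f"
proof -
  have "bounded_linear f"
    by (rule bounded_linear_intro[where K = M]) (simp_all add: assms scaleR_scaleC)
  then show ?thesis
    by (simp add: cblinfun_of_fun_def cblinfun_apply_def cblinfun_of_blinfun_inverse scale
        bounded_linear_Blinfun_apply)
qed

section \<open>Operators of rank one\<close>

definition rank_one ::
  "'b::complex_normed_vector \<Rightarrow> 'a::complex_normed_vector dual \<Rightarrow> 'a \<Rightarrow>\<^sub>B 'b"
  where "rank_one u g = cblinfun_of_fun (\<lambda>v. g v *\<^sub>C u)"

lemma rank_one_apply [simp]: "rank_one u g v = g v *\<^sub>C u"
  unfolding rank_one_def
  by (subst cblinfun_of_fun_apply[where M = "norm g * norm u"])
    (auto simp: scaleC_add_left norm_scaleC mult_right_mono mult.commute[of "norm v"]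
       intro: order_trans[OF mult_right_mono[OF norm_cblinfun_apply]])

lemma compose_rank_one: "A o\<^sub>C rank_one u g = rank_one (A u) g"
  by (rule cblinfun_eqI) simp

lemma rank_one_compose: "rank_one u g o\<^sub>C A = rank_one u (g o\<^sub>C A)"
  by (rule cblinfun_eqI) simp

lemma rank_one_eq_0_iff: "rank_one u g = 0 \<longleftrightarrow> u = 0 \<or> g = 0"
proof
  assume "rank_one u g = 0"
  then have "g v *\<^sub>C u = 0" for v
    using rank_one_apply[of u g v] by simp
  then show "u = 0 \<or> g = 0"
    by (auto intro!: cblinfun_eqI)
qed (auto intro!: cblinfun_eqI)

lemma cblinfun_compose_assoc: "A o\<^sub>C B o\<^sub>C C = A o\<^sub>C (B o\<^sub>C C)"
  by (rule cblinfun_eqI) simp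

lemma cblinfun_compose_id [simp]: "A o\<^sub>C cblinfun_id = A" "cblinfun_id o\<^sub>C A = A"
  by (rule cblinfun_eqI, simp)+

section \<open>The Hahn--Banach theorem and separation of points\<close>

text \<open>Only an inequality is demanded for \<open>t > 0\<close>: applied to
  \<open>inverse t\<close> it yields equality, and the weak form is easily checked for
  infima.\<close>

definition sublinear :: "('a::real_vector \<Rightarrow> real) \<Rightarrow> bool"
  where "sublinear p \<longleftrightarrow> (\<forall>x y. p (x + y) \<le> p x + p y) \<and> (\<forall>t>0. \<forall>x. p (t *\<^sub>R x) \<le> t * p x)"

lemma sublinear_0: assumes "sublinear p" shows "p 0 = 0"
proof -
  have "p (2 *\<^sub>R 0) \<le> 2 * p 0" "p ((1/2) *\<^sub>R 0) \<le> (1/2) * p 0"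
    using assms unfolding sublinear_def by (metis zero_less_numeral, metis half_gt_zero zero_less_one)
  then show ?thesis by simp
qed

lemma sublinear_scale: assumes "sublinear p" "t > 0" shows "p (t *\<^sub>R x) = t * p x"
proof (rule antisym)
  show "p (t *\<^sub>R x) \<le> t * p x" using assms by (simp add: sublinear_def)
  have "p (inverse t *\<^sub>R (t *\<^sub>R x)) \<le> inverse t * p (t *\<^sub>R x)"
    using assms by (simp add: sublinear_def del: scaleR_scaleR)
  then show "t * p x \<le> p (t *\<^sub>R x)" using assms(2) by (simp add: field_simps)
qed

lemma sublinear_uminus: assumes "sublinear p" shows "- p (- x) \<le> p x"
proof -
  have "p (x + - x) \<le> p x + p (- x)" using assms unfolding sublinear_def by blast
  then show ?thesis using sublinear_0[OF assms] by simp
qed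

text \<open>The infimum of \<open>p (x + t y) - t p y\<close> over \<open>t \<ge> 0\<close> is
  bounded below by \<open>- p (- x)\<close>, by subadditivity. The value \<open>t = 0\<close> gives
  \<open>q \<le> p\<close>, and \<open>t = 1\<close> at the point \<open>- y\<close> gives the last
  claim. This takes the place of the one-dimensional extension step in the usual proof of the
  Hahn-Banach theorem.\<close>

lemma sublinear_reduce:
  fixes p :: "'a::real_vector \<Rightarrow> real"
  assumes p: "sublinear p"
  obtains q where "sublinear q" "\<And>x. q x \<le> p x" "q (- y) \<le> - p y"
proof -
  define q where "q x = (INF t\<in>{0..}. p (x + t *\<^sub>R y) - t * p y)" for x
  have add: "p (a + b) \<le> p a + p b" for a b using p by (simp add: sublinear_def)
  have scale0: "p (t *\<^sub>R x) = t * p x" if "t \<ge> 0" for t x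
    using sublinear_scale[OF p] sublinear_0[OF p] that by (cases "t = 0") auto
  have bdd: "bdd_below ((\<lambda>t. p (x + t *\<^sub>R y) - t * p y) ` {0..})" for x
  proof (rule bdd_belowI2)
    fix t :: real assume "t \<in> {0..}"
    then show "- p (- x) \<le> p (x + t *\<^sub>R y) - t * p y"
      using add[of "x + t *\<^sub>R y" "- x"] scale0[of t y] by simp
  qed
  have le: "q x \<le> p (x + t *\<^sub>R y) - t * p y" if "t \<ge> 0" for x t
    unfolding q_def by (rule cINF_lower[OF bdd]) (use that in auto)
  have "q (a + b) \<le> q a + q b" for a b
  proof -
    have 1: "q (a + b) \<le> (p (a + s *\<^sub>R y) - s * p y) + (p (b + t *\<^sub>R y) - t * p y)"
      if "s \<ge> 0" "t \<ge> 0" for s t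
      using le[of "s + t" "a + b"] add[of "a + s *\<^sub>R y" "b + t *\<^sub>R y"] that
      by (simp add: algebra_simps)
    have "q (a + b) - (p (a + s *\<^sub>R y) - s * p y) \<le> q b" if "s \<ge> 0" for s
      unfolding q_def[of b] by (intro cINF_greatest) (use 1[OF that] in \<open>auto simp: algebra_simps\<close>)
    then have "q (a + b) - q b \<le> q a"
      unfolding q_def[of a] by (intro cINF_greatest) (auto simp: algebra_simps)
    then show ?thesis by simp
  qed
  moreover have "q (s *\<^sub>R x) \<le> s * q x" if "s > 0" for s x
  proof -
    have "q (s *\<^sub>R x) / s \<le> p (x + t *\<^sub>R y) - t * p y" if "t \<ge> 0" for t
      using le[of "s * t" "s *\<^sub>R x"] scale0[of s "x + t *\<^sub>R y"] that \<open>s > 0\<close>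
      by (simp add: field_simps scaleR_right_distrib)
    then have "q (s *\<^sub>R x) / s \<le> q x"
      unfolding q_def[of x] by (intro cINF_greatest) auto
    then show ?thesis using that by (simp add: field_simps)
  qed
  ultimately have "sublinear q" by (simp add: sublinear_def)
  moreover have "q x \<le> p x" for x using le[of 0 x] by simp
  moreover have "q (- y) \<le> - p y" using le[of 1 "- y"] sublinear_0[OF p] by simp
  ultimately show ?thesis using that by blast
qed

text \<open>Pointwise infima need not be subadditive, but in a chain \<open>p a + q b\<close>
  dominates \<open>r a + r b\<close> for the smaller \<open>r\<close> of \<open>p\<close> and
  \<open>q\<close>. The common majorant \<open>p0\<close> keeps the infima finite through
  \<open>p x \<ge> - p0 (- x)\<close>.\<close>

lemma sublinear_INF_chain:
  fixes C :: "('a::real_vector \<Rightarrow> real) set"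
  assumes sub: "\<And>p. p \<in> C \<Longrightarrow> sublinear p" and le: "\<And>p x. p \<in> C \<Longrightarrow> p x \<le> p0 x"
    and chain: "\<And>p q. p \<in> C \<Longrightarrow> q \<in> C \<Longrightarrow> (\<forall>x. p x \<le> q x) \<or> (\<forall>x. q x \<le> p x)" and "C \<noteq> {}"
  shows "sublinear (\<lambda>x. INF p\<in>C. p x)" and "\<And>p x. p \<in> C \<Longrightarrow> (INF p\<in>C. p x) \<le> p x"
proof -
  define u where "u x = (INF p\<in>C. p x)" for x
  have bdd: "bdd_below ((\<lambda>p. p x) ` C)" for x
  proof (rule bdd_belowI2)
    fix p assume "p \<in> C"
    then show "- p0 (- x) \<le> p x"
      using sublinear_uminus[OF sub, of p x] le[of p "- x"] by simp
  qed
  have ule: "u x \<le> p x" if "p \<in> C" for p x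
    unfolding u_def by (rule cINF_lower[OF bdd that])
  then show "\<And>p x. p \<in> C \<Longrightarrow> (INF p\<in>C. p x) \<le> p x" by (simp add: u_def)
  have "u (a + b) \<le> u a + u b" for a b
  proof -
    have 1: "u (a + b) \<le> p a + q b" if pq: "p \<in> C" "q \<in> C" for p q
    proof -
      obtain r where r: "r \<in> C" "r a \<le> p a" "r b \<le> q b"
        using chain[OF pq] pq by (metis order_refl)
      have "u (a + b) \<le> r (a + b)" by (rule ule[OF r(1)])
      also have "\<dots> \<le> r a + r b" using sub[OF r(1)] by (simp add: sublinear_def)
      finally show ?thesis using r by simp
    qed
    have "u (a + b) - p a \<le> u b" if "p \<in> C" for p
      unfolding u_def[of b] using \<open>C \<noteq> {}\<close>
      by (intro cINF_greatest) (use 1[OF that] in \<open>auto simp: algebra_simps\<close>)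
    then have "u (a + b) - u b \<le> u a"
      unfolding u_def[of a] using \<open>C \<noteq> {}\<close> by (intro cINF_greatest) (auto simp: algebra_simps)
    then show ?thesis by simp
  qed
  moreover have "u (t *\<^sub>R x) \<le> t * u x" if "t > 0" for t x
  proof -
    have "u (t *\<^sub>R x) / t \<le> p x" if "p \<in> C" for p
      using ule[OF that, of "t *\<^sub>R x"] sublinear_scale[OF sub[OF that] \<open>t > 0\<close>, of x] \<open>t > 0\<close>
      by (simp add: field_simps)
    then have "u (t *\<^sub>R x) / t \<le> u x"
      unfolding u_def[of x] using \<open>C \<noteq> {}\<close> by (intro cINF_greatest) auto
    then show ?thesis using that by (simp add: field_simps)
  qed
  ultimately show "sublinear (\<lambda>x. INF p\<in>C. p x)" by (simp add: sublinear_def u_def)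
qed

text \<open>A minimal sublinear functional is odd, because it cannot be reduced in the direction of
  any \<open>y\<close>; an odd sublinear functional is linear.\<close>

lemma linear_below_sublinear:
  fixes p0 :: "'a::real_vector \<Rightarrow> real"
  assumes "sublinear p0"
  obtains u where "linear u" "\<And>x. u x \<le> p0 x"
proof -
  define A where "A = {p. sublinear p \<and> (\<forall>x. p x \<le> p0 x)}"
  define P where "P p q \<longleftrightarrow> (\<forall>x. q x \<le> p x)" for p q :: "'a \<Rightarrow> real"
  have po: "partial_order_on A (relation_of P A)"
    by (rule partial_order_on_relation_ofI) (auto simp: P_def fun_eq_iff intro: order_trans order_antisym)
  have "\<exists>m\<in>A. \<forall>a\<in>A. P m a \<longrightarrow> a = m"
  proof (rule predicate_Zorn[OF po])
    fix C assume C: "C \<in> Chains (relation_of P A)"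
    then have CA: "C \<subseteq> A" and ch: "\<And>p q. p \<in> C \<Longrightarrow> q \<in> C \<Longrightarrow> P p q \<or> P q p"
      by (auto simp: Chains_def relation_of_def)
    show "\<exists>u\<in>A. \<forall>a\<in>C. P a u"
    proof (cases "C = {}")
      case True
      then show ?thesis using assms by (auto simp: A_def)
    next
      case False
      define u where "u x = (INF p\<in>C. p x)" for x
      have sub: "sublinear p" if "p \<in> C" for p using CA that by (auto simp: A_def)
      have le: "p x \<le> p0 x" if "p \<in> C" for p x using CA that by (auto simp: A_def)
      have chain: "(\<forall>x. p x \<le> q x) \<or> (\<forall>x. q x \<le> p x)" if "p \<in> C" "q \<in> C" for p q
        using ch[OF that] by (auto simp: P_def)
      have su: "sublinear u"
        unfolding u_def[abs_def]
        by (rule sublinear_INF_chain(1)[where ?p0.0 = p0]) ((assumption | rule sub le chain False)+)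
      have ul: "u x \<le> p x" if "p \<in> C" for p x
        unfolding u_def
        by (rule sublinear_INF_chain(2)[where ?p0.0 = p0]) ((assumption | rule sub le chain False that)+)
      obtain p where "p \<in> C" using False by blast
      then have "u \<in> A"
        using su order_trans[OF ul[OF \<open>p \<in> C\<close>] le[OF \<open>p \<in> C\<close>]] by (simp add: A_def)
      then show ?thesis using ul by (auto simp: P_def)
    qed
  qed
  then obtain p where p: "p \<in> A" and min: "\<And>q. q \<in> A \<Longrightarrow> P p q \<Longrightarrow> q = p" by blast
  have sp: "sublinear p" and ple: "\<And>x. p x \<le> p0 x" using p by (auto simp: A_def)
  have odd: "p (- y) = - p y" for y
  proof -
    obtain q where q: "sublinear q" "\<And>x. q x \<le> p x" "q (- y) \<le> - p y"
      using sublinear_reduce[OF sp] by blast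
    then have "q \<in> A" using ple by (auto simp: A_def intro: order_trans)
    then have "q = p" using min q by (simp add: P_def)
    then show ?thesis using q(3) sublinear_uminus[OF sp, of "- y"] by simp
  qed
  have add: "p (x + y) \<le> p x + p y" for x y using sp by (simp add: sublinear_def)
  have "linear p"
  proof
    show "p (x + y) = p x + p y" for x y
      using add[of x y] add[of "- x" "- y"] odd[of "x + y"] odd[of x] odd[of y] by simp
    show "p (t *\<^sub>R x) = t *\<^sub>R p x" for t x
      using sublinear_scale[OF sp, of t x] sublinear_scale[OF sp, of "- t" x] odd[of "t *\<^sub>R x"]
        sublinear_0[OF sp]
      by (cases t "0::real" rule: linorder_cases) auto
  qed
  then show ?thesis using that ple by blast
qed

text \<open>Reducing the norm in the direction of \<open>x\<close> before passing to a linear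
  functional \<open>u\<close> forces \<open>u x \<ge> norm x\<close>. The complex functional is
  \<open>u y - \<i> u (\<i> y)\<close>; the factor 2 comes from bounding its modulus by the sum of
  the moduli of its real and imaginary parts.\<close>

lemma norming_functional:
  fixes x :: "'a::complex_normed_vector"
  obtains \<phi> :: "'a dual" where "norm x \<le> norm (\<phi> x)" "\<And>y. norm (\<phi> y) \<le> 2 * norm y"
proof -
  have "sublinear (norm :: 'a \<Rightarrow> real)" by (simp add: sublinear_def norm_triangle_ineq)
  then obtain q where q: "sublinear q" "\<And>y. q y \<le> norm y" "q (- x) \<le> - norm x"
    using sublinear_reduce by blast
  obtain u where u: "linear u" "\<And>y. u y \<le> q y"
    using linear_below_sublinear[OF q(1)] by blast
  have ule: "u y \<le> norm y" for y using u(2)[of y] q(2)[of y] by simp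
  have abs: "\<bar>u y\<bar> \<le> norm y" for y
    using ule[of y] ule[of "- y"] by (simp add: linear_neg[OF u(1)] abs_le_iff)
  define \<phi> where "\<phi> y = Complex (u y) (- u (\<i> *\<^sub>C y))" for y
  have u_c: "u (c *\<^sub>C y) = Re c * u y + Im c * u (\<i> *\<^sub>C y)" for c y
  proof -
    have "c *\<^sub>C y = (Re c) *\<^sub>R y + (Im c) *\<^sub>R (\<i> *\<^sub>C y)"
      by (simp add: scaleR_scaleC flip: scaleC_add_left)
        (simp add: complex_eq mult.commute)
    then show ?thesis by (simp add: linear_add[OF u(1)] linear_scale[OF u(1)])
  qed
  have b: "norm (\<phi> y) \<le> norm y * 2" for y
  proof -
    have "norm (\<phi> y) \<le> \<bar>u y\<bar> + \<bar>u (\<i> *\<^sub>C y)\<bar>"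
      unfolding \<phi>_def using cmod_le[of "Complex (u y) (- u (\<i> *\<^sub>C y))"] by simp
    also have "\<dots> \<le> norm y * 2" using abs[of y] abs[of "\<i> *\<^sub>C y"] by (simp add: norm_scaleC)
    finally show ?thesis .
  qed
  have "cblinfun_apply (cblinfun_of_fun \<phi>) = \<phi>"
  proof (rule cblinfun_of_fun_apply[OF _ _ b])
    show "\<phi> (y + z) = \<phi> y + \<phi> z" for y z
      by (simp add: \<phi>_def linear_add[OF u(1)] scaleC_add_right complex_eq_iff)
    show "\<phi> (c *\<^sub>C y) = c *\<^sub>C \<phi> y" for c y
      using u_c[of c y] u_c[of "\<i> * c" y] by (simp add: \<phi>_def complex_eq_iff)
  qed
  moreover have "norm x \<le> norm (\<phi> x)"
    using complex_Re_le_cmod[of "\<phi> x"] u(2)[of "- x"] q(3) linear_neg[OF u(1), of x]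
    by (simp add: \<phi>_def)
  ultimately show ?thesis using that[of "cblinfun_of_fun \<phi>"] b by (simp add: mult.commute)
qed

text \<open>Induction on \<open>S\<close>. If \<open>s\<close> is outside the span of the rest, a
  functional \<open>\<sigma>\<close> with \<open>\<sigma> s = 1\<close> projects \<open>x\<close>
  along \<open>s\<close>; a \<open>\<psi>\<close> found for the projection is corrected by
  \<open>\<psi> s\<close> times \<open>\<sigma>\<close>, which makes it vanish at \<open>s\<close>
  and keeps the value 1 at \<open>x\<close>.\<close>

lemma separation:
  fixes x :: "'a::complex_normed_vector"
  assumes "finite S" and "x \<notin> complex_vector.span S"
  obtains \<phi> :: "'a dual" where "\<phi> x = 1" "\<And>s. s \<in> S \<Longrightarrow> \<phi> s = 0"
proof -
  have "\<exists>\<phi> :: 'a dual. \<phi> x = 1 \<and> (\<forall>s\<in>S. \<phi> s = 0)"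
    using assms
  proof (induction S arbitrary: x rule: finite_induct)
    case empty
    then have "x \<noteq> 0" by simp
    obtain \<phi> :: "'a dual" where "norm x \<le> norm (\<phi> x)" using norming_functional by blast
    with \<open>x \<noteq> 0\<close> have "\<phi> x \<noteq> 0" by auto
    then show ?case by (intro exI[of _ "inverse (\<phi> x) *\<^sub>C \<phi>"]) simp
  next
    case (insert s S)
    show ?case
    proof (cases "s \<in> complex_vector.span S")
      case True
      then have "x \<notin> complex_vector.span S"
        using insert.prems complex_vector.span_mono[of S "insert s S"] by blast
      then obtain \<phi> :: "'a dual" where \<phi>: "\<phi> x = 1" "\<forall>s\<in>S. \<phi> s = 0" using insert.IH by blast
      have "\<phi> s = 0" using True
        by (induction rule: complex_vector.span_induct_alt) (use \<phi> in auto)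
      then show ?thesis using \<phi> by auto
    next
      case False
      then obtain \<sigma> :: "'a dual" where \<sigma>: "\<sigma> s = 1" "\<forall>s\<in>S. \<sigma> s = 0" using insert.IH by blast
      have "x - \<sigma> x *\<^sub>C s \<notin> complex_vector.span S"
        using insert.prems complex_vector.span_breakdown_eq[of x s S] by blast
      then obtain \<psi> :: "'a dual" where \<psi>: "\<psi> (x - \<sigma> x *\<^sub>C s) = 1" "\<forall>s\<in>S. \<psi> s = 0"
        using insert.IH by blast
      show ?thesis
        by (rule exI[of _ "\<psi> - \<psi> s *\<^sub>C \<sigma>"]) (use \<psi> \<sigma> in \<open>auto simp: mult.commute\<close>)
    qed
  qed
  then show ?thesis using that by blast
qed

lemma dual_separates:
  assumes "\<And>\<phi> :: 'a::complex_normed_vector dual. \<phi> x = \<phi> y"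
  shows "x = y"
proof -
  obtain \<phi> :: "'a dual" where "norm (x - y) \<le> norm (\<phi> (x - y))" using norming_functional by blast
  then show ?thesis using assms[of \<phi>] by simp
qed

text \<open>The closed sets \<open>E n\<close>, on which all functionals are bounded by
  \<open>n\<close>, cover a complete space, so one of them contains a ball by Baire's theorem.
  Differences of points of the ball carry the bound to every direction.\<close>

lemma uniform_boundedness:
  fixes F :: "'a::complex_banach dual set"
  assumes "\<And>x. \<exists>C. \<forall>\<phi>\<in>F. norm (cblinfun_apply \<phi> x) \<le> C"
  shows "\<exists>C. \<forall>\<phi>\<in>F. \<forall>x. norm (cblinfun_apply \<phi> x) \<le> C * norm x"
proof -
  define E where "E n = {x. \<forall>\<phi>\<in>F. norm (cblinfun_apply \<phi> x) \<le> real n}" for n :: nat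
  have cont: "continuous_on UNIV (cblinfun_apply \<phi>)" for \<phi> :: "'a dual"
    by (rule linear_continuous_on[OF bounded_linear_cblinfun_apply])
  have closed: "closed (E n)" for n
  proof -
    have "E n = (\<Inter>\<phi>\<in>F. {x. norm (cblinfun_apply \<phi> x) \<le> real n})" by (auto simp: E_def)
    then show ?thesis
      by (auto intro!: closed_INT closed_Collect_le continuous_intros cont)
  qed
  have "\<exists>n. interior (E n) \<noteq> {}"
  proof (rule ccontr)
    assume H: "\<nexists>n. interior (E n) \<noteq> {}"
    have "Met_TC.mtopology interior_of \<Union> (range E) = {}"
    proof (rule Met_TC.metric_Baire_category_alt)
      show "Met_TC.mcomplete TYPE('a)" by (simp add: complete_UNIV)
    qed (use closed H in auto)
    moreover have "\<Union> (range E) = UNIV"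
    proof -
      have "\<exists>n. x \<in> E n" for x
      proof -
        obtain C where "\<forall>\<phi>\<in>F. norm (cblinfun_apply \<phi> x) \<le> C" using assms by blast
        moreover obtain n :: nat where "C \<le> real n" using real_arch_simple by blast
        ultimately show ?thesis by (intro exI[of _ n]) (auto simp: E_def intro: order_trans)
      qed
      then show ?thesis by auto
    qed
    ultimately show False by simp
  qed
  then obtain n a e where "e > 0" and ball: "ball a e \<subseteq> E n"
    by (metis ex_in_conv mem_interior)
  have "norm (\<phi> x) \<le> 4 * real n / e * norm x" if "\<phi> \<in> F" for \<phi> :: "'a dual" and x
  proof (cases "x = 0")
    case False
    \<comment> \<open>Half the radius, so that \<open>a + t x\<close> stays in the open
      ball.\<close>
    define t where "t = e / (2 * norm x)"
    have "t > 0" using False \<open>e > 0\<close> by (simp add: t_def)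
    have "a + t *\<^sub>R x \<in> ball a e" "a \<in> ball a e"
      using False \<open>e > 0\<close> by (auto simp: dist_norm t_def)
    then have 1: "norm (\<phi> (a + t *\<^sub>R x)) \<le> real n" "norm (\<phi> a) \<le> real n"
      using subsetD[OF ball] that unfolding E_def by blast+
    have "norm (\<phi> (t *\<^sub>R x)) \<le> 2 * real n"
      using norm_triangle_ineq4[of "\<phi> (a + t *\<^sub>R x)" "\<phi> a"] 1 by simp
    then have "t * norm (\<phi> x) \<le> 2 * real n"
      using \<open>t > 0\<close> by (simp add: scaleR_scaleC norm_mult)
    then show ?thesis using \<open>e > 0\<close> False by (simp add: t_def field_simps)
  qed simp
  then show ?thesis by blast
qed

section \<open>Linear algebra\<close>

lemma not_in_span_of_dim:
  assumes "complex_dim_ge TYPE('a::complex_normed_vector) n" and "finite S" "card S < n"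
  obtains x :: "'a::complex_normed_vector" where "x \<notin> complex_vector.span S"
proof -
  obtain B :: "'a set" where B: "complex_vector.independent B" "card B = n"
    using assms(1) by (auto simp: complex_dim_ge_def)
  then have "\<not> B \<subseteq> complex_vector.span S"
    using complex_vector.independent_span_bound[OF assms(2) B(1)] assms(3) by auto
  then show ?thesis using that by blast
qed

lemma span_singleton_iff:
  "x \<in> complex_vector.span {y} \<longleftrightarrow> (\<exists>c. x = c *\<^sub>C (y::'a::complex_normed_vector))"
  by (auto simp: complex_vector.span_singleton)

lemma span_pair_iff:
  "x \<in> complex_vector.span {y, z} \<longleftrightarrow> (\<exists>a b. x = a *\<^sub>C y + b *\<^sub>C (z::'a::complex_normed_vector))"
proof -
  have "x \<in> complex_vector.span {y, z} \<longleftrightarrow> (\<exists>a b. x - a *\<^sub>C y = b *\<^sub>C z)"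
    by (simp add: complex_vector.span_breakdown_eq[of x y "{z}"] span_singleton_iff)
  then show ?thesis by (simp add: algebra_simps)
qed

lemma separate1:
  fixes x y :: "'a::complex_normed_vector"
  assumes "x \<notin> complex_vector.span {y}"
  obtains \<phi> :: "'a dual" where "\<phi> x = 1" "\<phi> y = 0"
  using separation[of "{y}" x] assms by auto

lemma separate0:
  fixes x :: "'a::complex_normed_vector"
  assumes "x \<noteq> 0"
  obtains \<phi> :: "'a dual" where "\<phi> x = 1"
  using separation[of "{}" x] assms by auto

lemma biorthogonal_pair:
  fixes x y :: "'a::complex_normed_vector"
  assumes "x \<noteq> 0" "y \<notin> complex_vector.span {x}"
  obtains \<phi> \<psi> :: "'a dual" where "\<phi> x = 1" "\<phi> y = 0" "\<psi> x = 0" "\<psi> y = 1"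
proof -
  obtain \<psi> :: "'a dual" where \<psi>: "\<psi> y = 1" "\<psi> x = 0" using assms separate1 by blast
  obtain \<phi> :: "'a dual" where "\<phi> x = 1" using assms separate0 by blast
  then show ?thesis using that[of "\<phi> - \<phi> y *\<^sub>C \<psi>" \<psi>] \<psi> by simp
qed

lemma not_in_span_swap:
  fixes x y :: "'a::complex_normed_vector"
  assumes "x \<noteq> 0" "y \<notin> complex_vector.span {x}"
  shows "x \<notin> complex_vector.span {y}" "y \<noteq> 0"
proof -
  obtain \<phi> \<psi> :: "'a dual" where "\<phi> x = 1" "\<phi> y = 0" "\<psi> x = 0" "\<psi> y = 1"
    using biorthogonal_pair assms by blast
  then show "x \<notin> complex_vector.span {y}" "y \<noteq> 0" by (auto simp: span_singleton_iff)
qed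

text \<open>One of \<open>\<phi>\<close>, \<open>\<psi>\<close> and \<open>\<phi> + \<psi>\<close>
  works, as no vector space is a union of two proper subspaces. With \<open>z = 0\<close> this gives
  a functional that is nonzero at two given nonzero vectors.\<close>

lemma three_vectors:
  fixes x y z :: "'a::complex_normed_vector"
  assumes "x \<notin> complex_vector.span {z}" "y \<notin> complex_vector.span {z}"
  obtains g :: "'a dual" where "g z = 0" "g x \<noteq> 0" "g y \<noteq> 0"
proof -
  obtain \<phi> :: "'a dual" where \<phi>: "\<phi> x = 1" "\<phi> z = 0" using separate1 assms(1) by blast
  obtain \<psi> :: "'a dual" where \<psi>: "\<psi> y = 1" "\<psi> z = 0" using separate1 assms(2) by blast
  show ?thesis
  proof (cases "\<phi> y = 0 \<and> \<psi> x = 0")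
    case True
    then show ?thesis using that[of "\<phi> + \<psi>"] \<phi> \<psi> by simp
  next
    case False
    then show ?thesis using that[of \<phi>] that[of \<psi>] \<phi> \<psi> by auto
  qed
qed

text \<open>A Gram-Schmidt step: new vectors are projected along those already chosen, and
  separation supplies the functionals. Many test operators below live on such a triple.\<close>

lemma biorthogonal_triple:
  assumes "complex_dim_ge TYPE('a::complex_normed_vector) 3"
    and "cblinfun_apply f (x :: 'a::complex_normed_vector) = (1 :: complex)"
  obtains y z :: "'a::complex_normed_vector" and g h :: "'a::complex_normed_vector dual"
  where "f y = 0" "f z = 0" "g x = 0" "g y = 1" "g z = 0" "h x = 0" "h y = 0" "h z = 1"
proof -
  obtain y' where y': "y' \<notin> complex_vector.span {x}"
    using not_in_span_of_dim[OF assms(1), of "{x}"] by auto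
  define y where "y = y' - f y' *\<^sub>C x"
  have "y \<notin> complex_vector.span {x}"
  proof
    assume "y \<in> complex_vector.span {x}"
    then obtain c where "y = c *\<^sub>C x" by (auto simp: span_singleton_iff)
    then have "y' = (c + f y') *\<^sub>C x" by (simp add: y_def scaleC_add_left algebra_simps)
    then show False using y' by (auto simp: span_singleton_iff)
  qed
  then obtain g0 :: "'a dual" where g0: "g0 y = 1" "g0 x = 0" using separate1 by blast
  have fx: "f x = 1" and fy: "f y = 0" using assms by (auto simp: y_def)
  obtain z' where z': "z' \<notin> complex_vector.span {x, y}"
    using not_in_span_of_dim[OF assms(1), of "{x, y}"]
    by (metis card_2_iff card.empty card_insert_disjoint finite.emptyI finite.insertI insert_absorb2
        le_imp_less_Suc less_imp_le nat_le_linear not_less_eq numeral_2_eq_2 numeral_3_eq_3 lessI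
        One_nat_def empty_iff insert_iff)
  define z where "z = z' - f z' *\<^sub>C x - g0 z' *\<^sub>C y"
  have "z \<notin> complex_vector.span {x, y}"
  proof
    assume "z \<in> complex_vector.span {x, y}"
    then obtain a b where "z = a *\<^sub>C x + b *\<^sub>C y" by (auto simp: span_pair_iff)
    then have "z' = (a + f z') *\<^sub>C x + (b + g0 z') *\<^sub>C y"
      by (simp add: z_def scaleC_add_left algebra_simps)
    then show False using z' by (auto simp: span_pair_iff)
  qed
  then obtain h :: "'a dual" where h: "h z = 1" "h x = 0" "h y = 0"
    using separation[of "{x, y}" z] by (metis finite.emptyI finite_insert insertCI)
  have "f z = 0" "g0 z = 0" using fx fy g0 by (simp_all add: z_def)
  then show ?thesis using that[of y z g0 h] fy g0 h by simp
qed

text \<open>A biorthogonal pair compares the factors at \<open>y\<close>, \<open>y0\<close> and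
  \<open>y + y0\<close>. The subspace \<open>V\<close> allows the range of an operator as well as
  the whole space.\<close>

lemma scalar_of_locally_scalar:
  fixes D :: "'a::complex_normed_vector \<Rightarrow>\<^sub>B 'a"
  assumes V: "complex_vector.subspace V"
    and loc: "\<And>y. y \<in> V \<Longrightarrow> \<exists>c. D y = c *\<^sub>C y"
  obtains c where "\<And>y. y \<in> V \<Longrightarrow> D y = c *\<^sub>C y"
proof (cases "\<exists>y0\<in>V. y0 \<noteq> 0")
  case True
  then obtain y0 where y0: "y0 \<in> V" "y0 \<noteq> 0" by blast
  then obtain c where c: "D y0 = c *\<^sub>C y0" using loc by blast
  have "D y = c *\<^sub>C y" if y: "y \<in> V" for y
  proof -
    obtain a where a: "D y = a *\<^sub>C y" using loc y by blast
    show ?thesis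
    proof (cases "y \<in> complex_vector.span {y0}")
      case True
      then show ?thesis using c by (auto simp: span_singleton_iff mult.commute)
    next
      case False
      obtain b where b: "D (y + y0) = b *\<^sub>C (y + y0)"
        using loc complex_vector.subspace_add[OF V y y0(1)] by blast
      obtain \<phi> \<psi> :: "'a dual" where p: "\<phi> y0 = 1" "\<phi> y = 0" "\<psi> y0 = 0" "\<psi> y = 1"
        using biorthogonal_pair[OF y0(2) False] by blast
      have e: "a *\<^sub>C y + c *\<^sub>C y0 = b *\<^sub>C y + b *\<^sub>C y0"
        using b a c by (simp add: scaleC_add_right)
      have "a = b" using arg_cong[OF e, of \<psi>] p by simp
      moreover have "c = b" using arg_cong[OF e, of \<phi>] p by simp
      ultimately show ?thesis using a by simp
    qed
  qed
  then show ?thesis using that by blast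
qed (use that in fastforce)

section \<open>Spectra of operators of small rank\<close>

lemma invertible_operatorI:
  assumes "\<And>x. cblinfun_apply T (cblinfun_apply S x) = x" "\<And>x. cblinfun_apply S (cblinfun_apply T x) = x"
  shows "invertible_operator T"
  unfolding invertible_operator_def is_inverse_operator_def
  by (rule exI[of _ S]) (auto intro!: cblinfun_eqI simp: assms)

lemma invertible_operatorE:
  assumes "invertible_operator T"
  obtains S where "\<And>x. cblinfun_apply T (cblinfun_apply S x) = x" "\<And>x. cblinfun_apply S (cblinfun_apply T x) = x"
  using assms unfolding invertible_operator_def is_inverse_operator_def
  by (metis cblinfun_compose_apply cblinfun_id_apply)

lemma in_spectrum_iff:
  "z \<in> operator_spectrum T \<longleftrightarrow> \<not> invertible_operator (T - z *\<^sub>C cblinfun_id)"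
  by (simp add: operator_spectrum_def)

lemma eigenvalue_in_spectrum:
  assumes "cblinfun_apply T x = z *\<^sub>C x" "x \<noteq> 0"
  shows "z \<in> operator_spectrum T"
  unfolding in_spectrum_iff
proof
  assume "invertible_operator (T - z *\<^sub>C cblinfun_id)"
  then obtain S where "\<And>x. cblinfun_apply S (cblinfun_apply (T - z *\<^sub>C cblinfun_id) x) = x"
    using invertible_operatorE by blast
  from this[of x] show False using assms by simp
qed

text \<open>An operator whose range lies in the span of fewer than \<open>n\<close> vectors is not
  surjective, hence not invertible.\<close>

lemma zero_in_spectrum:
  assumes "complex_dim_ge TYPE('a::complex_normed_vector) n"
    and "range (cblinfun_apply (F :: 'a::complex_normed_vector \<Rightarrow>\<^sub>B 'a)) \<subseteq> complex_vector.span S" "finite S" "card S < n"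
  shows "0 \<in> operator_spectrum F"
  unfolding in_spectrum_iff
proof
  assume "invertible_operator (F - 0 *\<^sub>C cblinfun_id)"
  then have "invertible_operator F" by simp
  then obtain G where G: "\<And>x. F (cblinfun_apply G x) = x"
    using invertible_operatorE by blast
  obtain x where "x \<notin> complex_vector.span S" using not_in_span_of_dim[OF assms(1,3,4)] by blast
  then show False using assms(2) G[of x] by (metis rangeI subsetD)
qed

text \<open>A supremum that is attained at a known point is a maximum, so the spectral radius can be
  read off without compactness of the spectrum.\<close>

lemma peripheral_spectrumI:
  assumes "z0 \<in> operator_spectrum T" "\<And>z. z \<in> operator_spectrum T \<Longrightarrow> cmod z \<le> cmod z0"
  shows "peripheral_spectrum T = {z \<in> operator_spectrum T. cmod z = cmod z0}"
proof -
  have "operator_spectral_radius T = cmod z0"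
    unfolding operator_spectral_radius_def
    by (rule cSup_eq_maximum) (use assms in auto)
  then show ?thesis by (simp add: peripheral_spectrum_def)
qed

text \<open>The equation is the characteristic equation of the 2 by 2 matrix of the numbers
  \<open>g_i u_j\<close>. Off its roots the resolvent is written down by Cramer's rule; at a root, a
  null vector of the matrix provides an eigenvector in the span of \<open>u1\<close> and
  \<open>u2\<close>.\<close>

lemma spectrum_rank_two:
  assumes F: "F = rank_one u1 g1 + rank_one u2 g2" and z: "z \<noteq> 0"
  shows "z \<in> operator_spectrum F \<longleftrightarrow> (z - g1 u1) * (z - g2 u2) = g1 u2 * g2 u1"
proof
  define d where "d = (z - g1 u1) * (z - g2 u2) - g1 u2 * g2 u1"
  assume "z \<in> operator_spectrum F"
  have "invertible_operator (F - z *\<^sub>C cblinfun_id)" if "d \<noteq> 0"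
  proof -
    \<comment> \<open>Cramer's solution of \<open>(z - M) (a, b) = (g1 v, g2 v)\<close>, where
      \<open>M\<close> is that matrix and \<open>d\<close> the determinant of
      \<open>z - M\<close>.\<close>
    define a where "a v = ((z - g2 u2) * g1 v + g1 u2 * g2 v) / d" for v
    define b where "b v = (g2 u1 * g1 v + (z - g1 u1) * g2 v) / d" for v
    define S where "S = (- inverse z) *\<^sub>C (cblinfun_id
      + rank_one u1 (((z - g2 u2) / d) *\<^sub>C g1 + (g1 u2 / d) *\<^sub>C g2)
      + rank_one u2 ((g2 u1 / d) *\<^sub>C g1 + ((z - g1 u1) / d) *\<^sub>C g2))"
    have S: "S v = (- inverse z) *\<^sub>C (v + a v *\<^sub>C u1 + b v *\<^sub>C u2)" for v
      by (simp add: S_def a_def b_def add_divide_distrib)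
    have d1: "(z - g1 u1) * a v - g1 u2 * b v = g1 v" for v
    proof -
      have "(z - g1 u1) * a v - g1 u2 * b v = (d * g1 v) / d"
        unfolding a_def b_def times_divide_eq_right diff_divide_distrib[symmetric]
        by (rule arg_cong[where f = "\<lambda>x. x / d"]) (simp add: d_def algebra_simps)
      then show ?thesis using that by simp
    qed
    have d2: "(z - g2 u2) * b v - g2 u1 * a v = g2 v" for v
    proof -
      have "(z - g2 u2) * b v - g2 u1 * a v = (d * g2 v) / d"
        unfolding a_def b_def times_divide_eq_right diff_divide_distrib[symmetric]
        by (rule arg_cong[where f = "\<lambda>x. x / d"]) (simp add: d_def algebra_simps)
      then show ?thesis using that by simp
    qed
    show ?thesis
    proof (rule invertible_operatorI[where S = S])
      fix v
      define w where "w = v + a v *\<^sub>C u1 + b v *\<^sub>C u2"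
      have "g1 w = z * a v" "g2 w = z * b v"
        using d1[of v] d2[of v] by (simp_all add: w_def algebra_simps)
      then have "(F - z *\<^sub>C cblinfun_id) w = - z *\<^sub>C v"
        by (simp add: F, simp add: w_def scaleC_add_right)
      then show "(F - z *\<^sub>C cblinfun_id) (S v) = v"
        unfolding S w_def[symmetric] cblinfun_apply_scaleC using z by simp
      define y where "y = (F - z *\<^sub>C cblinfun_id) v"
      have gy: "g1 y = g1 u1 * g1 v + g1 u2 * g2 v - z * g1 v" "g2 y = g2 u1 * g1 v + g2 u2 * g2 v - z * g2 v"
        by (simp_all add: y_def F mult.commute)
      have "a y = (- d * g1 v) / d" "b y = (- d * g2 v) / d"
        unfolding a_def b_def gy
        by (rule arg_cong[where f = "\<lambda>x. x / d"], simp add: d_def algebra_simps)+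
      then have "a y = - g1 v" "b y = - g2 v" using that by simp_all
      then have "S y = v"
        unfolding S using z by (simp add: y_def F)
      then show "S ((F - z *\<^sub>C cblinfun_id) v) = v" by (simp add: y_def)
    qed
  qed
  with \<open>z \<in> operator_spectrum F\<close> have "d = 0" by (auto simp: in_spectrum_iff)
  then show "(z - g1 u1) * (z - g2 u2) = g1 u2 * g2 u1" by (simp add: d_def)
next
  assume det: "(z - g1 u1) * (z - g2 u2) = g1 u2 * g2 u1"
  \<comment> \<open>A column of the adjugate of \<open>z - M\<close> is a null vector; if the
    adjugate is zero then so is \<open>z - M\<close>, and any vector will do.\<close>
  have "\<exists>a b. (a, b) \<noteq> (0, 0) \<and> g1 u1 * a + g1 u2 * b = z * a \<and> g2 u1 * a + g2 u2 * b = z * b"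
  proof (cases "(g1 u2, z - g1 u1) = (0, 0) \<and> (z - g2 u2, g2 u1) = (0, 0)")
    case True
    then show ?thesis by (intro exI[of _ 1] exI[of _ 0]) auto
  next
    case False
    then consider "(g1 u2, z - g1 u1) \<noteq> (0, 0)" | "(z - g2 u2, g2 u1) \<noteq> (0, 0)" by blast
    then show ?thesis
    proof cases
      case 1
      then show ?thesis
        by (intro exI[of _ "g1 u2"] exI[of _ "z - g1 u1"]) (use det in \<open>auto simp: algebra_simps\<close>)
    next
      case 2
      then show ?thesis
        by (intro exI[of _ "z - g2 u2"] exI[of _ "g2 u1"]) (use det in \<open>auto simp: algebra_simps\<close>)
    qed
  qed
  then obtain a b where ab: "(a, b) \<noteq> (0, 0)" "g1 u1 * a + g1 u2 * b = z * a" "g2 u1 * a + g2 u2 * b = z * b"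
    by blast
  define w where "w = a *\<^sub>C u1 + b *\<^sub>C u2"
  have g: "g1 w = z * a" "g2 w = z * b" using ab by (simp_all add: w_def mult.commute)
  have "w \<noteq> 0" using g ab(1) z by auto
  moreover have "F w = z *\<^sub>C w" by (simp add: F g, simp add: w_def scaleC_add_right)
  ultimately show "z \<in> operator_spectrum F" by (rule eigenvalue_in_spectrum[rotated])
qed

section \<open>Peripheral spectra of operators of rank at most two\<close>

definition peripheral_pair :: "complex \<Rightarrow> complex \<Rightarrow> complex set"
  where "peripheral_pair a b = {z \<in> {a, b}. cmod z = max (cmod a) (cmod b)}"

lemma peripheral_pair_same [simp]: "peripheral_pair a a = {a}"
  by (auto simp: peripheral_pair_def)

lemma peripheral_pair_uminus [simp]: "peripheral_pair a (- a) = {a, - a}"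
  by (auto simp: peripheral_pair_def)

lemma peripheral_pair_0 [simp]: "peripheral_pair a 0 = {a}"
  by (auto simp: peripheral_pair_def)

lemma peripheral_pair_subset: "peripheral_pair a b \<subseteq> {a, b}"
  by (auto simp: peripheral_pair_def)

lemma peripheral_pair_nonempty: "peripheral_pair a b \<noteq> {}"
  by (auto simp: peripheral_pair_def max_def)

lemma peripheral_pair_eq: "cmod a = cmod b \<Longrightarrow> peripheral_pair a b = {a, b}"
  by (auto simp: peripheral_pair_def)

text \<open>Checking the sum and the product of proposed eigenvalues spares the uses of this lemma
  the quadratic formula. Since the dimension exceeds the rank, 0 is in the spectrum, which is
  therefore \<open>{0, a, b}\<close> even when \<open>a\<close> or \<open>b\<close>
  vanishes.\<close>

lemma peripheral_rank_two:
  assumes dim: "complex_dim_ge TYPE('a::complex_normed_vector) 3"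
    and F: "F = rank_one u1 g1 + rank_one (u2 :: 'a::complex_normed_vector) g2"
    and tr: "a + b = g1 u1 + g2 u2" and det: "a * b = g1 u1 * g2 u2 - g1 u2 * g2 u1"
  shows "peripheral_spectrum F = peripheral_pair a b"
proof -
  have 0: "0 \<in> operator_spectrum F"
  proof (rule zero_in_spectrum[OF dim, where S = "{u1, u2}"])
    show "range F \<subseteq> complex_vector.span {u1, u2}"
      by (rule image_subsetI, simp add: F span_pair_iff) blast
    show "card {u1, u2} < 3" by (cases "u1 = u2") auto
  qed auto
  have nz: "z \<in> operator_spectrum F \<longleftrightarrow> z = a \<or> z = b" if "z \<noteq> 0" for z
  proof -
    have "(z - g1 u1) * (z - g2 u2) - g1 u2 * g2 u1
        = z * z - z * (g1 u1 + g2 u2) + (g1 u1 * g2 u2 - g1 u2 * g2 u1)" by algebra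
    also have "\<dots> = (z - a) * (z - b)" unfolding tr[symmetric] det[symmetric] by algebra
    finally show ?thesis
      using spectrum_rank_two[OF F that] by (metis eq_iff_diff_eq_0 mult_eq_0_iff)
  qed
  have spec: "operator_spectrum F = {0, a, b}"
    using nz 0 by (cases "a = 0"; cases "b = 0") auto
  define z0 where "z0 = (if cmod a \<le> cmod b then b else a)"
  have "peripheral_spectrum F = {z \<in> operator_spectrum F. cmod z = cmod z0}"
    by (rule peripheral_spectrumI) (auto simp: spec z0_def)
  then show ?thesis
    unfolding spec by (auto simp: z0_def peripheral_pair_def max_def)
qed

lemma peripheral_rank_one:
  assumes dim: "complex_dim_ge TYPE('a::complex_normed_vector) 3"
  shows "peripheral_spectrum (rank_one (u :: 'a::complex_normed_vector) g) = {g u}"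
proof -
  have "peripheral_spectrum (rank_one u g) = peripheral_pair (g u) 0"
    by (rule peripheral_rank_two[OF dim, of _ u g 0 0]) (auto simp: rank_one_eq_0_iff)
  then show ?thesis by simp
qed

lemma spectrum_rank_two_subset:
  assumes F: "F = rank_one u1 g1 + rank_one u2 g2"
  shows "\<exists>a b. \<forall>z\<in>operator_spectrum F. z = 0 \<or> z = a \<or> z = b"
proof -
  define t where "t = g1 u1 + g2 u2"
  define e where "e = csqrt (t\<^sup>2 - 4 * (g1 u1 * g2 u2 - g1 u2 * g2 u1))"
  have e2: "e * e = t\<^sup>2 - 4 * (g1 u1 * g2 u2 - g1 u2 * g2 u1)"
    by (simp add: e_def flip: power2_eq_square)
  have "z = 0 \<or> z = (t + e) / 2 \<or> z = (t - e) / 2" if "z \<in> operator_spectrum F" for z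
  proof (cases "z = 0")
    case False
    have "(2 * z - t - e) * (2 * z - t + e) = 4 * ((z - g1 u1) * (z - g2 u2) - g1 u2 * g2 u1)
        + (4 * (g1 u1 * g2 u2 - g1 u2 * g2 u1) + e * e - t\<^sup>2) - 2 * (e * e)
        + 2 * (t\<^sup>2 - 4 * (g1 u1 * g2 u2 - g1 u2 * g2 u1))"
      unfolding t_def power2_eq_square by algebra
    then have "(2 * z - t - e) * (2 * z - t + e) = 0"
      using spectrum_rank_two[OF F False] that e2 by simp
    then have "2 * z - t - e = 0 \<or> 2 * z - t + e = 0" by (simp only: mult_eq_0_iff)
    then have "2 * z = t + e \<or> 2 * z = t - e" by (metis diff_diff_add diff_add_eq diff_eq_eq eq_iff_diff_eq_0 diff_add_cancel)
    then show ?thesis by (metis nonzero_mult_div_cancel_left zero_neq_numeral)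
  qed auto
  then show ?thesis by blast
qed

section \<open>Spectra of block sums, cyclic products, nilpotents and similar operators\<close>

lemma spectrum_block:
  assumes "F o\<^sub>C G = 0" "G o\<^sub>C F = 0" "z \<noteq> 0" "z \<in> operator_spectrum (F + G)"
  shows "z \<in> operator_spectrum F \<or> z \<in> operator_spectrum G"
proof (rule ccontr)
  assume "\<not> ?thesis"
  then obtain S T where
    S: "\<And>x. (F - z *\<^sub>C cblinfun_id) (cblinfun_apply S x) = x"
       "\<And>x. cblinfun_apply S ((F - z *\<^sub>C cblinfun_id) x) = x" and
    T: "\<And>x. (G - z *\<^sub>C cblinfun_id) (cblinfun_apply T x) = x"
       "\<And>x. cblinfun_apply T ((G - z *\<^sub>C cblinfun_id) x) = x"
    using invertible_operatorE[of "F - z *\<^sub>C cblinfun_id"] invertible_operatorE[of "G - z *\<^sub>C cblinfun_id"]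
    unfolding in_spectrum_iff by metis
  have FG: "F (G x) = 0" "G (F x) = 0" for x
    using cblinfun_cong[OF assms(1), of x] cblinfun_cong[OF assms(2), of x] by simp_all
  \<comment> \<open>The mixed products vanish, so \<open>(F - z) (G - z) = - z (F + G - z)\<close>,
    in either order.\<close>
  have 1: "(F + G - z *\<^sub>C cblinfun_id) x = (- inverse z) *\<^sub>C (F - z *\<^sub>C cblinfun_id) ((G - z *\<^sub>C cblinfun_id) x)" for x
    using assms(3) by (simp add: FG scaleC_add_right complex_vector.scale_right_diff_distrib)
  have 2: "(F + G - z *\<^sub>C cblinfun_id) x = (- inverse z) *\<^sub>C (G - z *\<^sub>C cblinfun_id) ((F - z *\<^sub>C cblinfun_id) x)" for x
    using assms(3) by (simp add: FG scaleC_add_right complex_vector.scale_right_diff_distrib)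
  have "invertible_operator (F + G - z *\<^sub>C cblinfun_id)"
  proof (rule invertible_operatorI[where S = "(- z) *\<^sub>C (T o\<^sub>C S)"])
    fix x
    show "(F + G - z *\<^sub>C cblinfun_id) (((- z) *\<^sub>C (T o\<^sub>C S)) x) = x"
      unfolding 1 using assms(3) by (simp only: cblinfun_apply_cscale cblinfun_compose_apply cblinfun_apply_scaleC T S) simp
    show "((- z) *\<^sub>C (T o\<^sub>C S)) ((F + G - z *\<^sub>C cblinfun_id) x) = x"
      unfolding 1 using assms(3) by (simp only: cblinfun_apply_cscale cblinfun_compose_apply cblinfun_apply_scaleC T S) simp
  qed
  then show False using assms(4) by (simp add: in_spectrum_iff)
qed

text \<open>For \<open>F^4 = F\<close> one has
  \<open>(F - z) (F^3 + z F^2 + z^2 F + z^3 - 1) = z - z^4\<close>, which is an explicit inverse up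
  to a nonzero scalar.\<close>

lemma spectrum_cubic:
  fixes F :: "'a::complex_normed_vector \<Rightarrow>\<^sub>B 'a"
  assumes F: "\<And>x. F (F (F (F x))) = cblinfun_apply F x" and z: "z \<in> operator_spectrum F"
  shows "z ^ 4 = z"
proof (rule ccontr)
  assume nz: "z ^ 4 \<noteq> z"
  define p where "p = z ^ 4 - z"
  have p: "p \<noteq> 0" using nz by (simp add: p_def)
  define S where "S = (- inverse p) *\<^sub>C (F o\<^sub>C F o\<^sub>C F + z *\<^sub>C (F o\<^sub>C F) + (z * z) *\<^sub>C F + (z * z * z - 1) *\<^sub>C cblinfun_id)"
  have e: "F (F (F (F x))) + z *\<^sub>C F (F (F x)) + (z * z) *\<^sub>C F (F x) + (z * z * z - 1) *\<^sub>C F x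
      - z *\<^sub>C (F (F (F x)) + z *\<^sub>C F (F x) + (z * z) *\<^sub>C F x + (z * z * z - 1) *\<^sub>C x) = - p *\<^sub>C x" for x
    unfolding F p_def
    by (simp add: scaleC_add_right complex_vector.scale_left_diff_distrib power4_eq_xxxx
        complex_vector.scale_right_diff_distrib mult.assoc)
  have 1: "(F - z *\<^sub>C cblinfun_id) (S x) = (- inverse p) *\<^sub>C (F (F (F (F x))) + z *\<^sub>C F (F (F x)) + (z * z) *\<^sub>C F (F x) + (z * z * z - 1) *\<^sub>C F x
      - z *\<^sub>C (F (F (F x)) + z *\<^sub>C F (F x) + (z * z) *\<^sub>C F x + (z * z * z - 1) *\<^sub>C x))" for x
    by (simp add: S_def scaleC_add_right complex_vector.scale_right_diff_distrib algebra_simps)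
  have 2: "S ((F - z *\<^sub>C cblinfun_id) x) = (- inverse p) *\<^sub>C (F (F (F (F x))) + z *\<^sub>C F (F (F x)) + (z * z) *\<^sub>C F (F x) + (z * z * z - 1) *\<^sub>C F x
      - z *\<^sub>C (F (F (F x)) + z *\<^sub>C F (F x) + (z * z) *\<^sub>C F x + (z * z * z - 1) *\<^sub>C x))" for x
    by (simp add: S_def scaleC_add_right complex_vector.scale_right_diff_distrib algebra_simps)
  have "invertible_operator (F - z *\<^sub>C cblinfun_id)"
    by (rule invertible_operatorI[where S = S]) (unfold 1 2 e, use p in simp_all)
  then show False using z by (simp add: in_spectrum_iff)
qed

text \<open>Jacobson's identity: if \<open>R\<close> inverts \<open>S T - z\<close>, then
  \<open>(T R S - 1) / z\<close> inverts \<open>T S - z\<close>.\<close>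

lemma invertible_swap:
  fixes S :: "'a::complex_normed_vector \<Rightarrow>\<^sub>B 'b::complex_normed_vector" and T :: "'b \<Rightarrow>\<^sub>B 'a"
  assumes z: "z \<noteq> 0" and inv: "invertible_operator (S o\<^sub>C T - z *\<^sub>C cblinfun_id)"
  shows "invertible_operator (T o\<^sub>C S - z *\<^sub>C cblinfun_id)"
proof -
  obtain R where R: "\<And>x. (S o\<^sub>C T - z *\<^sub>C cblinfun_id) (cblinfun_apply R x) = x"
    "\<And>x. cblinfun_apply R ((S o\<^sub>C T - z *\<^sub>C cblinfun_id) x) = x"
    using invertible_operatorE[OF inv] by blast
  have R1: "S (T (R x)) = x + z *\<^sub>C R x" for x using R(1)[of x] by (simp add: algebra_simps)
  have R2: "R (S (T x)) = x + z *\<^sub>C R x" for x using R(2)[of x] by (simp add: algebra_simps)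
  show ?thesis
  proof (rule invertible_operatorI[where S = "inverse z *\<^sub>C (T o\<^sub>C R o\<^sub>C S - cblinfun_id)"])
    fix x
    show "(T o\<^sub>C S - z *\<^sub>C cblinfun_id) ((inverse z *\<^sub>C (T o\<^sub>C R o\<^sub>C S - cblinfun_id)) x) = x"
      using z by (simp add: R1 complex_vector.scale_right_diff_distrib scaleC_add_right)
    show "(inverse z *\<^sub>C (T o\<^sub>C R o\<^sub>C S - cblinfun_id)) ((T o\<^sub>C S - z *\<^sub>C cblinfun_id) x) = x"
      using z by (simp add: R2 complex_vector.scale_right_diff_distrib scaleC_add_right)
  qed
qed

lemma spectrum_swap:
  fixes S :: "'a::complex_normed_vector \<Rightarrow>\<^sub>B 'b::complex_normed_vector" and T :: "'b \<Rightarrow>\<^sub>B 'a"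
  assumes "z \<noteq> 0"
  shows "z \<in> operator_spectrum (S o\<^sub>C T) \<longleftrightarrow> z \<in> operator_spectrum (T o\<^sub>C S)"
  unfolding in_spectrum_iff
  using invertible_swap[OF assms, of S T] invertible_swap[OF assms, of T S] by blast

text \<open>A finite Neumann series: \<open>q n\<close> satisfies
  \<open>(W - z) (q n) = 1 - (W / z)^n\<close> and is an inverse once the power vanishes.\<close>

lemma spectrum_nilpotent:
  assumes "\<And>x. (cblinfun_apply W ^^ n) x = 0" "z \<in> operator_spectrum W"
  shows "z = 0"
proof (rule ccontr)
  assume z: "z \<noteq> 0"
  have inv: "invertible_operator (W - z *\<^sub>C cblinfun_id)" if "\<And>x. (cblinfun_apply W ^^ n) x = 0" for n
  proof -
    define q where "q = rec_nat 0 (\<lambda>i Q. inverse z *\<^sub>C (W o\<^sub>C Q - cblinfun_id))"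
    have q0: "q 0 = 0" and qS: "q (Suc i) = inverse z *\<^sub>C (W o\<^sub>C q i - cblinfun_id)" for i
      by (simp_all add: q_def)
    have comm: "W (q i x) = q i (W x)" for i x
      by (induction i arbitrary: x) (simp_all add: q0 qS)
    have e: "W (q i x) - z *\<^sub>C q i x = x - inverse z ^ i *\<^sub>C (cblinfun_apply W ^^ i) x" for i x
    proof (induction i)
      case (Suc i)
      have "W (q (Suc i) x) - z *\<^sub>C q (Suc i) x
          = inverse z *\<^sub>C (W (W (q i x)) - W x) - (W (q i x) - x)"
        using z by (simp add: qS)
      also have "\<dots> = inverse z *\<^sub>C W (W (q i x) - z *\<^sub>C q i x - x) + x"
        using z by (simp add: complex_vector.scale_right_diff_distrib)
      also have "\<dots> = x - inverse z ^ Suc i *\<^sub>C (cblinfun_apply W ^^ Suc i) x"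
        unfolding Suc.IH by simp
      finally show ?case .
    qed (simp add: q0)
    show ?thesis
      by (rule invertible_operatorI[where S = "q n"]) (use e[of n] that comm in simp_all)
  qed
  show False using inv[OF assms(1)] assms(2) by (simp add: in_spectrum_iff)
qed

lemma invertible_similar:
  assumes TS: "is_inverse_operator T S"
  shows "invertible_operator (T o\<^sub>C A o\<^sub>C S) \<longleftrightarrow> invertible_operator A"
proof
  have t: "T (S x) = x" "S (T y) = y" for x y
    using TS unfolding is_inverse_operator_def by (metis cblinfun_compose_apply cblinfun_id_apply)+
  show "invertible_operator (T o\<^sub>C A o\<^sub>C S)" if inv: "invertible_operator A"
  proof -
    obtain B where "\<And>x. A (cblinfun_apply B x) = x" "\<And>x. cblinfun_apply B (A x) = x"
      using invertible_operatorE[OF inv] by blast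
    then show ?thesis by (intro invertible_operatorI[where S = "T o\<^sub>C B o\<^sub>C S"]) (simp_all add: t)
  qed
  show "invertible_operator A" if inv: "invertible_operator (T o\<^sub>C A o\<^sub>C S)"
  proof -
    obtain B where B: "\<And>x. (T o\<^sub>C A o\<^sub>C S) (cblinfun_apply B x) = x" "\<And>x. cblinfun_apply B ((T o\<^sub>C A o\<^sub>C S) x) = x"
      using invertible_operatorE[OF inv] by blast
    have "A ((S o\<^sub>C B o\<^sub>C T) x) = x" for x
      using arg_cong[OF B(1)[of "T x"], of S] by (simp add: t)
    moreover have "(S o\<^sub>C B o\<^sub>C T) (A x) = x" for x
      using B(2)[of "T x"] by (simp add: t)
    ultimately show ?thesis by (rule invertible_operatorI)
  qed
qed

lemma spectrum_similar:
  assumes TS: "is_inverse_operator T S"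
  shows "operator_spectrum (T o\<^sub>C A o\<^sub>C S) = operator_spectrum A"
proof -
  have "T (S x) = x" for x
    using TS unfolding is_inverse_operator_def by (metis cblinfun_compose_apply cblinfun_id_apply)
  then have "T o\<^sub>C A o\<^sub>C S - z *\<^sub>C cblinfun_id = T o\<^sub>C (A - z *\<^sub>C cblinfun_id) o\<^sub>C S" for z
    by (intro cblinfun_eqI) simp
  then show ?thesis
    unfolding operator_spectrum_def using invertible_similar[OF TS] by simp
qed

lemma peripheral_spectrum_cong:
  "operator_spectrum S = operator_spectrum T \<Longrightarrow> peripheral_spectrum S = peripheral_spectrum T"
  by (simp add: peripheral_spectrum_def operator_spectral_radius_def)

section \<open>Bilinear families of rank-one forms\<close>

text \<open>The contrapositive of the fact that a functional vanishing on the kernel of another is a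
  multiple of it. Functionals are thus separated by points of the space and not by elements of the
  bidual.\<close>

lemma functional_separates:
  fixes P P' :: "'v::complex_normed_vector dual"
  assumes "P \<notin> complex_vector.span {P'}"
  obtains v where "P v = 1" "P' v = 0"
proof -
  have "\<exists>v. P v \<noteq> 0 \<and> P' v = 0"
  proof (rule ccontr)
    assume H: "\<nexists>v. P v \<noteq> 0 \<and> P' v = 0"
    show False
    proof (cases "\<exists>w. P' w \<noteq> 0")
      case True
      then obtain w where w: "P' w \<noteq> 0" by blast
      have "P = (P w / P' w) *\<^sub>C P'"
      proof (rule cblinfun_eqI)
        fix v
        have "P' (P' w *\<^sub>C v - P' v *\<^sub>C w) = 0" by (simp add: mult.commute)
        then have "P (P' w *\<^sub>C v - P' v *\<^sub>C w) = 0" using H by blast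
        then show "P v = ((P w / P' w) *\<^sub>C P') v" using w by (simp add: field_simps)
      qed
      then show False using assms by (auto simp: span_singleton_iff)
    next
      case False
      then have "P = 0" using H by (intro cblinfun_eqI) auto
      then show False using assms by (simp add: complex_vector.span_zero)
    qed
  qed
  then obtain v where "P v \<noteq> 0" "P' v = 0" by blast
  then show ?thesis using that[of "inverse (P v) *\<^sub>C v"] by simp
qed

text \<open>If the factors were independent on both sides, biorthogonal test points would exhibit a
  2 by 2 block with ones on the diagonal and a zero off it, which a product \<open>P v * Q h\<close>
  cannot have.\<close>

lemma rank_one_forms_add:
  fixes P1 P2 :: "'v::complex_normed_vector dual" and Q1 Q2 :: "'g::complex_normed_vector dual"
  assumes sum: "\<And>v h. P1 v * Q1 h + P2 v * Q2 h = cblinfun_apply P v * cblinfun_apply Q h" and nz: "P1 \<noteq> 0" "Q1 \<noteq> 0"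
  shows "P2 \<in> complex_vector.span {P1} \<or> Q2 \<in> complex_vector.span {Q1}"
proof (rule ccontr)
  assume "\<not> ?thesis"
  then have P: "P2 \<notin> complex_vector.span {P1}" and Q: "Q2 \<notin> complex_vector.span {Q1}" by auto
  obtain v1 where v1: "P1 v1 = 1" "P2 v1 = 0"
    using functional_separates not_in_span_swap(1)[OF nz(1) P] by blast
  obtain v2 where v2: "P2 v2 = 1" "P1 v2 = 0" using functional_separates P by blast
  obtain h1 where h1: "Q1 h1 = 1" "Q2 h1 = 0"
    using functional_separates not_in_span_swap(1)[OF nz(2) Q] by blast
  obtain h2 where h2: "Q2 h2 = 1" "Q1 h2 = 0" using functional_separates Q by blast
  have "P v1 * Q h1 = 1" "P v2 * Q h2 = 1" "P v1 * Q h2 = 0"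
    using sum[of v1 h1] sum[of v2 h2] sum[of v1 h2] v1 v2 h1 h2 by simp_all
  then show False by auto
qed

text \<open>The analogue for matrices: a linear space of matrices of rank at most one has a common
  row or column direction. If \<open>p y\<close> leaves the line of \<open>p x0\<close>, then
  \<open>q y\<close> stays on that of \<open>q x0\<close>; a \<open>z\<close> with
  \<open>q z\<close> off this line would put \<open>p z\<close> on the lines of both
  \<open>p x0\<close> and \<open>p y\<close>.\<close>

lemma rank_one_form_family:
  fixes F :: "'a::complex_normed_vector \<Rightarrow> 'v::complex_normed_vector \<Rightarrow> 'g::complex_normed_vector \<Rightarrow> complex"
  assumes K: "complex_vector.subspace K" and K0: "x0 \<in> K" "x0 \<noteq> 0"
    and add: "\<And>x y v h. x \<in> K \<Longrightarrow> y \<in> K \<Longrightarrow> F (x + y) v h = F x v h + F y v h"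
    and r1: "\<And>x. x \<in> K \<Longrightarrow> x \<noteq> 0 \<Longrightarrow>
      \<exists>(P :: 'v dual) (Q :: 'g dual). P \<noteq> 0 \<and> Q \<noteq> 0 \<and> (\<forall>v h. F x v h = cblinfun_apply P v * cblinfun_apply Q h)"
  shows "(\<exists>\<sigma> :: 'v dual. \<sigma> \<noteq> 0 \<and> (\<forall>x\<in>K. \<exists>Q :: 'g dual. \<forall>v h. F x v h = cblinfun_apply \<sigma> v * cblinfun_apply Q h))
    \<or> (\<exists>\<tau> :: 'g dual. \<tau> \<noteq> 0 \<and> (\<forall>x\<in>K. \<exists>P :: 'v dual. \<forall>v h. F x v h = cblinfun_apply P v * cblinfun_apply \<tau> h))"
proof -
  have F0: "F 0 v h = 0" for v h
    using add[of 0 0 v h] complex_vector.subspace_0[OF K] by simp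
  obtain p :: "'a \<Rightarrow> 'v dual" and q :: "'a \<Rightarrow> 'g dual" where
    pq: "\<And>x. x \<in> K \<Longrightarrow> x \<noteq> 0 \<Longrightarrow> p x \<noteq> 0 \<and> q x \<noteq> 0 \<and> (\<forall>v h. F x v h = p x v * q x h)"
    using r1 by metis
  have par: "p y \<in> complex_vector.span {p x} \<or> q y \<in> complex_vector.span {q x}"
    if "x \<in> K" "x \<noteq> 0" "y \<in> K" "y \<noteq> 0" for x y
  proof -
    have "\<exists>(P :: 'v dual) (Q :: 'g dual). \<forall>v h. F (x + y) v h = cblinfun_apply P v * cblinfun_apply Q h"
    proof (cases "x + y = 0")
      case True
      then show ?thesis by (intro exI[of _ 0]) (simp add: F0)
    next
      case False
      then show ?thesis using r1[OF complex_vector.subspace_add[OF K that(1,3)]] by blast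
    qed
    then obtain P :: "'v dual" and Q :: "'g dual" where "\<And>v h. F (x + y) v h = cblinfun_apply P v * cblinfun_apply Q h" by blast
    then have "p x v * q x h + p y v * q y h = cblinfun_apply P v * cblinfun_apply Q h" for v h
      using add[OF that(1,3)] pq[OF that(1,2)] pq[OF that(3,4)] by metis
    then show ?thesis using rank_one_forms_add pq[OF that(1,2)] by blast
  qed
  show ?thesis
  proof (cases "\<forall>x\<in>K. x \<noteq> 0 \<longrightarrow> p x \<in> complex_vector.span {p x0}")
    case True
    have "\<exists>Q :: 'g dual. \<forall>v h. F x v h = p x0 v * cblinfun_apply Q h" if x: "x \<in> K" for x
    proof (cases "x = 0")
      case True
      then show ?thesis by (intro exI[of _ 0]) (simp add: F0)
    next
      case False
      then obtain c where "p x = c *\<^sub>C p x0" 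
        using \<open>\<forall>x\<in>K. _\<close> x by (auto simp: span_singleton_iff)
      then show ?thesis using pq[OF x False] by (intro exI[of _ "c *\<^sub>C q x"]) simp
    qed
    then show ?thesis using pq[OF K0] by blast
  next
    case False
    then obtain y where y: "y \<in> K" "y \<noteq> 0" "p y \<notin> complex_vector.span {p x0}" by blast
    then obtain d where d: "q y = d *\<^sub>C q x0" using par[OF K0 y(1,2)] by (auto simp: span_singleton_iff)
    have "\<exists>P :: 'v dual. \<forall>v h. F z v h = cblinfun_apply P v * q x0 h" if z: "z \<in> K" for z
    proof (cases "z = 0")
      case True
      then show ?thesis by (intro exI[of _ 0]) (simp add: F0)
    next
      case False
      have "q z \<in> complex_vector.span {q x0}"
      proof (rule ccontr)
        assume n: "q z \<notin> complex_vector.span {q x0}"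
        then obtain c where c: "p z = c *\<^sub>C p x0" using par[OF K0 z False] by (auto simp: span_singleton_iff)
        have "q z \<notin> complex_vector.span {q y}"
          using n by (auto simp: d span_singleton_iff)
        then obtain e where e: "p z = e *\<^sub>C p y" using par[OF y(1,2) z False] by (auto simp: span_singleton_iff)
        have "e \<noteq> 0" using e pq[OF z False] by auto
        then have "p y = (c / e) *\<^sub>C p x0" using c e
          by (metis complex_vector.scale_left_imp_eq divide_inverse mult.commute nonzero_eq_divide_eq scaleC_scaleC)
        then show False using y(3) by (auto simp: span_singleton_iff)
      qed
      then obtain c where "q z = c *\<^sub>C q x0" by (auto simp: span_singleton_iff)
      then show ?thesis using pq[OF z False] by (intro exI[of _ "c *\<^sub>C p z"]) simp
    qed
    then show ?thesis using pq[OF K0] by blast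
  qed
qed

text \<open>The minors of \<open>\<Theta> + a p1 q1 + b p2 q2\<close> are affine in \<open>a\<close> and \<open>b\<close> once
  \<open>a b = - w\<close>; their vanishing for three values of \<open>a\<close> determines \<open>\<Theta>\<close>.\<close>

lemma rank_one_form_pencil:
  fixes p1 p2 :: "'v::complex_normed_vector dual" and q1 q2 :: "'g::complex_normed_vector dual"
    and \<Theta> :: "'v \<Rightarrow> 'g \<Rightarrow> complex"
  assumes nz: "p1 \<noteq> 0" "q1 \<noteq> 0"
    and p: "p2 \<notin> complex_vector.span {p1}" and q: "q2 \<notin> complex_vector.span {q1}"
    and r1: "\<And>a b. a * b = - w \<Longrightarrow>
      \<exists>P Q. \<forall>v h. \<Theta> v h + a * (p1 v * q1 h) + b * (p2 v * q2 h) = (P v * Q h :: complex)"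
  obtains l m where "l * m = - w" "\<And>v h. \<Theta> v h = l * (p1 v * q2 h) + m * (p2 v * q1 h)"
proof -
  obtain v1 where v1: "p1 v1 = 1" "p2 v1 = 0"
    using functional_separates not_in_span_swap(1)[OF nz(1) p] by blast
  obtain v2 where v2: "p2 v2 = 1" "p1 v2 = 0" using functional_separates p by blast
  obtain h1 where h1: "q1 h1 = 1" "q2 h1 = 0"
    using functional_separates not_in_span_swap(1)[OF nz(2) q] by blast
  obtain h2 where h2: "q2 h2 = 1" "q1 h2 = 0" using functional_separates q by blast
  \<comment> \<open>\<open>b1\<close> and \<open>b2\<close> are the coefficients of \<open>a\<close>
    and \<open>b\<close> in the minor, and \<open>c0\<close> is its constant part after
    \<open>a b = - w\<close> is inserted. The squares of \<open>a\<close> and \<open>b\<close> drop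
    out, their coefficients being minors of rank-one forms.\<close>
  define b1 where "b1 v h v' h' = \<Theta> v h * (p1 v' * q1 h') + (p1 v * q1 h) * \<Theta> v' h'
     - \<Theta> v h' * (p1 v' * q1 h) - (p1 v * q1 h') * \<Theta> v' h" for v h v' h'
  define b2 where "b2 v h v' h' = \<Theta> v h * (p2 v' * q2 h') + (p2 v * q2 h) * \<Theta> v' h'
     - \<Theta> v h' * (p2 v' * q2 h) - (p2 v * q2 h') * \<Theta> v' h" for v h v' h'
  define c0 where "c0 v h v' h' = \<Theta> v h * \<Theta> v' h' - \<Theta> v h' * \<Theta> v' h
     - w * ((p1 v * q1 h) * (p2 v' * q2 h') + (p2 v * q2 h) * (p1 v' * q1 h')
       - (p1 v * q1 h') * (p2 v' * q2 h) - (p2 v * q2 h') * (p1 v' * q1 h))" for v h v' h'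
  have minor: "c0 v h v' h' + a * b1 v h v' h' + b * b2 v h v' h' = 0" if ab: "a * b = - w" for a b v h v' h'
  proof -
    obtain P Q where PQ: "\<And>v h. \<Theta> v h + a * (p1 v * q1 h) + b * (p2 v * q2 h) = P v * Q h"
      using r1[OF ab] by blast
    define M where "M v h = \<Theta> v h + a * (p1 v * q1 h) + b * (p2 v * q2 h)" for v h
    have "M v h * M v' h' - M v h' * M v' h = 0" unfolding M_def PQ by simp
    moreover have "(t + a * u + b * k) * (t' + a * u' + b * k') - (s + a * y + b * l) * (s' + a * y' + b * l')
      = (t * t' - s * s' - w * (u * k' + k * u' - y * l' - l * y'))
        + a * (t * u' + u * t' - s * y' - y * s') + b * (t * k' + k * t' - s * l' - l * s')
        + (a * b + w) * (u * k' + k * u' - y * l' - l * y') + a * a * (u * u' - y * y') + b * b * (k * k' - l * l')"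
      for t u k t' u' k' s y l s' y' l' :: complex by (simp add: distrib_left distrib_right left_diff_distrib right_diff_distrib ac_simps)
    then have "M v h * M v' h' - M v h' * M v' h = c0 v h v' h' + a * b1 v h v' h' + b * b2 v h v' h'
        + (a * b + w) * ((p1 v * q1 h) * (p2 v' * q2 h') + (p2 v * q2 h) * (p1 v' * q1 h')
          - (p1 v * q1 h') * (p2 v' * q2 h) - (p2 v * q2 h') * (p1 v' * q1 h))
        + a * a * ((p1 v * q1 h) * (p1 v' * q1 h') - (p1 v * q1 h') * (p1 v' * q1 h))
        + b * b * ((p2 v * q2 h) * (p2 v' * q2 h') - (p2 v * q2 h') * (p2 v' * q2 h))"
      unfolding M_def c0_def b1_def b2_def .
    moreover have "(p1 v * q1 h) * (p1 v' * q1 h') - (p1 v * q1 h') * (p1 v' * q1 h) = 0"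
      "(p2 v * q2 h) * (p2 v' * q2 h') - (p2 v * q2 h') * (p2 v' * q2 h) = 0" by simp_all
    ultimately show ?thesis using ab by simp
  qed
  have c0: "c0 v h v' h' = 0" and b1: "b1 v h v' h' = 0" and b2: "b2 v h v' h' = 0" for v h v' h'
  proof -
    note m = minor[where v = v and h = h and v' = v' and h' = h']
    have "c0 v h v' h' = 0 \<and> b1 v h v' h' = 0 \<and> b2 v h v' h' = 0"
    proof (cases "w = 0")
      case True
      then show ?thesis using m[of 0 0] m[of 1 0] m[of 0 1] by simp
    next
      case False
      have e: "c0 v h v' h' + b1 v h v' h' - w * b2 v h v' h' = 0"
        "c0 v h v' h' - b1 v h v' h' + w * b2 v h v' h' = 0"
        "c0 v h v' h' + 2 * b1 v h v' h' - (w / 2) * b2 v h v' h' = 0"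
        using m[of 1 "- w"] m[of "-1" w] m[of 2 "- w / 2"] by simp_all
      have "2 * c0 v h v' h' = 0" using arg_cong2[OF e(1,2), of "(+)"] by simp
      then have c: "c0 v h v' h' = 0" by simp
      have B: "b1 v h v' h' = w * b2 v h v' h'" using e(1) c by simp
      have "(3 / 2) * (w * b2 v h v' h') = 0" using e(3) by (simp add: B c)
      then have "w * b2 v h v' h' = 0" by simp
      then show ?thesis using c B False by simp
    qed
    then show "c0 v h v' h' = 0" "b1 v h v' h' = 0" "b2 v h v' h' = 0" by auto
  qed
  \<comment> \<open>The vanishing of \<open>b1\<close> at \<open>v1\<close>, \<open>h1\<close>
    writes \<open>\<Theta>\<close> with \<open>p1\<close> or \<open>q1\<close> as a factor of every
    term, and that of \<open>b2\<close> does the same with \<open>p2\<close> and \<open>q2\<close>.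
    Only the mixed products \<open>p1 q2\<close> and \<open>p2 q1\<close> survive both.\<close>
  have E1: "\<Theta> v h = \<Theta> v h1 * q1 h + p1 v * \<Theta> v1 h - p1 v * q1 h * \<Theta> v1 h1" for v h
  proof -
    have "t = t' * q + p * s - p * q * r" if "t * 1 + p * q * r - t' * q - p * s = 0"
      for t t' q p s r :: complex using that by algebra
    then show ?thesis using b1[of v h v1 h1] by (simp add: b1_def v1 h1)
  qed
  have E2: "\<Theta> v h = \<Theta> v h2 * q2 h + p2 v * \<Theta> v2 h - p2 v * q2 h * \<Theta> v2 h2" for v h
  proof -
    have "t = t' * q + p * s - p * q * r" if "t * 1 + p * q * r - t' * q - p * s = 0"
      for t t' q p s r :: complex using that by algebra
    then show ?thesis using b2[of v h v2 h2] by (simp add: b2_def v2 h2)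
  qed
  have 11: "\<Theta> v1 h1 = 0" using E2[of v1 h1] by (simp add: v1 h1)
  have 22: "\<Theta> v2 h2 = 0" using E1[of v2 h2] by (simp add: v2 h2)
  have "\<Theta> v h = \<Theta> v1 h2 * (p1 v * q2 h) + \<Theta> v2 h1 * (p2 v * q1 h)" for v h
  proof -
    have "\<Theta> v h1 = p2 v * \<Theta> v2 h1" using E2[of v h1] by (simp add: h1)
    moreover have "\<Theta> v1 h = \<Theta> v1 h2 * q2 h" using E2[of v1 h] by (simp add: v1)
    ultimately show ?thesis using E1[of v h] 11 by (metis (no_types, lifting) add.commute diff_zero
          mult.assoc mult.commute mult.left_commute mult_zero_right)
  qed
  moreover have "- (\<Theta> v1 h2 * \<Theta> v2 h1) = w"
    using c0[of v1 h1 v2 h2] by (simp add: c0_def v1 v2 h1 h2 11 22)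
  then have "\<Theta> v1 h2 * \<Theta> v2 h1 = - w" by (metis minus_minus)
  ultimately show ?thesis using that by blast
qed

lemma rank_one_factor_linear:
  fixes F :: "'c::complex_normed_vector \<Rightarrow> 'v::complex_normed_vector \<Rightarrow> 'g::complex_normed_vector \<Rightarrow> complex"
    and \<sigma> :: "'v dual" and T :: "'c \<Rightarrow> 'g dual"
  assumes K: "complex_vector.subspace K" and \<sigma>: "\<sigma> \<noteq> 0"
    and T: "\<And>x v h. x \<in> K \<Longrightarrow> F x v h = \<sigma> v * T x h"
    and F: "\<And>x y v h. F (x + y) v h = F x v h + F y v h" "\<And>c x v h. F (c *\<^sub>C x) v h = c * F x v h"
  shows "x \<in> K \<Longrightarrow> y \<in> K \<Longrightarrow> T (x + y) = T x + T y" and "x \<in> K \<Longrightarrow> T (c *\<^sub>C x) = c *\<^sub>C T x"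
proof -
  obtain v where "\<sigma> v \<noteq> 0" using \<sigma> by (metis cblinfun_apply_zero cblinfun_eqI)
  then have Tv: "T x h = F x v h / \<sigma> v" if "x \<in> K" for x h using T[OF that] by simp
  show "T (x + y) = T x + T y" if "x \<in> K" "y \<in> K"
    by (rule cblinfun_eqI) (simp add: Tv that complex_vector.subspace_add[OF K] F add_divide_distrib)
  show "T (c *\<^sub>C x) = c *\<^sub>C T x" if "x \<in> K"
    by (rule cblinfun_eqI) (simp add: Tv that complex_vector.subspace_scale[OF K] F)
qed

text \<open>Two linear maps that are proportional at every point, the first of them injective, have
  a constant ratio: independent images allow a comparison of coefficients in
  \<open>T (x + y)\<close>, and dependent images make \<open>y\<close> a multiple of
  \<open>x\<close>.\<close>

lemma scalar_factor_constant:
  fixes T :: "'c::complex_normed_vector \<Rightarrow> 'd::complex_normed_vector" and l :: "'c \<Rightarrow> complex"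
  assumes K: "complex_vector.subspace K"
    and T: "\<And>x y. x \<in> K \<Longrightarrow> y \<in> K \<Longrightarrow> T (x + y) = T x + T y" "\<And>c x. x \<in> K \<Longrightarrow> T (c *\<^sub>C x) = c *\<^sub>C T x"
      "\<And>x. x \<in> K \<Longrightarrow> x \<noteq> 0 \<Longrightarrow> T x \<noteq> 0"
    and l: "\<And>x y. x \<in> K \<Longrightarrow> y \<in> K \<Longrightarrow> l (x + y) *\<^sub>C T (x + y) = l x *\<^sub>C T x + l y *\<^sub>C T y"
      "\<And>c x. x \<in> K \<Longrightarrow> l (c *\<^sub>C x) *\<^sub>C T (c *\<^sub>C x) = (c * l x) *\<^sub>C T x"
    and xy: "x \<in> K" "x \<noteq> 0" "y \<in> K" "y \<noteq> 0"
  shows "l x = l y"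
proof (cases "T y \<in> complex_vector.span {T x}")
  case True
  then obtain c where c: "T y = c *\<^sub>C T x" by (auto simp: span_singleton_iff)
  define d where "d = - c"
  have dx: "d *\<^sub>C x \<in> K" using complex_vector.subspace_scale[OF K xy(1)] .
  have "T (y + d *\<^sub>C x) = c *\<^sub>C T x + d *\<^sub>C T x" using T(1)[OF xy(3) dx] T(2)[OF xy(1), of d] c by simp
  then have "T (y + d *\<^sub>C x) = 0" by (simp add: d_def)
  then have "y + d *\<^sub>C x = 0" using T(3) complex_vector.subspace_add[OF K xy(3) dx] by blast
  then have y: "y = c *\<^sub>C x" by (simp add: d_def)
  have "l y *\<^sub>C T y = l x *\<^sub>C T y" using l(2)[OF xy(1), of c] by (simp add: y T(2)[OF xy(1)] mult.commute)
  then show ?thesis using T(3)[OF xy(3,4)] by simp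
next
  case False
  obtain \<phi> \<psi> :: "'d dual" where p: "\<phi> (T x) = 1" "\<phi> (T y) = 0" "\<psi> (T x) = 0" "\<psi> (T y) = 1"
    using biorthogonal_pair[OF T(3)[OF xy(1,2)] False] by blast
  have e: "l (x + y) *\<^sub>C (T x + T y) = l x *\<^sub>C T x + l y *\<^sub>C T y"
    using l(1)[OF xy(1,3)] T(1)[OF xy(1,3)] by simp
  show ?thesis using arg_cong[OF e, of \<phi>] arg_cong[OF e, of \<psi>] p by simp
qed

text \<open>For fixed \<open>f0\<close> the left factor is constant by hypothesis; for fixed
  \<open>x0\<close> either the left or the right factor is constant. A constant left factor in both
  families is contradictory in dimension three, and otherwise the form splits. The two families are
  tied together by the nilpotents \<open>(x + a x0) \<otimes> (f + b f0)\<close> with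
  \<open>a b = - f x\<close>, to which \<open>rank_one_form_pencil\<close> applies.\<close>

lemma nilpotent_form_structure_left:
  fixes \<beta> :: "'v::complex_normed_vector \<Rightarrow> 'g::complex_normed_vector \<Rightarrow> 'a::complex_normed_vector \<Rightarrow>\<^sub>B 'a"
  assumes dim: "complex_dim_ge TYPE('a) 3"
    and r1: "\<And>x f. x \<noteq> 0 \<Longrightarrow> f \<noteq> 0 \<Longrightarrow> cblinfun_apply f x = (0 :: complex) \<Longrightarrow>
      \<exists>(P :: 'v dual) (Q :: 'g dual). P \<noteq> 0 \<and> Q \<noteq> 0 \<and> (\<forall>v h. cblinfun_apply f (\<beta> v h x) = cblinfun_apply P v * cblinfun_apply Q h)"
    and par: "\<And>x f y g (P :: 'v dual) (Q :: 'g dual) P' Q'.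
      \<lbrakk>x \<noteq> 0; f \<noteq> 0; cblinfun_apply f x = (0 :: complex); y \<noteq> 0; g \<noteq> 0; cblinfun_apply g y = (0 :: complex);
       \<And>v h. cblinfun_apply f (\<beta> v h x) = cblinfun_apply P v * cblinfun_apply Q h; \<And>v h. cblinfun_apply g (\<beta> v h y) = cblinfun_apply P' v * cblinfun_apply Q' h;
       P' \<in> complex_vector.span {P} \<or> Q' \<in> complex_vector.span {Q}\<rbrakk>
      \<Longrightarrow> y \<in> complex_vector.span {x} \<or> g \<in> complex_vector.span {f}"
    and f0: "cblinfun_apply f0 x0 = 1"
    and left: "\<sigma> \<noteq> 0" "\<And>x. f0 x = 0 \<Longrightarrow> \<exists>Q :: 'g dual. \<forall>v h. f0 (\<beta> v h x) = cblinfun_apply \<sigma> v * cblinfun_apply Q h"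
  shows "\<exists>S T.
    (\<forall>f g :: 'a dual. S (f + g) = (S f + S g :: 'v dual)) \<and> (\<forall>c f. S (c *\<^sub>C f) = c *\<^sub>C S f) \<and>
    (\<forall>x y :: 'a. T (x + y) = (T x + T y :: 'g dual)) \<and> (\<forall>c x. T (c *\<^sub>C x) = c *\<^sub>C T x) \<and>
    (\<forall>x f v h. cblinfun_apply f x = 0 \<longrightarrow>
      cblinfun_apply f (\<beta> v h x) = cblinfun_apply (S f) v * cblinfun_apply (T x) h)"
proof -
  obtain x1 x2 :: 'a and f1 f2 :: "'a dual" where b: "f0 x1 = 0" "f0 x2 = 0" "f1 x0 = 0" "f1 x1 = 1" "f1 x2 = 0"
    "f2 x0 = 0" "f2 x1 = 0" "f2 x2 = 1"
    using biorthogonal_triple[OF dim f0] by metis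
  have x0: "x0 \<noteq> 0" "f0 \<noteq> 0" using f0 by auto
  define K where "K = {x. f0 x = 0}"
  define K' where "K' = {f :: 'a dual. f x0 = 0}"
  have K: "complex_vector.subspace K" and K': "complex_vector.subspace K'"
    by (auto simp: K_def K'_def complex_vector.subspace_def)
  have f1: "f1 \<in> K'" "f1 \<noteq> 0" "x1 \<in> K" "x1 \<noteq> 0" "f2 \<in> K'" "f2 \<noteq> 0" "x2 \<in> K" "x2 \<noteq> 0"
    using b by (auto simp: K_def K'_def)
  have nz: "\<exists>v h. f (\<beta> v h x) \<noteq> 0" if xf: "x \<noteq> 0" "f \<noteq> 0" "f x = 0" for x and f :: "'a dual"
  proof -
    obtain P :: "'v dual" and Q :: "'g dual" where "P \<noteq> 0" "Q \<noteq> 0" "\<And>v h. f (\<beta> v h x) = P v * Q h"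
      using r1[OF xf] by blast
    moreover from this obtain v h where "P v \<noteq> 0" "Q h \<noteq> 0" by (metis cblinfun_apply_zero cblinfun_eqI)
    ultimately show ?thesis by (metis mult_eq_0_iff)
  qed
  obtain T :: "'a \<Rightarrow> 'g dual" where T: "\<And>x v h. x \<in> K \<Longrightarrow> f0 (\<beta> v h x) = \<sigma> v * T x h"
    using left(2) unfolding K_def mem_Collect_eq by metis
  note Tlin = rank_one_factor_linear[OF K left(1), of "\<lambda>x v h. f0 (\<beta> v h x)" T, OF T, simplified]
  have Tnz: "T x \<noteq> 0" if "x \<in> K" "x \<noteq> 0" for x
    using nz[of x f0] x0(2) T[OF that(1)] that by (auto simp: K_def)
  \<comment> \<open>The form of the trace-zero tensor
    \<open>x \<otimes> f - f x (x0 \<otimes> f0)\<close>, which is the part of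
    \<open>(x + a x0) \<otimes> (f + b f0)\<close> that is the same for all
    \<open>a b = - f x\<close>.\<close>
  define \<Theta> where "\<Theta> x f v h = f (\<beta> v h x) - f x * f0 (\<beta> v h x0)" for x and f :: "'a dual" and v h
  have pencil: "\<exists>P Q. \<forall>v h. \<Theta> x f v h + a * f (\<beta> v h x0) + b * f0 (\<beta> v h x) = (P v * Q h :: complex)"
    if "x \<in> K" "x \<noteq> 0" "f \<in> K'" "f \<noteq> 0" "a * b = - f x" for x f a b
  proof -
    have 1: "x + a *\<^sub>C x0 \<noteq> 0"
    proof
      assume z: "x + a *\<^sub>C x0 = 0"
      then have "f0 (x + a *\<^sub>C x0) = 0" by simp
      then have "a = 0" using that(1) f0 by (simp add: K_def)
      then show False using z that(2) by simp
    qed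
    have 2: "f + b *\<^sub>C f0 \<noteq> 0"
    proof
      assume z: "f + b *\<^sub>C f0 = 0"
      have "(f + b *\<^sub>C f0) x0 = 0" unfolding z by simp
      then have "b = 0" using that(3) f0 by (simp add: K'_def)
      then show False using z that(4) by simp
    qed
    have "(f + b *\<^sub>C f0) (x + a *\<^sub>C x0) = 0"
      using that f0 by (simp add: K_def K'_def mult.commute)
    from r1[OF 1 2 this] obtain P :: "'v dual" and Q :: "'g dual" where
      PQ: "\<forall>v h. (f + b *\<^sub>C f0) (\<beta> v h (x + a *\<^sub>C x0)) = P v * Q h" by blast
    have E: "\<Theta> x f v h + a * f (\<beta> v h x0) + b * f0 (\<beta> v h x) = (f + b *\<^sub>C f0) (\<beta> v h (x + a *\<^sub>C x0))" for v h
    proof -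
      have "(f + b *\<^sub>C f0) (\<beta> v h (x + a *\<^sub>C x0)) = f (\<beta> v h x) + a * f (\<beta> v h x0) + b * f0 (\<beta> v h x)
          + (a * b) * f0 (\<beta> v h x0)" by (simp add: algebra_simps)
      then show ?thesis using that(5) by (simp add: \<Theta>_def)
    qed
    have "\<forall>v h. \<Theta> x f v h + a * f (\<beta> v h x0) + b * f0 (\<beta> v h x) = P v * Q h" unfolding E by (rule PQ)
    then show ?thesis by (intro exI)
  qed
  \<comment> \<open>\<open>x \<otimes> f0\<close> and \<open>x0 \<otimes> f\<close> have neither the
    vector nor the functional in common, so by \<open>par\<close> their forms share no
    factor.\<close>
  have indep: "P \<notin> complex_vector.span {\<sigma>}" "Q \<notin> complex_vector.span {T x}"
    if "x \<in> K" "x \<noteq> 0" "f \<in> K'" "f \<noteq> 0" "\<And>v h. f (\<beta> v h x0) = P v * Q h"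
    for x f and P :: "'v dual" and Q :: "'g dual"
  proof -
    have "\<not> (x0 \<in> complex_vector.span {x} \<or> f \<in> complex_vector.span {f0})"
      using that f0 x0 by (auto simp: span_singleton_iff K_def K'_def)
    then show "P \<notin> complex_vector.span {\<sigma>}" "Q \<notin> complex_vector.span {T x}"
      using par[OF that(2) x0(2) _ x0(1) that(4) _ T[OF that(1)] that(5)] that(1,3)
      unfolding K_def K'_def by blast+
  qed
  have \<Theta>lin: "\<Theta> (x + y) f v h = \<Theta> x f v h + \<Theta> y f v h" "\<Theta> x (f + g) v h = \<Theta> x f v h + \<Theta> x g v h"
    "\<Theta> (c *\<^sub>C x) f v h = c * \<Theta> x f v h" "\<Theta> x (c *\<^sub>C f) v h = c * \<Theta> x f v h" for x y f g v h c
    by (simp_all add: \<Theta>_def algebra_simps)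
  have \<Theta>_const: "l x = l y"
    if H: "\<And>x h. x \<in> K \<Longrightarrow> x \<noteq> 0 \<Longrightarrow> \<Theta> x f w h = l x * T x h" and xy: "x \<in> K" "x \<noteq> 0" "y \<in> K" "y \<noteq> 0"
    for f w l x y
  proof (rule scalar_factor_constant[OF K Tlin Tnz _ _ xy])
    have "T 0 = 0" using Tlin(2)[OF complex_vector.subspace_0[OF K], of 0] by simp
    then have H': "l x * T x h = \<Theta> x f w h" if "x \<in> K" for x h
      using H[OF that] \<Theta>lin(3)[of 0 0 f w h] by (cases "x = 0") auto
    show "l (x + y) *\<^sub>C T (x + y) = l x *\<^sub>C T x + l y *\<^sub>C T y" if "x \<in> K" "y \<in> K" for x y
      by (rule cblinfun_eqI) (simp add: H' that complex_vector.subspace_add[OF K] \<Theta>lin)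
    show "l (c *\<^sub>C x) *\<^sub>C T (c *\<^sub>C x) = (c * l x) *\<^sub>C T x" if "x \<in> K" for c x
      by (rule cblinfun_eqI) (simp add: H' that complex_vector.subspace_scale[OF K] \<Theta>lin mult.assoc)
  qed
  have "(\<exists>\<sigma>' :: 'v dual. \<sigma>' \<noteq> 0 \<and> (\<forall>f\<in>K'. \<exists>Q :: 'g dual. \<forall>v h. cblinfun_apply f (\<beta> v h x0) = cblinfun_apply \<sigma>' v * cblinfun_apply Q h))
    \<or> (\<exists>\<tau> :: 'g dual. \<tau> \<noteq> 0 \<and> (\<forall>f\<in>K'. \<exists>P :: 'v dual. \<forall>v h. cblinfun_apply f (\<beta> v h x0) = cblinfun_apply P v * cblinfun_apply \<tau> h))"
    by (rule rank_one_form_family[OF K' f1(1,2)]) (use r1[OF x0(1)] in \<open>auto simp: K'_def\<close>)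
  then show ?thesis
  proof
    assume "\<exists>\<sigma>' :: 'v dual. \<sigma>' \<noteq> 0 \<and> (\<forall>f\<in>K'. \<exists>Q :: 'g dual. \<forall>v h. cblinfun_apply f (\<beta> v h x0) = cblinfun_apply \<sigma>' v * cblinfun_apply Q h)"
    then obtain \<sigma>' :: "'v dual" and S :: "'a dual \<Rightarrow> 'g dual" where
      \<sigma>': "\<sigma>' \<noteq> 0" and S: "\<And>f v h. f \<in> K' \<Longrightarrow> f (\<beta> v h x0) = \<sigma>' v * S f h" by metis
    note Slin = rank_one_factor_linear[OF K' \<sigma>', of "\<lambda>f v h. f (\<beta> v h x0)" S, OF S, simplified]
    have Snz: "S f \<noteq> 0" if "f \<in> K'" "f \<noteq> 0" for f
      using nz[of x0 f] x0(1) S[OF that(1)] that by (auto simp: K'_def)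
    have \<sigma>\<sigma>': "\<sigma>' \<notin> complex_vector.span {\<sigma>}" using indep(1)[OF f1(3,4,1,2) S[OF f1(1)]] .
    have "\<exists>l m. l * m = - f x \<and> (\<forall>v h. \<Theta> x f v h = l * (\<sigma> v * S f h) + m * (\<sigma>' v * T x h))"
      if "x \<in> K" "x \<noteq> 0" "f \<in> K'" "f \<noteq> 0" for x f
    proof -
      have "S f \<notin> complex_vector.span {T x}" using indep(2)[OF that S[OF that(3)]] .
      moreover have "\<exists>P Q. \<forall>v h. \<Theta> x f v h + a * (\<sigma> v * T x h) + b * (\<sigma>' v * S f h) = (P v * Q h :: complex)"
        if "a * b = - f x" for a b
        using pencil[of x f b a] \<open>x \<in> K\<close> \<open>x \<noteq> 0\<close> \<open>f \<in> K'\<close> \<open>f \<noteq> 0\<close> that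
        by (simp add: S T add.commute add.left_commute mult.commute)
      ultimately show ?thesis
        using rank_one_form_pencil[OF left(1) Tnz[OF that(1,2)] \<sigma>\<sigma>', where w = "f x" and \<Theta> = "\<Theta> x f"] by metis
    qed
    then obtain l m where lm: "\<And>x f. x \<in> K \<Longrightarrow> x \<noteq> 0 \<Longrightarrow> f \<in> K' \<Longrightarrow> f \<noteq> 0 \<Longrightarrow>
      l x f * m x f = - f x \<and> (\<forall>v h. \<Theta> x f v h = l x f * (\<sigma> v * S f h) + m x f * (\<sigma>' v * T x h))" by metis
    obtain v1 where v1: "\<sigma>' v1 = 1" "\<sigma> v1 = 0" using functional_separates \<sigma>\<sigma>' by blast
    obtain v2 where v2: "\<sigma> v2 = 1" "\<sigma>' v2 = 0"
      using functional_separates not_in_span_swap(1)[OF left(1) \<sigma>\<sigma>'] by blast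
    have m: "m x1 f2 = m x2 f2"
      by (rule \<Theta>_const[of f2 v1 "\<lambda>x. m x f2"]) (use lm f1 v1 in auto)
    have l: "l x1 f1 = l x1 f2"
    proof (rule scalar_factor_constant[OF K' Slin Snz _ _ f1(1,2,5,6), of "l x1"])
      have "S 0 = 0" using Slin(2)[OF complex_vector.subspace_0[OF K'], of 0] by simp
      then have H': "l x1 f * S f h = \<Theta> x1 f v2 h" if "f \<in> K'" for f h
        using lm[OF f1(3,4) that] v2 \<Theta>lin(4)[of x1 0 0 v2 h] by (cases "f = 0") auto
      show "l x1 (f + g) *\<^sub>C S (f + g) = l x1 f *\<^sub>C S f + l x1 g *\<^sub>C S g" if "f \<in> K'" "g \<in> K'" for f g
        by (rule cblinfun_eqI) (simp add: H' that complex_vector.subspace_add[OF K'] \<Theta>lin)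
      show "l x1 (c *\<^sub>C f) *\<^sub>C S (c *\<^sub>C f) = (c * l x1 f) *\<^sub>C S f" if "f \<in> K'" for c f
        by (rule cblinfun_eqI) (simp add: H' that complex_vector.subspace_scale[OF K'] \<Theta>lin mult.assoc)
    qed
    \<comment> \<open>By the outer equations \<open>l x1 f2 = l x1 f1\<close> and
      \<open>m x1 f2 = m x2 f2\<close> are nonzero, yet the middle one makes their product 0. This
      is where a third vector \<open>x2\<close> is used.\<close>
    have "l x1 f1 * m x1 f1 = -1" "l x1 f2 * m x1 f2 = 0" "l x2 f2 * m x2 f2 = -1"
      using lm[OF f1(3,4,1,2)] lm[OF f1(3,4,5,6)] lm[OF f1(7,8,5,6)] b by auto
    then show ?thesis using l m by auto
  next
    assume "\<exists>\<tau> :: 'g dual. \<tau> \<noteq> 0 \<and> (\<forall>f\<in>K'. \<exists>P :: 'v dual. \<forall>v h. cblinfun_apply f (\<beta> v h x0) = cblinfun_apply P v * cblinfun_apply \<tau> h)"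
    then obtain \<tau> :: "'g dual" and S :: "'a dual \<Rightarrow> 'v dual" where
      \<tau>: "\<tau> \<noteq> 0" and S: "\<And>f v h. f \<in> K' \<Longrightarrow> f (\<beta> v h x0) = S f v * \<tau> h" by metis
    have S': "f (\<beta> v h x0) = \<tau> h * S f v" if "f \<in> K'" for f v h using S[OF that] by (simp add: mult.commute)
    note Slin = rank_one_factor_linear[OF K' \<tau>, of "\<lambda>f h v. f (\<beta> v h x0)" S, OF S', simplified]
    have ind: "S f \<notin> complex_vector.span {\<sigma>}" "\<tau> \<notin> complex_vector.span {T x}"
      if "x \<in> K" "x \<noteq> 0" "f \<in> K'" "f \<noteq> 0" for x f
      using indep[OF that S[OF that(3)]] by auto
    have Snz: "S f \<noteq> 0" if "f \<in> K'" "f \<noteq> 0" for f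
      using ind(1)[OF f1(3,4) that] complex_vector.span_zero by metis
    have "\<exists>l m. l * m = - f x \<and> (\<forall>v h. \<Theta> x f v h = l * (S f v * T x h) + m * (\<sigma> v * \<tau> h))"
      if x: "x \<in> K" "x \<noteq> 0" "f \<in> K'" "f \<noteq> 0" for x f
    proof -
      have "\<exists>P Q. \<forall>v h. \<Theta> x f v h + a * (\<sigma> v * T x h) + b * (S f v * \<tau> h) = (P v * Q h :: complex)"
        if "a * b = - f x" for a b
        using pencil[OF x, of b a] that x
        by (simp add: S T add.commute add.left_commute mult.commute)
      then obtain l m where "l * m = - f x" "\<And>v h. \<Theta> x f v h = l * (\<sigma> v * \<tau> h) + m * (S f v * T x h)"
        using rank_one_form_pencil[OF left(1) Tnz[OF x(1,2)] ind[OF x], where w = "f x" and \<Theta> = "\<Theta> x f"] by metis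
      then show ?thesis by (intro exI[of _ m] exI[of _ l]) (simp add: mult.commute)
    qed
    then obtain l m where lm: "\<And>x f. x \<in> K \<Longrightarrow> x \<noteq> 0 \<Longrightarrow> f \<in> K' \<Longrightarrow> f \<noteq> 0 \<Longrightarrow>
      l x f * m x f = - f x \<and> (\<forall>v h. \<Theta> x f v h = l x f * (S f v * T x h) + m x f * (\<sigma> v * \<tau> h))" by metis
    have lx: "l x f = l x1 f" if xf: "x \<in> K" "x \<noteq> 0" "f \<in> K'" "f \<noteq> 0" for x f
    proof -
      obtain v where "S f v = 1" "\<sigma> v = 0" using functional_separates ind(1)[OF xf] by blast
      then show ?thesis by (intro \<Theta>_const[of f v "\<lambda>x. l x f"]) (use lm f1 xf in auto)
    qed
    have lf: "l x1 f = l x1 f1" if f: "f \<in> K'" "f \<noteq> 0" for f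
    proof (rule scalar_factor_constant[OF K' Slin Snz _ _ f f1(1,2), of "l x1"])
      obtain h1 where h1: "T x1 h1 = 1" "\<tau> h1 = 0"
        using functional_separates not_in_span_swap(1)[OF Tnz[OF f1(3,4)] ind(2)[OF f1(3,4,1,2)]] by blast
      have "S 0 = 0" using Slin(2)[OF complex_vector.subspace_0[OF K'], of 0] by simp
      then have H': "l x1 f * S f v = \<Theta> x1 f v h1" if "f \<in> K'" for f v
        using lm[OF f1(3,4) that] h1 \<Theta>lin(4)[of x1 0 0 v h1] by (cases "f = 0") auto
      show "l x1 (f + g) *\<^sub>C S (f + g) = l x1 f *\<^sub>C S f + l x1 g *\<^sub>C S g" if "f \<in> K'" "g \<in> K'" for f g
        by (rule cblinfun_eqI) (simp add: H' that complex_vector.subspace_add[OF K'] \<Theta>lin)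
      show "l x1 (c *\<^sub>C f) *\<^sub>C S (c *\<^sub>C f) = (c * l x1 f) *\<^sub>C S f" if "f \<in> K'" for c f
        by (rule cblinfun_eqI) (simp add: H' that complex_vector.subspace_scale[OF K'] \<Theta>lin mult.assoc)
    qed
    define L where "L = l x1 f1"
    have L: "l x f = L" if "x \<in> K" "x \<noteq> 0" "f \<in> K'" "f \<noteq> 0" for x f
      using lx[OF that] lf[OF that(3,4)] by (simp add: L_def)
    have L0: "L \<noteq> 0" using lm[OF f1(3,4,1,2)] b by (auto simp: L_def)
    have \<Theta>: "\<Theta> x f v h = L * (S f v * T x h) - f x / L * (\<sigma> v * \<tau> h)" if xf: "x \<in> K" "f \<in> K'" for x f v h
    proof (cases "x = 0 \<or> f = 0")
      case True
      have "T 0 = 0" "S 0 = 0"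
        using Tlin(2)[OF complex_vector.subspace_0[OF K], of 0] Slin(2)[OF complex_vector.subspace_0[OF K'], of 0]
        by simp_all
      then show ?thesis using True by (auto simp: \<Theta>_def)
    next
      case False
      then have "L * m x f = - f x" "\<Theta> x f v h = L * (S f v * T x h) + m x f * (\<sigma> v * \<tau> h)"
        using lm[of x f] L[of x f] xf by auto
      then show ?thesis using L0 by (metis (no_types, lifting) minus_divide_left mult_minus_left
            nonzero_mult_div_cancel_left uminus_add_conv_diff add.commute)
    qed
    \<comment> \<open>The terms at \<open>x0\<close> and \<open>f0\<close> are dictated by the
      factorisation \<open>(L S f + k x0 \<sigma>) (T x + f0 z / L \<tau>)\<close> that
      \<open>main\<close> verifies.\<close>
    define T' where "T' z = T (z - f0 z *\<^sub>C x0) + (f0 z / L) *\<^sub>C \<tau>" for z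
    define S' where "S' k = L *\<^sub>C S (k - k x0 *\<^sub>C f0) + k x0 *\<^sub>C \<sigma>" for k :: "'a dual"
    have zK: "z - f0 z *\<^sub>C x0 \<in> K" for z using f0 by (simp add: K_def)
    have kK: "k - k x0 *\<^sub>C f0 \<in> K'" for k :: "'a dual" using f0 by (simp add: K'_def)
    have main: "k (\<beta> v h z) = S' k v * T' z h" if "k z = 0" for z v h and k :: "'a dual"
    proof -
      define x where "x = z - f0 z *\<^sub>C x0"
      define f where "f = k - k x0 *\<^sub>C f0"
      have xf: "x \<in> K" "f \<in> K'" using zK kK by (simp_all add: x_def f_def)
      have fx: "f x = - (f0 z * k x0)" using that f0 by (simp add: f_def x_def mult.commute)
      have z: "z = x + f0 z *\<^sub>C x0" and k: "k = f + k x0 *\<^sub>C f0" by (simp_all add: x_def f_def)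
      have "k (\<beta> v h z) = f (\<beta> v h x) + f0 z * f (\<beta> v h x0) + k x0 * f0 (\<beta> v h x)
          + (f0 z * k x0) * f0 (\<beta> v h x0)"
        by (subst k, subst z) (simp add: algebra_simps)
      also have "\<dots> = \<Theta> x f v h + f0 z * (S f v * \<tau> h) + k x0 * (\<sigma> v * T x h)"
        using fx S[OF xf(2)] T[OF xf(1)] by (simp add: \<Theta>_def)
      also have "\<dots> = (L * S f v + k x0 * \<sigma> v) * (T x h + f0 z / L * \<tau> h)"
        unfolding \<Theta>[OF xf] fx using L0 by (simp add: field_simps)
      finally show ?thesis by (simp add: S'_def T'_def x_def f_def)
    qed
    have "S' (f + g) = S' f + S' g" for f g
    proof -
      have e: "f + g - (f + g) x0 *\<^sub>C f0 = (f - f x0 *\<^sub>C f0) + (g - g x0 *\<^sub>C f0)"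
        by (simp add: scaleC_add_left)
      then show ?thesis unfolding S'_def e Slin(1)[OF kK kK] by (simp add: scaleC_add_left scaleC_add_right)
    qed
    moreover have "S' (c *\<^sub>C f) = c *\<^sub>C S' f" for f c
    proof -
      have e: "c *\<^sub>C f - (c *\<^sub>C f) x0 *\<^sub>C f0 = c *\<^sub>C (f - f x0 *\<^sub>C f0)"
        by (simp add: complex_vector.scale_right_diff_distrib)
      then show ?thesis unfolding S'_def e Slin(2)[OF kK] by (simp add: scaleC_add_right mult.commute)
    qed
    moreover have "T' (x + y) = T' x + T' y" for x y
    proof -
      have e: "x + y - f0 (x + y) *\<^sub>C x0 = (x - f0 x *\<^sub>C x0) + (y - f0 y *\<^sub>C x0)"
        by (simp add: scaleC_add_left)
      then show ?thesis unfolding T'_def e Tlin(1)[OF zK zK] by (simp add: scaleC_add_left add_divide_distrib)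
    qed
    moreover have "T' (c *\<^sub>C x) = c *\<^sub>C T' x" for x c
    proof -
      have e: "c *\<^sub>C x - f0 (c *\<^sub>C x) *\<^sub>C x0 = c *\<^sub>C (x - f0 x *\<^sub>C x0)"
        by (simp add: complex_vector.scale_right_diff_distrib)
      then show ?thesis unfolding T'_def e Tlin(2)[OF zK] by (simp add: scaleC_add_right)
    qed
    ultimately show ?thesis using main by (intro exI[of _ S'] exI[of _ T']) blast
  qed
qed

text \<open>The forms over a fixed \<open>f0\<close> have a constant left or a constant right
  factor; the second case is the first with the arguments of \<open>\<beta>\<close> exchanged. These
  cases become the similarity and the adjoint form of \<open>\<Phi>\<close>.\<close>

theorem nilpotent_form_structure:
  fixes \<beta> :: "'v::complex_normed_vector \<Rightarrow> 'g::complex_normed_vector \<Rightarrow> 'a::complex_normed_vector \<Rightarrow>\<^sub>B 'a"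
  assumes dim: "complex_dim_ge TYPE('a) 3"
    and r1: "\<And>x f. x \<noteq> 0 \<Longrightarrow> f \<noteq> 0 \<Longrightarrow> cblinfun_apply f x = (0 :: complex) \<Longrightarrow>
      \<exists>(P :: 'v dual) (Q :: 'g dual). P \<noteq> 0 \<and> Q \<noteq> 0 \<and>
        (\<forall>v h. cblinfun_apply f (\<beta> v h x) = cblinfun_apply P v * cblinfun_apply Q h)"
    and par: "\<And>x f y g (P :: 'v dual) (Q :: 'g dual) P' Q'.
      \<lbrakk>x \<noteq> 0; f \<noteq> 0; cblinfun_apply f x = (0 :: complex); y \<noteq> 0; g \<noteq> 0; cblinfun_apply g y = (0 :: complex);
       \<And>v h. cblinfun_apply f (\<beta> v h x) = cblinfun_apply P v * cblinfun_apply Q h;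
       \<And>v h. cblinfun_apply g (\<beta> v h y) = cblinfun_apply P' v * cblinfun_apply Q' h;
       P' \<in> complex_vector.span {P} \<or> Q' \<in> complex_vector.span {Q}\<rbrakk>
      \<Longrightarrow> y \<in> complex_vector.span {x} \<or> g \<in> complex_vector.span {f}"
  shows "(\<exists>S T. (\<forall>f g :: 'a dual. S (f + g) = (S f + S g :: 'v dual)) \<and> (\<forall>c f. S (c *\<^sub>C f) = c *\<^sub>C S f) \<and>
    (\<forall>x y :: 'a. T (x + y) = (T x + T y :: 'g dual)) \<and> (\<forall>c x. T (c *\<^sub>C x) = c *\<^sub>C T x) \<and>
    (\<forall>x f v h. cblinfun_apply f x = 0 \<longrightarrow>
      cblinfun_apply f (\<beta> v h x) = cblinfun_apply (S f) v * cblinfun_apply (T x) h)) \<or>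
    (\<exists>S T. (\<forall>f g :: 'a dual. S (f + g) = (S f + S g :: 'g dual)) \<and> (\<forall>c f. S (c *\<^sub>C f) = c *\<^sub>C S f) \<and>
    (\<forall>x y :: 'a. T (x + y) = (T x + T y :: 'v dual)) \<and> (\<forall>c x. T (c *\<^sub>C x) = c *\<^sub>C T x) \<and>
    (\<forall>x f h v. cblinfun_apply f x = 0 \<longrightarrow>
      cblinfun_apply f (\<beta> v h x) = cblinfun_apply (S f) h * cblinfun_apply (T x) v))"
    (is "?L \<or> ?R")
proof -
  obtain x0 :: 'a where "x0 \<notin> complex_vector.span {}" using not_in_span_of_dim[OF dim, of "{}"] by auto
  then have "x0 \<noteq> 0" by simp
  then obtain f0 :: "'a dual" where f0: "f0 x0 = 1" using separate0 by blast
  then have "f0 \<noteq> 0" by auto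
  obtain x1 where x1: "f0 x1 = 0" "x1 \<noteq> 0"
    using biorthogonal_triple[OF dim f0] by (metis cblinfun_linear_simps(4) zero_neq_one)
  define K where "K = {x. f0 x = 0}"
  have K: "complex_vector.subspace K" by (auto simp: K_def complex_vector.subspace_def)
  have "(\<exists>\<sigma> :: 'v dual. \<sigma> \<noteq> 0 \<and> (\<forall>x\<in>K. \<exists>Q :: 'g dual. \<forall>v h. f0 (\<beta> v h x) = cblinfun_apply \<sigma> v * cblinfun_apply Q h))
    \<or> (\<exists>\<tau> :: 'g dual. \<tau> \<noteq> 0 \<and> (\<forall>x\<in>K. \<exists>P :: 'v dual. \<forall>v h. f0 (\<beta> v h x) = cblinfun_apply P v * cblinfun_apply \<tau> h))"
    by (rule rank_one_form_family[OF K, of x1]) (use x1 r1[OF _ \<open>f0 \<noteq> 0\<close>] in \<open>auto simp: K_def\<close>)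
  then show ?thesis
  proof
    assume "\<exists>\<sigma> :: 'v dual. \<sigma> \<noteq> 0 \<and> (\<forall>x\<in>K. \<exists>Q :: 'g dual. \<forall>v h. f0 (\<beta> v h x) = cblinfun_apply \<sigma> v * cblinfun_apply Q h)"
    then obtain \<sigma> :: "'v dual" where \<sigma>: "\<sigma> \<noteq> 0"
      "\<And>x. f0 x = 0 \<Longrightarrow> \<exists>Q :: 'g dual. \<forall>v h. f0 (\<beta> v h x) = cblinfun_apply \<sigma> v * cblinfun_apply Q h"
      unfolding K_def by blast
    show ?thesis
      by (rule disjI1, rule nilpotent_form_structure_left[OF dim r1 par f0 \<sigma>])
  next
    assume "\<exists>\<tau> :: 'g dual. \<tau> \<noteq> 0 \<and> (\<forall>x\<in>K. \<exists>P :: 'v dual. \<forall>v h. f0 (\<beta> v h x) = cblinfun_apply P v * cblinfun_apply \<tau> h)"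
    then obtain \<tau> :: "'g dual" where \<tau>: "\<tau> \<noteq> 0"
      "\<And>x. f0 x = 0 \<Longrightarrow> \<exists>P :: 'v dual. \<forall>h v. f0 (\<beta> v h x) = cblinfun_apply \<tau> h * cblinfun_apply P v"
    proof -
      assume H: "\<And>\<tau> :: 'g dual. \<lbrakk>\<tau> \<noteq> 0; \<And>x. f0 x = 0 \<Longrightarrow> \<exists>P :: 'v dual. \<forall>h v.
        f0 (\<beta> v h x) = cblinfun_apply \<tau> h * cblinfun_apply P v\<rbrakk> \<Longrightarrow> thesis"
      obtain \<tau> :: "'g dual" where "\<tau> \<noteq> 0" and \<tau>: "\<And>x. x \<in> K \<Longrightarrow> \<exists>P :: 'v dual. \<forall>v h.
        f0 (\<beta> v h x) = cblinfun_apply P v * cblinfun_apply \<tau> h"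
        using \<open>\<exists>\<tau>. _\<close> by blast
      show thesis
      proof (rule H[OF \<open>\<tau> \<noteq> 0\<close>])
        fix x assume "f0 x = 0"
        then obtain P :: "'v dual" where "\<forall>v h. f0 (\<beta> v h x) = P v * \<tau> h" using \<tau>[of x] by (auto simp: K_def)
        then show "\<exists>P :: 'v dual. \<forall>h v. f0 (\<beta> v h x) = cblinfun_apply \<tau> h * cblinfun_apply P v"
          by (intro exI[of _ P]) (simp add: mult.commute)
      qed
    qed
    have "\<exists>S T. (\<forall>f g :: 'a dual. S (f + g) = (S f + S g :: 'g dual)) \<and> (\<forall>c f. S (c *\<^sub>C f) = c *\<^sub>C S f) \<and>
      (\<forall>x y :: 'a. T (x + y) = (T x + T y :: 'v dual)) \<and> (\<forall>c x. T (c *\<^sub>C x) = c *\<^sub>C T x) \<and>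
      (\<forall>x f h v. cblinfun_apply f x = 0 \<longrightarrow>
        cblinfun_apply f (\<beta> v h x) = cblinfun_apply (S f) h * cblinfun_apply (T x) v)"
    proof (rule nilpotent_form_structure_left[where \<beta> = "\<lambda>h v. \<beta> v h", OF dim _ _ f0 \<tau>])
      show "\<exists>(P :: 'g dual) (Q :: 'v dual). P \<noteq> 0 \<and> Q \<noteq> 0 \<and>
          (\<forall>h v. cblinfun_apply f (\<beta> v h x) = cblinfun_apply P h * cblinfun_apply Q v)"
        if "x \<noteq> 0" "f \<noteq> 0" "cblinfun_apply f x = (0 :: complex)" for x f
        using r1[OF that] by (metis mult.commute)
    next
      fix x f y g and P :: "'g dual" and Q :: "'v dual" and P' Q'
      assume a: "x \<noteq> 0" "f \<noteq> 0" "cblinfun_apply f x = (0 :: complex)" "y \<noteq> 0" "g \<noteq> 0" "cblinfun_apply g y = (0 :: complex)"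
        "\<And>h v. cblinfun_apply f (\<beta> v h x) = cblinfun_apply P h * cblinfun_apply Q v"
        "\<And>h v. cblinfun_apply g (\<beta> v h y) = cblinfun_apply P' h * cblinfun_apply Q' v"
        "P' \<in> complex_vector.span {P} \<or> Q' \<in> complex_vector.span {Q}"
      show "y \<in> complex_vector.span {x} \<or> g \<in> complex_vector.span {f}"
        by (rule par[OF a(1-6), of Q P Q' P']) (use a(7-9) in \<open>auto simp: mult.commute\<close>)
    qed
    then show ?thesis by (rule disjI2)
  qed
qed

section \<open>Correspondences between rank-one nilpotents\<close>

declare canonical_embedding_apply [simp]

lemma canonical_embedding_eq_iff: "canonical_embedding x = canonical_embedding y \<longleftrightarrow> x = y"
  by (metis canonical_embedding_apply dual_separates)

lemma canonical_embedding_scaleC: "canonical_embedding (c *\<^sub>C x) = c *\<^sub>C canonical_embedding x"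
  by (rule cblinfun_eqI) simp

lemma canonical_embedding_eq_0_iff: "canonical_embedding x = 0 \<longleftrightarrow> x = 0"
  using canonical_embedding_eq_iff[of x 0] canonical_embedding_scaleC[of 0 x] by simp

lemma canonical_embedding_span_iff:
  "canonical_embedding y \<in> complex_vector.span {canonical_embedding x} \<longleftrightarrow> y \<in> complex_vector.span {x}"
  by (simp add: span_singleton_iff canonical_embedding_eq_iff flip: canonical_embedding_scaleC)

text \<open>Both sides are linear in \<open>v\<close>: scaling reaches every \<open>v\<close> with
  \<open>h v \<noteq> 0\<close>, and a vector in the kernel of \<open>h\<close> is a difference of
  two such vectors. Rank-one idempotents therefore suffice as tests.\<close>

lemma tensor_eqI:
  fixes f1 f2 f3 :: "'a::complex_normed_vector dual"
  assumes H: "\<And>v h. cblinfun_apply h v = (1 :: complex) \<Longrightarrow> f1 v * h x1 + f2 v * h x2 = f3 v * h x3"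
  shows "f1 v * cblinfun_apply h x1 + f2 v * h x2 = f3 v * h x3"
proof -
  define B where "B v = f1 v * h x1 + f2 v * h x2 - f3 v * h x3" for v
  have add: "B (v + w) = B v + B w" and scale: "B (c *\<^sub>C v) = c * B v" for v w c
    by (simp_all add: B_def algebra_simps)
  have B1: "B v = 0" if "h v = 1" for v using H[OF that] by (simp add: B_def)
  have Bn: "B v = 0" if "h v \<noteq> 0" for v
    using B1[of "inverse (h v) *\<^sub>C v"] that by (simp add: scale)
  have "B v = 0"
  proof (cases "h v = 0")
    case True
    show ?thesis
    proof (cases "\<exists>w. h w \<noteq> 0")
      case True
      then obtain w where w: "h w \<noteq> 0" by blast
      then have "B (v + w) = 0" "B w = 0" using Bn \<open>h v = 0\<close> by simp_all
      then show ?thesis by (simp add: add)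
    next
      case False
      then have "h = 0" by (intro cblinfun_eqI) simp
      then show ?thesis by (simp add: B_def)
    qed
  qed (rule Bn)
  then show ?thesis by (simp add: B_def)
qed

lemma tensor_sum_rank_one:
  fixes f1 f2 f3 :: "'a::complex_normed_vector dual"
  assumes "\<And>v h. f1 v * cblinfun_apply h x1 + f2 v * h x2 = f3 v * h x3" and "f1 \<noteq> 0" "x1 \<noteq> 0"
  shows "f2 \<in> complex_vector.span {f1} \<or> x2 \<in> complex_vector.span {x1}"
  using rank_one_forms_add[of f1 "canonical_embedding x1" f2 "canonical_embedding x2" f3 "canonical_embedding x3"]
    assms by (simp add: canonical_embedding_eq_0_iff canonical_embedding_span_iff)

lemma functional_nonzeroE:
  assumes "f \<noteq> 0"
  obtains v where "cblinfun_apply f v = (1 :: complex)"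
proof -
  obtain v where "f v \<noteq> 0" using assms by (metis cblinfun_apply_zero cblinfun_eqI)
  then show ?thesis using that[of "inverse (f v) *\<^sub>C v"] by simp
qed

lemma idempotent_trace_nonzero:
  fixes f :: "'a::complex_normed_vector dual"
  assumes "x \<noteq> 0" "f \<noteq> 0"
  obtains v h where "cblinfun_apply h v = (1 :: complex)" "f v * h x \<noteq> 0"
proof -
  obtain v where v: "f v = 1" using functional_nonzeroE assms(2) by blast
  then have "v \<noteq> 0" by auto
  then obtain h :: "'a dual" where h: "h x \<noteq> 0" "h v \<noteq> 0"
    using three_vectors[of x 0 v] assms(1) by (auto simp: span_singleton_iff)
  then show ?thesis using that[of "inverse (h v) *\<^sub>C h" v] v by simp
qed

lemma kernel_vector:
  fixes f :: "'a::complex_normed_vector dual"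
  assumes "complex_dim_ge TYPE('a) 3"
  obtains x where "x \<noteq> 0" "f x = 0"
proof (cases "f = 0")
  case True
  obtain x :: 'a where "x \<notin> complex_vector.span {}" using not_in_span_of_dim[OF assms, of "{}"] by auto
  then show ?thesis using that[of x] True by simp
next
  case False
  then obtain v where v: "f v = 1" using functional_nonzeroE by blast
  obtain y :: 'a and g :: "'a dual" where "f y = 0" "g y = 1"
    using biorthogonal_triple[OF assms v] by metis
  then show ?thesis using that[of y] by force
qed

lemma annihilating_functional:
  fixes x :: "'a::complex_normed_vector"
  assumes "complex_dim_ge TYPE('a) 3"
  obtains f :: "'a dual" where "f \<noteq> 0" "f x = 0"
proof -
  obtain y where "y \<notin> complex_vector.span {x}" using not_in_span_of_dim[OF assms, of "{x}"] by auto
  then obtain f :: "'a dual" where "f y = 1" "f x = 0" using separate1 by blast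
  then show ?thesis using that[of f] by force
qed

text \<open>\<open>f (\<theta> i x)\<close> is the trace of \<open>\<theta> i\<close> times
  \<open>x \<otimes> f\<close>. The index set will be the algebra, with \<open>\<theta>1 A\<close>
  and \<open>\<theta>2 A\<close> equal to the \<open>r\<close>-th powers of \<open>A\<close> and
  \<open>\<Phi> A\<close> when \<open>s = 0\<close> and to \<open>A\<close> and
  \<open>\<Phi> A\<close> otherwise, so that one argument covers both cases.\<close>

definition trace_equiv ::
  "'i set \<Rightarrow> ('i \<Rightarrow> 'a::complex_normed_vector \<Rightarrow>\<^sub>B 'a) \<Rightarrow> ('i \<Rightarrow> 'b::complex_normed_vector \<Rightarrow>\<^sub>B 'b)
    \<Rightarrow> 'a \<Rightarrow> 'a dual \<Rightarrow> 'b \<Rightarrow> 'b dual \<Rightarrow> bool"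
  where "trace_equiv I \<theta>1 \<theta>2 x f u g \<longleftrightarrow> (\<forall>i\<in>I. f (\<theta>1 i x) = g (\<theta>2 i u))"

definition covers_idempotents :: "'i set \<Rightarrow> ('i \<Rightarrow> 'a::complex_normed_vector \<Rightarrow>\<^sub>B 'a) \<Rightarrow> bool"
  where "covers_idempotents I \<theta> \<longleftrightarrow> (\<forall>v h. cblinfun_apply h v = (1 :: complex) \<longrightarrow> (\<exists>i\<in>I. \<theta> i = rank_one v h))"

lemma trace_equiv_commute: "trace_equiv I \<theta>1 \<theta>2 x f u g \<longleftrightarrow> trace_equiv I \<theta>2 \<theta>1 u g x f"
  unfolding trace_equiv_def by metis

definition nilpotents_correspond ::
  "'i set \<Rightarrow> ('i \<Rightarrow> 'a::complex_normed_vector \<Rightarrow>\<^sub>B 'a) \<Rightarrow> ('i \<Rightarrow> 'b::complex_normed_vector \<Rightarrow>\<^sub>B 'b) \<Rightarrow> bool"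
  where "nilpotents_correspond I \<theta>1 \<theta>2 \<longleftrightarrow> (\<forall>x f. x \<noteq> 0 \<and> f \<noteq> 0 \<and> cblinfun_apply f x = (0 :: complex) \<longrightarrow>
    (\<exists>u g. u \<noteq> 0 \<and> g \<noteq> 0 \<and> cblinfun_apply g u = (0 :: complex) \<and> trace_equiv I \<theta>1 \<theta>2 x f u g))"

lemma nilpotents_correspondD:
  assumes "nilpotents_correspond I \<theta>1 \<theta>2"
  shows "x \<noteq> 0 \<Longrightarrow> f \<noteq> 0 \<Longrightarrow> cblinfun_apply f x = (0 :: complex) \<Longrightarrow>
      \<exists>u g. u \<noteq> 0 \<and> g \<noteq> 0 \<and> cblinfun_apply g u = (0 :: complex) \<and> trace_equiv I \<theta>1 \<theta>2 x f u g"
    and "x \<noteq> 0 \<Longrightarrow> f \<noteq> 0 \<Longrightarrow> cblinfun_apply f x = (0 :: complex) \<Longrightarrow>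
      \<exists>u g. u \<noteq> 0 \<and> g \<noteq> 0 \<and> cblinfun_apply g u = (0 :: complex) \<and> trace_equiv I \<theta>2 \<theta>1 u g x f"
  using assms trace_equiv_commute[of I \<theta>1 \<theta>2] unfolding nilpotents_correspond_def by metis+

lemma trace_equiv_nonzero:
  assumes "trace_equiv I \<theta>1 \<theta>2 x f u g" "covers_idempotents I \<theta>1" "x \<noteq> 0" "f \<noteq> 0"
  shows "u \<noteq> 0" "g \<noteq> 0"
proof -
  obtain v h where vh: "cblinfun_apply h v = 1" "f v * h x \<noteq> 0" using idempotent_trace_nonzero assms(3,4) by blast
  obtain i where i: "i \<in> I" "\<theta>1 i = rank_one v h" using assms(2) vh(1) unfolding covers_idempotents_def by blast
  have "g (\<theta>2 i u) = f (\<theta>1 i x)" using assms(1) i(1) by (simp add: trace_equiv_def)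
  also have "\<dots> \<noteq> 0" using vh(2) by (simp add: i(2) mult.commute)
  finally show "u \<noteq> 0" "g \<noteq> 0" by auto
qed

text \<open>A nilpotent \<open>x \<otimes> f\<close> is written as \<open>(x + y) \<otimes> f - y \<otimes> f\<close> with \<open>f y = 1\<close>; since also
  \<open>(x + 2 y) \<otimes> f\<close> corresponds to a rank-one operator, so does the difference.\<close>

lemma nilpotent_correspondence_of_idempotents:
  fixes \<theta>1 :: "'i \<Rightarrow> 'a::complex_normed_vector \<Rightarrow>\<^sub>B 'a" and \<theta>2 :: "'i \<Rightarrow> 'b::complex_normed_vector \<Rightarrow>\<^sub>B 'b"
  assumes cov1: "covers_idempotents I \<theta>1" and cov2: "covers_idempotents I \<theta>2"
    and fwd: "\<And>x f. cblinfun_apply f x \<noteq> (0 :: complex) \<Longrightarrow> \<exists>u g. cblinfun_apply g u \<noteq> (0 :: complex) \<and> trace_equiv I \<theta>1 \<theta>2 x f u g"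
    and bwd: "\<And>u g. cblinfun_apply g u \<noteq> (0 :: complex) \<Longrightarrow> \<exists>x f. cblinfun_apply f x \<noteq> (0 :: complex) \<and> trace_equiv I \<theta>1 \<theta>2 x f u g"
  shows "nilpotents_correspond I \<theta>1 \<theta>2"
  unfolding nilpotents_correspond_def
proof (intro allI impI, elim conjE)
  fix x and f :: "'a dual" assume xf: "x \<noteq> 0" "f \<noteq> 0" "f x = 0"
  obtain y where y: "f y = 1" using functional_nonzeroE xf(2) by blast
  obtain u1 g1 where 1: "cblinfun_apply g1 u1 \<noteq> (0 :: complex)" "trace_equiv I \<theta>1 \<theta>2 (x + y) f u1 g1"
    using fwd[of f "x + y"] xf y by auto
  obtain u2 g2 where 2: "cblinfun_apply g2 u2 \<noteq> (0 :: complex)" "trace_equiv I \<theta>1 \<theta>2 y f u2 g2"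
    using fwd[of f y] y by auto
  obtain u3 g3 where 3: "trace_equiv I \<theta>1 \<theta>2 (x + y + y) f u3 g3"
    using fwd[of f "x + y + y"] xf y by auto
  have "g1 v * cblinfun_apply h u1 + g2 v * h u2 = g3 v * h u3" for v h
  proof (rule tensor_eqI)
    fix v :: 'b and h :: "'b dual" assume "cblinfun_apply h v = (1 :: complex)"
    then obtain i where i: "i \<in> I" "\<theta>2 i = rank_one v h" using cov2 unfolding covers_idempotents_def by blast
    then show "g1 v * h u1 + g2 v * h u2 = g3 v * h u3"
      using 1(2) 2(2) 3 unfolding trace_equiv_def by (auto simp: mult.commute dest!: bspec[of I _ i])
  qed
  moreover have n1: "g1 \<noteq> 0" "u1 \<noteq> 0" using 1(1) by auto
  ultimately have par: "g2 \<in> complex_vector.span {g1} \<or> u2 \<in> complex_vector.span {u1}"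
    using tensor_sum_rank_one by blast
  have diff: "f (\<theta>1 i x) = g1 (\<theta>2 i u1) - g2 (\<theta>2 i u2)" if "i \<in> I" for i
    using 1(2) 2(2) that unfolding trace_equiv_def by (metis add_diff_cancel_right' cblinfun_linear_simps(1))
  have "\<exists>u g. trace_equiv I \<theta>1 \<theta>2 x f u g"
  proof (cases "g2 \<in> complex_vector.span {g1}")
    case True
    then obtain c where "g2 = c *\<^sub>C g1" by (auto simp: span_singleton_iff)
    then have "trace_equiv I \<theta>1 \<theta>2 x f (u1 - c *\<^sub>C u2) g1" by (simp add: trace_equiv_def diff)
    then show ?thesis by blast
  next
    case False
    then obtain c where "u2 = c *\<^sub>C u1" using par by (auto simp: span_singleton_iff)
    then have "trace_equiv I \<theta>1 \<theta>2 x f u1 (g1 - c *\<^sub>C g2)" by (simp add: trace_equiv_def diff)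
    then show ?thesis by blast
  qed
  then obtain u g where ug: "trace_equiv I \<theta>1 \<theta>2 x f u g" by blast
  \<comment> \<open>Otherwise \<open>bwd\<close> yields a tensor \<open>x' \<otimes> f'\<close> of
    nonzero trace with the same traces as \<open>x \<otimes> f\<close>. Idempotents separate
    tensors, so the two coincide, against \<open>f x = 0\<close>.\<close>
  have "g u = 0"
  proof (rule ccontr)
    assume "g u \<noteq> 0"
    then obtain x' f' where x': "cblinfun_apply f' x' \<noteq> (0 :: complex)" "trace_equiv I \<theta>1 \<theta>2 x' f' u g" using bwd by blast
    have T: "f v * cblinfun_apply h x + (0 :: 'a dual) v * h x = f' v * h x'" for v h
    proof (rule tensor_eqI)
      fix v :: 'a and h :: "'a dual" assume "cblinfun_apply h v = (1 :: complex)"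
      then obtain i where i: "i \<in> I" "\<theta>1 i = rank_one v h" using cov1 unfolding covers_idempotents_def by blast
      have "f (\<theta>1 i x) = f' (\<theta>1 i x')" using x'(2) ug i(1) by (simp add: trace_equiv_def)
      then show "f v * h x + (0 :: 'a dual) v * h x = f' v * h x'" by (simp add: i(2) mult.commute)
    qed
    have "f' x' \<noteq> 0" "x' \<noteq> 0" using x'(1) by auto
    obtain h :: "'a dual" where h: "h x' = 1" using separate0[OF \<open>x' \<noteq> 0\<close>] by blast
    have f': "f' v = h x * f v" for v using T[of v h] h by (simp add: mult.commute)
    have "h' (h x *\<^sub>C x') = h' x" for h' :: "'a dual"
      using T[of y h'] y by (simp add: f')
    then have "h x *\<^sub>C x' = x" by (rule dual_separates)
    then have "f' x' = f x" by (metis cblinfun_apply_scaleC f' scaleC_complex_def)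
    then show False using x'(1) xf(3) by simp
  qed
  then show "\<exists>u g. u \<noteq> 0 \<and> g \<noteq> 0 \<and> cblinfun_apply g u = (0 :: complex) \<and> trace_equiv I \<theta>1 \<theta>2 x f u g"
    using trace_equiv_nonzero[OF ug cov1 xf(1,2)] ug by blast
qed

text \<open>The trace against \<open>v \<otimes> h\<close> on the second space is reproduced by an
  operator \<open>\<beta> v h\<close> on the first, obtained from the family for idempotents and by
  scaling and subtraction in general. Then \<open>f (\<beta> v h x) = g v * h u\<close> is a
  rank-one form, with \<open>u\<close> acting on \<open>h\<close> through the canonical
  embedding.\<close>

lemma trace_equiv_structure:
  fixes \<theta>1 :: "'i \<Rightarrow> 'a::complex_normed_vector \<Rightarrow>\<^sub>B 'a" and \<theta>2 :: "'i \<Rightarrow> 'b::complex_normed_vector \<Rightarrow>\<^sub>B 'b"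
  assumes dim: "complex_dim_ge TYPE('a) 3"
    and cov1: "covers_idempotents I \<theta>1" and cov2: "covers_idempotents I \<theta>2"
    and corr: "nilpotents_correspond I \<theta>1 \<theta>2" "nilpotents_correspond I \<theta>2 \<theta>1"
  shows "(\<exists>S T. (\<forall>f g :: 'a dual. S (f + g) = (S f + S g :: 'b dual)) \<and> (\<forall>c f. S (c *\<^sub>C f) = c *\<^sub>C S f) \<and>
    (\<forall>x y :: 'a. T (x + y) = (T x + T y :: 'b dual dual)) \<and> (\<forall>c x. T (c *\<^sub>C x) = c *\<^sub>C T x) \<and>
    (\<forall>x f u g v h. cblinfun_apply f x = 0 \<longrightarrow> trace_equiv I \<theta>1 \<theta>2 x f u g \<longrightarrow>
      cblinfun_apply g v * cblinfun_apply h u = cblinfun_apply (S f) v * cblinfun_apply (T x) h)) \<or>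
    (\<exists>S T. (\<forall>f g :: 'a dual. S (f + g) = (S f + S g :: 'b dual dual)) \<and> (\<forall>c f. S (c *\<^sub>C f) = c *\<^sub>C S f) \<and>
    (\<forall>x y :: 'a. T (x + y) = (T x + T y :: 'b dual)) \<and> (\<forall>c x. T (c *\<^sub>C x) = c *\<^sub>C T x) \<and>
    (\<forall>x f u g v h. cblinfun_apply f x = 0 \<longrightarrow> trace_equiv I \<theta>1 \<theta>2 x f u g \<longrightarrow>
      cblinfun_apply g v * cblinfun_apply h u = cblinfun_apply (S f) h * cblinfun_apply (T x) v))"
proof -
  note fwd = nilpotents_correspondD(1)[OF corr(1)] and bwd = nilpotents_correspondD(2)[OF corr(2)]
  define good where "good v h b \<longleftrightarrow> (\<forall>x f u g. trace_equiv I \<theta>1 \<theta>2 x f u g \<longrightarrow> f (cblinfun_apply b x) = g v * h u)"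
    for v :: 'b and h :: "'b dual" and b :: "'a \<Rightarrow>\<^sub>B 'a"
  have good1: "\<exists>b. good v h b" if hv: "h v = 1" for v and h :: "'b dual"
  proof -
    obtain i where i: "i \<in> I" "\<theta>2 i = rank_one v h" using cov2 hv unfolding covers_idempotents_def by blast
    then have "good v h (\<theta>1 i)" by (auto simp: good_def trace_equiv_def mult.commute)
    then show ?thesis by blast
  qed
  have goodn: "\<exists>b. good v h b" if hv: "h v \<noteq> 0" for v and h :: "'b dual"
  proof -
    obtain b where "good (inverse (h v) *\<^sub>C v) h b" using good1[of h "inverse (h v) *\<^sub>C v"] hv by auto
    then have "good v h (h v *\<^sub>C b)" using hv by (auto simp: good_def)
    then show ?thesis by blast
  qed
  have "\<exists>b. good v h b" for v h
  proof (cases "h v = 0")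
    case True
    show ?thesis
    proof (cases "h = 0")
      case True
      then have "good v h 0" by (auto simp: good_def)
      then show ?thesis by blast
    next
      case False
      then obtain w where w: "h w = 1" using functional_nonzeroE by blast
      then obtain b b' where b: "good (v + w) h b" "good w h b'" using goodn[of h "v + w"] goodn[of h w] True by auto
      then have "good v h (b - b')" by (auto simp: good_def algebra_simps)
      then show ?thesis by blast
    qed
  qed (rule goodn)
  then obtain \<beta> where \<beta>: "\<And>v h. good v h (\<beta> v h)" by metis
  have te: "f (\<beta> v h x) = g v * h u" if "trace_equiv I \<theta>1 \<theta>2 x f u g"
    for x u v and f :: "'a dual" and g h :: "'b dual"
    using \<beta> that unfolding good_def by blast
  have r1: "\<exists>(P :: 'b dual) (Q :: 'b dual dual). P \<noteq> 0 \<and> Q \<noteq> 0 \<and>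
      (\<forall>v h. cblinfun_apply f (\<beta> v h x) = cblinfun_apply P v * cblinfun_apply Q h)"
    if xf: "x \<noteq> 0" "f \<noteq> 0" "cblinfun_apply f x = (0 :: complex)" for x f
  proof -
    obtain u g where "u \<noteq> 0" "g \<noteq> 0" "trace_equiv I \<theta>1 \<theta>2 x f u g" using fwd[OF xf] by blast
    then show ?thesis
      using te by (intro exI[of _ g] exI[of _ "canonical_embedding u"]) (simp add: canonical_embedding_eq_0_iff)
  qed
  have par: "y \<in> complex_vector.span {x} \<or> g \<in> complex_vector.span {f}"
    if n: "x \<noteq> 0" "f \<noteq> 0" "cblinfun_apply f x = (0 :: complex)" "y \<noteq> 0" "g \<noteq> 0" "cblinfun_apply g y = (0 :: complex)"
       and F: "\<And>v h. cblinfun_apply f (\<beta> v h x) = cblinfun_apply P v * cblinfun_apply Q h"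
       and G: "\<And>v h. cblinfun_apply g (\<beta> v h y) = cblinfun_apply P' v * cblinfun_apply Q' h"
       and PQ: "P' \<in> complex_vector.span {P} \<or> Q' \<in> complex_vector.span {Q}"
     for x f y g and P :: "'b dual" and Q :: "'b dual dual" and P' Q'
  proof -
    obtain u k where u: "u \<noteq> 0" "k \<noteq> 0" "cblinfun_apply k u = (0 :: complex)" "trace_equiv I \<theta>1 \<theta>2 x f u k" using fwd[OF n(1-3)] by blast
    obtain u' k' where u': "u' \<noteq> 0" "k' \<noteq> 0" "cblinfun_apply k' u' = (0 :: complex)" "trace_equiv I \<theta>1 \<theta>2 y g u' k'" using fwd[OF n(4-6)] by blast
    have e: "k v * h u = P v * Q h" "k' v * h u' = P' v * Q' h" for v and h :: "'b dual"
      using te[OF u(4), of v h] te[OF u'(4), of v h] F[of v h] G[of v h] by simp_all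
    obtain h0 where h0: "cblinfun_apply h0 u = (1 :: complex)" using separate0[OF u(1)] by blast
    obtain h0' where h0': "cblinfun_apply h0' u' = (1 :: complex)" using separate0[OF u'(1)] by blast
    obtain v0 where v0: "k v0 = 1" using functional_nonzeroE u(2) by blast
    obtain v0' where v0': "k' v0' = 1" using functional_nonzeroE u'(2) by blast
    have k: "k v = Q h0 * P v" "k' v = Q' h0' * P' v" for v
      using e(1)[of v h0] e(2)[of v h0'] h0 h0' by (simp_all add: mult.commute)
    have q: "h u = P v0 * Q h" "h u' = P' v0' * Q' h" for h :: "'b dual"
      using e(1)[of v0 h] e(2)[of v0' h] v0 v0' by simp_all
    have Q0: "Q h0 \<noteq> 0" "P v0 \<noteq> 0" using k(1)[of v0] q(1)[of h0] v0 h0 by auto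
    have "k' \<in> complex_vector.span {k} \<or> u' \<in> complex_vector.span {u}"
      using PQ
    proof
      assume "P' \<in> complex_vector.span {P}"
      then obtain c where "P' = c *\<^sub>C P" by (auto simp: span_singleton_iff)
      then have "k' = (Q' h0' * c / Q h0) *\<^sub>C k" using Q0 by (intro cblinfun_eqI) (simp add: k)
      then show ?thesis using span_singleton_iff by blast
    next
      assume "Q' \<in> complex_vector.span {Q}"
      then obtain c where c: "Q' = c *\<^sub>C Q" by (auto simp: span_singleton_iff)
      have "u' = (P' v0' * c / P v0) *\<^sub>C u"
        by (rule dual_separates) (use Q0 in \<open>simp add: q c\<close>)
      then show ?thesis using span_singleton_iff by blast
    qed
    \<comment> \<open>With a common factor the two nilpotents add up to one nilpotent
      \<open>w \<otimes> l\<close>. Its correspondent shows that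
      \<open>x \<otimes> f + y \<otimes> g\<close> has rank at most one.\<close>
    then have "\<exists>w l. cblinfun_apply l w = (0 :: complex) \<and> (\<forall>v :: 'b. \<forall>h :: 'b dual. k v * h u + k' v * h u' = l v * h w) \<and>
        (\<forall>A :: 'b \<Rightarrow>\<^sub>B 'b. k (A u) + k' (A u') = l (A w))"
    proof
      assume "k' \<in> complex_vector.span {k}"
      then obtain c where c: "k' = c *\<^sub>C k" by (auto simp: span_singleton_iff)
      have "k u' = 0" using u'(2,3) by (auto simp: c)
      then show ?thesis using u(3)
        by (intro exI[of _ "u + c *\<^sub>C u'"] exI[of _ k]) (simp add: c algebra_simps)
    next
      assume "u' \<in> complex_vector.span {u}"
      then obtain c where c: "u' = c *\<^sub>C u" by (auto simp: span_singleton_iff)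
      have "k' u = 0" using u'(1,3) by (auto simp: c)
      then show ?thesis using u(3)
        by (intro exI[of _ u] exI[of _ "k + c *\<^sub>C k'"]) (simp add: c algebra_simps)
    qed
    then obtain w l where w: "cblinfun_apply l w = (0 :: complex)" "\<And>A :: 'b \<Rightarrow>\<^sub>B 'b. k (A u) + k' (A u') = l (A w)" by blast
    obtain z m where z: "\<And>i. i \<in> I \<Longrightarrow> f (\<theta>1 i x) + g (\<theta>1 i y) = cblinfun_apply m (\<theta>1 i z)"
    proof (cases "w = 0 \<or> l = 0")
      case True
      have "f (\<theta>1 i x) + g (\<theta>1 i y) = (0 :: 'a dual) (\<theta>1 i 0)" if "i \<in> I" for i
        using u(4) u'(4) that w(2)[of "\<theta>2 i"] True by (auto simp: trace_equiv_def)
      then show ?thesis by (rule that)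
    next
      case False
      then obtain z m where "trace_equiv I \<theta>1 \<theta>2 z m w l" using bwd w(1) by blast
      then have "f (\<theta>1 i x) + g (\<theta>1 i y) = m (\<theta>1 i z)" if "i \<in> I" for i
        using u(4) u'(4) that w(2)[of "\<theta>2 i"] by (simp add: trace_equiv_def)
      then show ?thesis by (rule that)
    qed
    have "f v * cblinfun_apply h x + g v * h y = m v * h z" for v and h :: "'a dual"
    proof (rule tensor_eqI)
      fix v :: 'a and h :: "'a dual" assume "cblinfun_apply h v = (1 :: complex)"
      then obtain i where "i \<in> I" "\<theta>1 i = rank_one v h" using cov1 unfolding covers_idempotents_def by blast
      then show "f v * h x + g v * h y = m v * h z" using z[of i] by (simp add: mult.commute)
    qed
    then show ?thesis using tensor_sum_rank_one n(1,2) by blast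
  qed
  from nilpotent_form_structure[of \<beta>, OF dim r1 par] show ?thesis
  proof
    assume "\<exists>S T. (\<forall>f g :: 'a dual. S (f + g) = (S f + S g :: 'b dual)) \<and> (\<forall>c f. S (c *\<^sub>C f) = c *\<^sub>C S f) \<and>
      (\<forall>x y :: 'a. T (x + y) = (T x + T y :: 'b dual dual)) \<and> (\<forall>c x. T (c *\<^sub>C x) = c *\<^sub>C T x) \<and>
      (\<forall>x f v h. cblinfun_apply f x = 0 \<longrightarrow>
        cblinfun_apply f (\<beta> v h x) = cblinfun_apply (S f) v * cblinfun_apply (T x) h)"
    then show ?thesis by (intro disjI1) (metis te)
  next
    assume "\<exists>S T. (\<forall>f g :: 'a dual. S (f + g) = (S f + S g :: 'b dual dual)) \<and> (\<forall>c f. S (c *\<^sub>C f) = c *\<^sub>C S f) \<and>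
      (\<forall>x y :: 'a. T (x + y) = (T x + T y :: 'b dual)) \<and> (\<forall>c x. T (c *\<^sub>C x) = c *\<^sub>C T x) \<and>
      (\<forall>x f h v. cblinfun_apply f x = 0 \<longrightarrow>
        cblinfun_apply f (\<beta> v h x) = cblinfun_apply (S f) h * cblinfun_apply (T x) v)"
    then show ?thesis by (intro disjI2) (metis te)
  qed
qed

section \<open>Boundedness\<close>

lemma norm_cblinfun_le:
  assumes "\<And>x. norm (cblinfun_apply f x) \<le> C * norm x" "C \<ge> 0"
  shows "norm f \<le> C"
  using norm_blinfun_bound[of C "blinfun_of_cblinfun f"] assms
  by (simp add: norm_cblinfun.rep_eq cblinfun_apply_def)

text \<open>The unit ball goes to a pointwise bounded set of functionals on a Banach space;
  homogeneity spreads the resulting bound.\<close>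

lemma bounded_of_pointwise_bounded:
  fixes D :: "'c::complex_normed_vector \<Rightarrow> 'd::complex_banach dual"
  assumes scale: "\<And>c w. D (c *\<^sub>C w) = c *\<^sub>C D w"
    and pt: "\<And>x. \<exists>C. \<forall>w. norm (cblinfun_apply (D w) x) \<le> C * norm w"
  shows "\<exists>M. \<forall>w. norm (D w) \<le> M * norm w"
proof -
  have "\<exists>C. \<forall>\<phi>\<in>D ` {w. norm w \<le> 1}. norm (cblinfun_apply \<phi> x) \<le> C" for x
  proof -
    obtain C where C: "\<And>w. norm (cblinfun_apply (D w) x) \<le> C * norm w" using pt by blast
    have "norm (cblinfun_apply (D w) x) \<le> \<bar>C\<bar>" if "norm w \<le> 1" for w
    proof -
      have "C * norm w \<le> \<bar>C\<bar> * 1" using that by (intro mult_mono) auto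
      then show ?thesis using C[of w] by simp
    qed
    then show ?thesis by auto
  qed
  then obtain C where C: "\<And>w x. norm w \<le> 1 \<Longrightarrow> norm (cblinfun_apply (D w) x) \<le> C * norm x"
    using uniform_boundedness[of "D ` {w. norm w \<le> 1}"] by blast
  have C': "norm (D w) \<le> \<bar>C\<bar>" if "norm w \<le> 1" for w
  proof (rule norm_cblinfun_le)
    show "norm (D w x) \<le> \<bar>C\<bar> * norm x" for x
      using C[OF that, of x] mult_right_mono[OF abs_ge_self norm_ge_zero, of C x] by linarith
  qed simp
  have "norm (D w) \<le> \<bar>C\<bar> * norm w" for w
  proof (cases "w = 0")
    case True
    then show ?thesis using scale[of 0 0] by simp
  next
    case False
    define c where "c = complex_of_real (inverse (norm w))"
    have "norm (c *\<^sub>C w) = 1" using False by (simp add: norm_scaleC c_def norm_inverse)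
    then have "norm (D (c *\<^sub>C w)) \<le> \<bar>C\<bar>" by (intro C') simp
    then have "inverse (norm w) * norm (D w) \<le> \<bar>C\<bar>" by (simp add: scale norm_scaleC c_def norm_inverse)
    then show ?thesis using False by (simp add: field_simps)
  qed
  then show ?thesis by blast
qed

text \<open>The images are regarded as functionals on the dual, which is complete, so uniform
  boundedness applies there; a norming functional brings the estimate back.\<close>

lemma bounded_of_weakly_bounded:
  fixes T :: "'c::complex_normed_vector \<Rightarrow> 'd::complex_normed_vector"
  assumes scale: "\<And>c x. T (c *\<^sub>C x) = c *\<^sub>C T x"
    and weak: "\<And>g :: 'd dual. \<exists>C. \<forall>x. norm (g (T x)) \<le> C * norm x"
  shows "\<exists>M. \<forall>x. norm (T x) \<le> norm x * M"
proof -
  obtain M where M: "\<And>x. norm (canonical_embedding (T x)) \<le> M * norm x"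
    using bounded_of_pointwise_bounded[of "\<lambda>x. canonical_embedding (T x)"] scale weak
    by (auto simp: canonical_embedding_scaleC)
  have "norm (T x) \<le> norm x * (M * 2)" for x
  proof -
    obtain \<phi> :: "'d dual" where \<phi>: "norm (T x) \<le> norm (\<phi> (T x))" "\<And>y. norm (\<phi> y) \<le> 2 * norm y"
      using norming_functional by blast
    have "norm \<phi> \<le> 2" by (rule norm_cblinfun_le) (use \<phi> in auto)
    have "norm (\<phi> (T x)) \<le> norm (canonical_embedding (T x)) * norm \<phi>"
      using norm_cblinfun_apply[of "canonical_embedding (T x)" \<phi>] by simp
    also have "\<dots> \<le> norm (canonical_embedding (T x)) * 2"
      using \<open>norm \<phi> \<le> 2\<close> by (intro mult_left_mono) auto
    also have "\<dots> \<le> (M * norm x) * 2" using M[of x] by simp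
    finally show ?thesis using \<phi>(1) by (simp add: algebra_simps)
  qed
  then show ?thesis by blast
qed

text \<open>\<open>f w x - f x w\<close> lies in the kernel of \<open>f\<close>, and
  \<open>k x f - f x k\<close> annihilates \<open>x\<close>; so the ratio of \<open>b x f\<close> to
  \<open>f x\<close> depends neither on \<open>x\<close> nor on \<open>f\<close>. A functional that
  is nonzero at both \<open>x\<close> and \<open>x0\<close> links any two points.\<close>

lemma bilinear_form_multiple:
  fixes b :: "'a::complex_normed_vector \<Rightarrow> 'a dual \<Rightarrow> complex"
  assumes add1: "\<And>x y f. b (x + y) f = b x f + b y f" and scale1: "\<And>c x f. b (c *\<^sub>C x) f = c * b x f"
    and add2: "\<And>x f g. b x (f + g) = b x f + b x g" and scale2: "\<And>c x f. b x (c *\<^sub>C f) = c * b x f"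
    and van: "\<And>x f. cblinfun_apply f x = 0 \<Longrightarrow> b x f = 0"
  obtains \<kappa> where "\<And>x f. b x f = \<kappa> * f x"
proof -
  have E1: "b x f * f w = f x * b w f" for x w f
  proof -
    have "b (f w *\<^sub>C x + (- f x) *\<^sub>C w) f = 0" by (rule van) (simp add: mult.commute)
    then show ?thesis unfolding add1 scale1 by (simp add: algebra_simps)
  qed
  have E2: "b x f * k x = f x * b x k" for x f and k :: "'a dual"
  proof -
    have "b x (k x *\<^sub>C f + (- f x) *\<^sub>C k) = 0" by (rule van) (simp add: mult.commute)
    then show ?thesis unfolding add2 scale2 by (simp add: algebra_simps)
  qed
  have b0: "b 0 f = 0" for f using scale1[of 0 0 f] by simp
  show ?thesis
  proof (cases "\<exists>x0 :: 'a. x0 \<noteq> 0")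
    case True
    then obtain x0 :: 'a where x0: "x0 \<noteq> 0" by blast
    then obtain f0 :: "'a dual" where f0: "f0 x0 = 1" using separate0 by blast
    have "b x f = b x0 f0 * f x" for x f
    proof (cases "x = 0")
      case False
      obtain h :: "'a dual" where h: "h x \<noteq> 0" "h x0 \<noteq> 0"
        using three_vectors[of x 0 x0] False x0 by (auto simp: span_singleton_iff)
      have "b x0 h = h x0 * b x0 f0" using E2[of x0 h f0] f0 by simp
      then have "b x h = h x * b x0 f0" using E1[of x h x0] h by simp
      then show ?thesis using E2[of x f h] h by simp
    qed (simp add: b0)
    then show ?thesis by (rule that)
  next
    case False
    then have "b x f = 0 * f x" for x f using b0 by (metis mult_zero_left)
    then show ?thesis by (rule that)
  qed
qed

text \<open>The product form makes \<open>u\<close> a multiple of \<open>U x\<close> and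
  \<open>g\<close> a multiple of \<open>S f\<close>. The pairing \<open>S f (U x)\<close> vanishes
  together with \<open>f x\<close>, hence equals \<open>\<kappa> * f x\<close>. This gives
  injectivity and weak boundedness, while surjectivity comes from the backward
  correspondence.\<close>

lemma correspondence_operator:
  fixes \<theta>1 :: "'i \<Rightarrow> 'a::complex_banach \<Rightarrow>\<^sub>B 'a" and \<theta>2 :: "'i \<Rightarrow> 'b::complex_banach \<Rightarrow>\<^sub>B 'b"
    and S :: "'a dual \<Rightarrow> 'b dual" and T :: "'a \<Rightarrow> 'b dual dual"
  assumes dim1: "complex_dim_ge TYPE('a) 3" and dim2: "complex_dim_ge TYPE('b) 3"
    and corr: "nilpotents_correspond I \<theta>1 \<theta>2" "nilpotents_correspond I \<theta>2 \<theta>1"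
    and Sadd: "\<And>f g. S (f + g) = S f + S g" and Sscale: "\<And>c f. S (c *\<^sub>C f) = c *\<^sub>C S f"
    and Tadd: "\<And>x y. T (x + y) = T x + T y" and Tscale: "\<And>c x. T (c *\<^sub>C x) = c *\<^sub>C T x"
    and rel: "\<And>x f u g v h. cblinfun_apply f x = 0 \<Longrightarrow> trace_equiv I \<theta>1 \<theta>2 x f u g \<Longrightarrow>
      cblinfun_apply g v * cblinfun_apply h u = cblinfun_apply (S f) v * cblinfun_apply (T x) h"
  shows "\<exists>(U :: 'a \<Rightarrow>\<^sub>B 'b) R \<kappa>. is_inverse_operator U R \<and> \<kappa> \<noteq> 0 \<and>
    (\<forall>i\<in>I. \<forall>x f. cblinfun_apply f x = (0 :: complex) \<longrightarrow> f (\<theta>1 i x) = \<kappa> * f (cblinfun_apply R (\<theta>2 i (cblinfun_apply U x))))"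
proof -
  note fwd = nilpotents_correspondD(1)[OF corr(1)] and bwd = nilpotents_correspondD(2)[OF corr(2)]
  have T0: "T 0 = 0" and S0: "S 0 = 0" using Tscale[of 0 0] Sscale[of 0 0] by simp_all
  have "\<exists>u. \<forall>h. T x h = cblinfun_apply h u" for x
  proof (cases "x = 0")
    case False
    obtain f :: "'a dual" where f: "f \<noteq> 0" "f x = 0" using annihilating_functional[OF dim1] by blast
    obtain u g where ug: "u \<noteq> 0" "g \<noteq> 0" "trace_equiv I \<theta>1 \<theta>2 x f u g" using fwd[OF False f] by blast
    obtain v where v: "g v = 1" using functional_nonzeroE ug(2) by blast
    have e: "h u = S f v * T x h" for h :: "'b dual" using rel[OF f(2) ug(3), of v h] v by simp
    obtain h :: "'b dual" where "h u = 1" using separate0 ug(1) by blast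
    then have "S f v \<noteq> 0" using e[of h] by auto
    then have "T x h = cblinfun_apply h (inverse (S f v) *\<^sub>C u)" for h using e[of h] by simp
    then show ?thesis by blast
  qed (simp add: T0 exI[of _ 0])
  then obtain U where U: "\<And>x h. T x h = cblinfun_apply h (U x)" by metis
  have Uadd: "U (x + y) = U x + U y" for x y
    by (rule dual_separates) (simp add: Tadd flip: U)
  have Uscale: "U (c *\<^sub>C x) = c *\<^sub>C U x" for c x
    by (rule dual_separates) (simp add: Tscale flip: U)
  have U0: "U 0 = 0" using Uscale[of 0 0] by simp
  have par: "\<exists>c. c \<noteq> 0 \<and> u = c *\<^sub>C U x \<and> S f = c *\<^sub>C g"
    if te: "f x = 0" "trace_equiv I \<theta>1 \<theta>2 x f u g" "u \<noteq> 0" "g \<noteq> 0"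
    for x u and f :: "'a dual" and g :: "'b dual"
  proof -
    obtain v where v: "g v = 1" using functional_nonzeroE te(4) by blast
    obtain h :: "'b dual" where h: "h u = 1" using separate0 te(3) by blast
    have "h' u = h' (S f v *\<^sub>C U x)" for h' :: "'b dual" using rel[OF te(1,2), of v h'] v by (simp add: U)
    then have u: "u = S f v *\<^sub>C U x" by (rule dual_separates)
    have c: "S f v \<noteq> 0" using u te(3) by auto
    have hU: "S f v * h (U x) = 1" using h by (subst (asm) u) simp
    have "S f w = (S f v *\<^sub>C g) w" for w
    proof -
      have "g w = S f w * h (U x)" using rel[OF te(1,2), of w h] h by (simp add: U)
      then have "S f v * g w = S f w * (S f v * h (U x))" by simp
      then show ?thesis using hU by simp
    qed
    then have "S f = S f v *\<^sub>C g" by (rule cblinfun_eqI)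
    then show ?thesis using u c by blast
  qed
  have van: "S f (U x) = 0" if fx: "f x = 0" for x and f :: "'a dual"
  proof (cases "x = 0 \<or> f = 0")
    case False
    then have nz: "x \<noteq> 0" "f \<noteq> 0" by auto
    obtain u g where ug: "u \<noteq> 0" "g \<noteq> 0" "cblinfun_apply g u = (0 :: complex)" "trace_equiv I \<theta>1 \<theta>2 x f u g"
      using fwd[OF nz fx] by blast
    then obtain c where c: "u = c *\<^sub>C U x" "S f = c *\<^sub>C g" using par[OF fx ug(4,1,2)] by blast
    then show ?thesis using ug(3) by simp
  qed (auto simp: U0 S0)
  obtain \<kappa> where \<kappa>: "\<And>x f. S f (U x) = \<kappa> * f x"
  proof -
    have "S f (U (x + y)) = S f (U x) + S f (U y)" "S f (U (c *\<^sub>C x)) = c * S f (U x)"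
      "S (f + g) (U x) = S f (U x) + S g (U x)" "S (c *\<^sub>C f) (U x) = c * S f (U x)" for x y f g c
      by (simp_all add: Uadd Uscale Sadd Sscale)
    from bilinear_form_multiple[of "\<lambda>x f. S f (U x)", OF this van] show ?thesis using that by blast
  qed
  have Usurj: "\<exists>x. U x = u" for u
  proof (cases "u = 0")
    case False
    obtain g :: "'b dual" where g: "g \<noteq> 0" "g u = 0" using annihilating_functional[OF dim2] by blast
    obtain x f where xf: "cblinfun_apply f x = (0 :: complex)" "trace_equiv I \<theta>1 \<theta>2 x f u g" using bwd[OF False g] by blast
    then obtain c where "u = c *\<^sub>C U x" using par False g(1) by blast
    then show ?thesis by (metis Uscale)
  qed (use U0 in blast)
  have Ssurj: "\<exists>f. S f = g" for g
  proof (cases "g = 0")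
    case False
    obtain u where u: "u \<noteq> 0" "g u = 0" using kernel_vector[OF dim2] by blast
    obtain x f where xf: "cblinfun_apply f x = (0 :: complex)" "trace_equiv I \<theta>1 \<theta>2 x f u g" using bwd[OF u(1) False u(2)] by blast
    then obtain c where c: "c \<noteq> 0" "S f = c *\<^sub>C g" using par u(1) False by blast
    then have "S (inverse c *\<^sub>C f) = g" by (simp add: Sscale)
    then show ?thesis by blast
  qed (use S0 in blast)
  have \<kappa>0: "\<kappa> \<noteq> 0"
  proof
    assume "\<kappa> = 0"
    obtain u :: 'b where "u \<notin> complex_vector.span {}" using not_in_span_of_dim[OF dim2, of "{}"] by auto
    then have "u \<noteq> 0" by simp
    then obtain g :: "'b dual" where "g u = 1" using separate0 by blast
    moreover obtain x f where "U x = u" "S f = g" using Usurj Ssurj by metis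
    ultimately show False using \<kappa>[of f x] \<open>\<kappa> = 0\<close> by simp
  qed
  have Uinj: "x = y" if "U x = U y" for x y
  proof (rule dual_separates)
    fix \<phi> :: "'a dual"
    show "\<phi> x = \<phi> y" using \<kappa>[of \<phi> x] \<kappa>[of \<phi> y] that \<kappa>0 by simp
  qed
  obtain R where UR: "\<And>u. U (R u) = u" using Usurj by metis
  have RU: "R (U x) = x" for x by (rule Uinj) (rule UR)
  have Radd: "R (u + v) = R u + R v" for u v by (rule Uinj) (simp add: UR Uadd)
  have Rscale: "R (c *\<^sub>C u) = c *\<^sub>C R u" for c u by (rule Uinj) (simp add: UR Uscale)
  have \<kappa>R: "\<kappa> * f (R u) = S f u" for u and f :: "'a dual" using \<kappa>[of f "R u"] by (simp add: UR)
  obtain M where M: "\<And>x. norm (U x) \<le> norm x * M"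
  proof -
    \<comment> \<open>Every \<open>g\<close> is some \<open>S f\<close>, and then
      \<open>g (U x) = \<kappa> * f x\<close>.\<close>
    have "\<exists>C. \<forall>x. norm (g (U x)) \<le> C * norm x" for g :: "'b dual"
    proof -
      obtain f where f: "S f = g" using Ssurj by blast
      have "norm (g (U x)) \<le> (norm \<kappa> * norm f) * norm x" for x
        using \<kappa>[of f x] f mult_left_mono[OF norm_cblinfun_apply[of f x], of "norm \<kappa>"]
        by (simp add: norm_mult mult.assoc)
      then show ?thesis by blast
    qed
    then show ?thesis using bounded_of_weakly_bounded[of U, OF Uscale] that by blast
  qed
  obtain M' where M': "\<And>x. norm (R x) \<le> norm x * M'"
  proof -
    have "\<exists>C. \<forall>u. norm (f (R u)) \<le> C * norm u" for f :: "'a dual"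
    proof -
      have "norm (f (R u)) \<le> (norm (S f) / norm \<kappa>) * norm u" for u
      proof -
        have "f (R u) = S f u / \<kappa>" using \<kappa>R[of f u] \<kappa>0 by (simp add: field_simps)
        then show ?thesis using norm_cblinfun_apply[of "S f" u] \<kappa>0 by (simp add: norm_divide divide_right_mono)
      qed
      then show ?thesis by blast
    qed
    then show ?thesis using bounded_of_weakly_bounded[of R, OF Rscale] that by blast
  qed
  define U' where "U' = cblinfun_of_fun U"
  define R' where "R' = cblinfun_of_fun R"
  have U': "U' x = U x" and R': "R' u = R u" for x u
    unfolding U'_def R'_def
    by (simp_all add: cblinfun_of_fun_apply[OF Uadd Uscale M] cblinfun_of_fun_apply[OF Radd Rscale M'])
  have inv: "is_inverse_operator U' R'"
    unfolding is_inverse_operator_def by (auto intro!: cblinfun_eqI simp: U' R' UR RU)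
  have main: "f (\<theta>1 i x) = \<kappa> * f (R' (\<theta>2 i (U' x)))" if i: "i \<in> I" and fx: "f x = 0" for i x and f :: "'a dual"
  proof -
    have "f (\<theta>1 i x) = S f (\<theta>2 i (U x))"
    proof (cases "x = 0 \<or> f = 0")
      case False
      then have nz: "x \<noteq> 0" "f \<noteq> 0" by auto
      obtain u g where ug: "u \<noteq> 0" "g \<noteq> 0" "trace_equiv I \<theta>1 \<theta>2 x f u g" using fwd[OF nz fx] by blast
      then obtain c where c: "u = c *\<^sub>C U x" "S f = c *\<^sub>C g" using par[OF fx ug(3,1,2)] by blast
      then show ?thesis using ug(3) i by (simp add: trace_equiv_def)
    qed (auto simp: U0 S0)
    then show ?thesis by (simp add: U' R' \<kappa>R)
  qed
  show ?thesis
    by (intro exI[of _ U'] exI[of _ R'] exI[of _ \<kappa>] conjI ballI allI impI)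
      (rule inv \<kappa>0 | (rule main; assumption))+
qed

text \<open>Here \<open>u\<close> is linear in \<open>f\<close> and \<open>g\<close> in
  \<open>x\<close>, so the pairing reads \<open>T x (V f) = \<kappa> * f x\<close>. It identifies
  the second space with the dual of the first and the first space with the dual of the second, and
  reflexivity of both follows.\<close>

lemma correspondence_adjoint:
  fixes \<theta>1 :: "'i \<Rightarrow> 'a::complex_banach \<Rightarrow>\<^sub>B 'a" and \<theta>2 :: "'i \<Rightarrow> 'b::complex_banach \<Rightarrow>\<^sub>B 'b"
    and S :: "'a dual \<Rightarrow> 'b dual dual" and T :: "'a \<Rightarrow> 'b dual"
  assumes dim1: "complex_dim_ge TYPE('a) 3" and dim2: "complex_dim_ge TYPE('b) 3"
    and corr: "nilpotents_correspond I \<theta>1 \<theta>2" "nilpotents_correspond I \<theta>2 \<theta>1"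
    and Sadd: "\<And>f g. S (f + g) = S f + S g" and Sscale: "\<And>c f. S (c *\<^sub>C f) = c *\<^sub>C S f"
    and Tadd: "\<And>x y. T (x + y) = T x + T y" and Tscale: "\<And>c x. T (c *\<^sub>C x) = c *\<^sub>C T x"
    and rel: "\<And>x f u g v h. cblinfun_apply f x = 0 \<Longrightarrow> trace_equiv I \<theta>1 \<theta>2 x f u g \<Longrightarrow>
      cblinfun_apply g v * cblinfun_apply h u = cblinfun_apply (S f) h * cblinfun_apply (T x) v"
  shows "reflexive_space TYPE('a) \<and> reflexive_space TYPE('b) \<and>
    (\<exists>(V :: 'a dual \<Rightarrow>\<^sub>B 'b) R (U :: 'a \<Rightarrow>\<^sub>B 'b dual) W \<kappa>. is_inverse_operator V R \<and> is_inverse_operator U W \<and> \<kappa> \<noteq> 0 \<and>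
    (\<forall>x f. cblinfun_apply (cblinfun_apply U x) (cblinfun_apply V f) = \<kappa> * cblinfun_apply f x) \<and>
    (\<forall>i\<in>I. \<forall>x f. cblinfun_apply f x = (0 :: complex) \<longrightarrow>
      f (\<theta>1 i x) = \<kappa> * f (cblinfun_apply W (cblinfun_apply U x o\<^sub>C \<theta>2 i))))"
proof -
  note fwd = nilpotents_correspondD(1)[OF corr(1)] and bwd = nilpotents_correspondD(2)[OF corr(2)]
  have T0: "T 0 = 0" and S0: "S 0 = 0" using Tscale[of 0 0] Sscale[of 0 0] by simp_all
  have "\<exists>u. \<forall>h. S f h = cblinfun_apply h u" for f
  proof (cases "f = 0")
    case False
    obtain x where x: "x \<noteq> 0" "f x = 0" using kernel_vector[OF dim1] by blast
    obtain u g where ug: "u \<noteq> 0" "g \<noteq> 0" "trace_equiv I \<theta>1 \<theta>2 x f u g" using fwd[OF x(1) False x(2)] by blast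
    obtain v where v: "g v = 1" using functional_nonzeroE ug(2) by blast
    have e: "h u = S f h * T x v" for h :: "'b dual" using rel[OF x(2) ug(3), of v h] v by simp
    obtain h :: "'b dual" where "h u = 1" using separate0 ug(1) by blast
    then have "T x v \<noteq> 0" using e[of h] by auto
    then have "S f h = cblinfun_apply h (inverse (T x v) *\<^sub>C u)" for h using e[of h] by simp
    then show ?thesis by blast
  qed (simp add: S0 exI[of _ 0])
  then obtain V where V: "\<And>f h. S f h = cblinfun_apply h (V f)" by metis
  have Vadd: "V (f + g) = V f + V g" for f g
    by (rule dual_separates) (simp add: Sadd flip: V)
  have Vscale: "V (c *\<^sub>C f) = c *\<^sub>C V f" for c f
    by (rule dual_separates) (simp add: Sscale flip: V)
  have V0: "V 0 = 0" using Vscale[of 0 0] by simp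
  have par: "\<exists>c. c \<noteq> 0 \<and> u = c *\<^sub>C V f \<and> T x = c *\<^sub>C g"
    if te: "f x = 0" "trace_equiv I \<theta>1 \<theta>2 x f u g" "u \<noteq> 0" "g \<noteq> 0"
    for x u and f :: "'a dual" and g :: "'b dual"
  proof -
    obtain v where v: "g v = 1" using functional_nonzeroE te(4) by blast
    obtain h :: "'b dual" where h: "h u = 1" using separate0 te(3) by blast
    have "h' u = h' (T x v *\<^sub>C V f)" for h' :: "'b dual" using rel[OF te(1,2), of v h'] v by (simp add: V mult.commute)
    then have u: "u = T x v *\<^sub>C V f" by (rule dual_separates)
    have c: "T x v \<noteq> 0" using u te(3) by auto
    have hV: "T x v * h (V f) = 1" using h by (subst (asm) u) simp
    have "T x w = (T x v *\<^sub>C g) w" for w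
    proof -
      have "g w = h (V f) * T x w" using rel[OF te(1,2), of w h] h by (simp add: V)
      then have "T x v * g w = (T x v * h (V f)) * T x w" by simp
      then show ?thesis using hV by simp
    qed
    then have "T x = T x v *\<^sub>C g" by (rule cblinfun_eqI)
    then show ?thesis using u c by blast
  qed
  have van: "T x (V f) = 0" if fx: "f x = 0" for x and f :: "'a dual"
  proof (cases "x = 0 \<or> f = 0")
    case False
    then have nz: "x \<noteq> 0" "f \<noteq> 0" by auto
    obtain u g where ug: "u \<noteq> 0" "g \<noteq> 0" "cblinfun_apply g u = (0 :: complex)" "trace_equiv I \<theta>1 \<theta>2 x f u g"
      using fwd[OF nz fx] by blast
    then obtain c where c: "u = c *\<^sub>C V f" "T x = c *\<^sub>C g" using par[OF fx ug(4,1,2)] by blast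
    then show ?thesis using ug(3) by simp
  qed (auto simp: V0 T0)
  obtain \<kappa> where \<kappa>: "\<And>x f. T x (V f) = \<kappa> * f x"
  proof -
    have "T (x + y) (V f) = T x (V f) + T y (V f)" "T (c *\<^sub>C x) (V f) = c * T x (V f)"
      "T x (V (f + g)) = T x (V f) + T x (V g)" "T x (V (c *\<^sub>C f)) = c * T x (V f)" for x y f g c
      by (simp_all add: Vadd Vscale Tadd Tscale)
    from bilinear_form_multiple[of "\<lambda>x f. T x (V f)", OF this van] show ?thesis using that by blast
  qed
  have Vsurj: "\<exists>f. V f = u" for u
  proof (cases "u = 0")
    case False
    obtain g :: "'b dual" where g: "g \<noteq> 0" "g u = 0" using annihilating_functional[OF dim2] by blast
    obtain x f where xf: "cblinfun_apply f x = (0 :: complex)" "trace_equiv I \<theta>1 \<theta>2 x f u g" using bwd[OF False g] by blast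
    then obtain c where "u = c *\<^sub>C V f" using par False g(1) by blast
    then show ?thesis by (metis Vscale)
  qed (use V0 in blast)
  have Tsurj: "\<exists>x. T x = g" for g
  proof (cases "g = 0")
    case False
    obtain u where u: "u \<noteq> 0" "g u = 0" using kernel_vector[OF dim2] by blast
    obtain x f where xf: "cblinfun_apply f x = (0 :: complex)" "trace_equiv I \<theta>1 \<theta>2 x f u g" using bwd[OF u(1) False u(2)] by blast
    then obtain c where c: "c \<noteq> 0" "T x = c *\<^sub>C g" using par u(1) False by blast
    then have "T (inverse c *\<^sub>C x) = g" by (simp add: Tscale)
    then show ?thesis by blast
  qed (use T0 in blast)
  have \<kappa>0: "\<kappa> \<noteq> 0"
  proof
    assume "\<kappa> = 0"
    obtain u :: 'b where "u \<notin> complex_vector.span {}" using not_in_span_of_dim[OF dim2, of "{}"] by auto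
    then have "u \<noteq> 0" by simp
    then obtain g :: "'b dual" where "g u = 1" using separate0 by blast
    moreover obtain x f where "V f = u" "T x = g" using Vsurj Tsurj by metis
    ultimately show False using \<kappa>[of x f] \<open>\<kappa> = 0\<close> by simp
  qed
  have Vinj: "f = g" if "V f = V g" for f g
  proof (rule cblinfun_eqI)
    fix x show "f x = g x" using \<kappa>[of x f] \<kappa>[of x g] that \<kappa>0 by simp
  qed
  have Tinj: "x = y" if "T x = T y" for x y
  proof (rule dual_separates)
    fix \<phi> :: "'a dual" show "\<phi> x = \<phi> y" using \<kappa>[of x \<phi>] \<kappa>[of y \<phi>] that \<kappa>0 by simp
  qed
  obtain R where VR: "\<And>u. V (R u) = u" using Vsurj by metis
  have RV: "R (V f) = f" for f by (rule Vinj) (rule VR)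
  have Radd: "R (u + v) = R u + R v" for u v by (rule Vinj) (simp add: VR Vadd)
  have Rscale: "R (c *\<^sub>C u) = c *\<^sub>C R u" for c u by (rule Vinj) (simp add: VR Vscale)
  obtain W where TW: "\<And>g. T (W g) = g" using Tsurj by metis
  have WT: "W (T x) = x" for x by (rule Tinj) (rule TW)
  have Wadd: "W (u + v) = W u + W v" for u v by (rule Tinj) (simp add: TW Tadd)
  have Wscale: "W (c *\<^sub>C u) = c *\<^sub>C W u" for c u by (rule Tinj) (simp add: TW Tscale)
  have \<kappa>R: "T x u = \<kappa> * R u x" for x u using \<kappa>[of x "R u"] by (simp add: VR)
  have \<kappa>W: "\<kappa> * f (W g) = g (V f)" for f :: "'a dual" and g :: "'b dual" using \<kappa>[of "W g" f] by (simp add: TW)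
  obtain M where M: "\<And>f. norm (V f) \<le> norm f * M"
  proof -
    have "\<exists>C. \<forall>f. norm (g (V f)) \<le> C * norm f" for g :: "'b dual"
    proof -
      obtain x where x: "T x = g" using Tsurj by blast
      have "norm (g (V f)) \<le> (norm \<kappa> * norm x) * norm f" for f
        using \<kappa>[of x f] x mult_left_mono[OF norm_cblinfun_apply[of f x], of "norm \<kappa>"]
        by (simp add: norm_mult mult.assoc mult.commute[of "norm x"])
      then show ?thesis by blast
    qed
    then show ?thesis using bounded_of_weakly_bounded[of V, OF Vscale] that by blast
  qed
  obtain M' where M': "\<And>u. norm (R u) \<le> M' * norm u"
  proof -
    have "\<exists>C. \<forall>u. norm (R u x) \<le> C * norm u" for x
    proof -
      have "norm (R u x) \<le> (norm (T x) / norm \<kappa>) * norm u" for u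
      proof -
        have "R u x = T x u / \<kappa>" using \<kappa>R[of x u] \<kappa>0 by (simp add: field_simps)
        then show ?thesis using norm_cblinfun_apply[of "T x" u] \<kappa>0 by (simp add: norm_divide divide_right_mono)
      qed
      then show ?thesis by blast
    qed
    then show ?thesis using bounded_of_pointwise_bounded[of R, OF Rscale] that by blast
  qed
  obtain N where N: "\<And>x. norm (T x) \<le> N * norm x"
  proof -
    have "\<exists>C. \<forall>x. norm (T x u) \<le> C * norm x" for u
    proof -
      have "norm (T x u) \<le> (norm \<kappa> * norm (R u)) * norm x" for x
        using \<kappa>R[of x u] mult_left_mono[OF norm_cblinfun_apply[of "R u" x], of "norm \<kappa>"]
        by (simp add: norm_mult mult.assoc)
      then show ?thesis by blast
    qed
    then show ?thesis using bounded_of_pointwise_bounded[of T, OF Tscale] that by blast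
  qed
  obtain N' where N': "\<And>g. norm (W g) \<le> norm g * N'"
  proof -
    have "\<exists>C. \<forall>g. norm (f (W g)) \<le> C * norm g" for f :: "'a dual"
    proof -
      have "norm (f (W g)) \<le> (norm (V f) / norm \<kappa>) * norm g" for g
      proof -
        have "f (W g) = g (V f) / \<kappa>" using \<kappa>W[of f g] \<kappa>0 by (simp add: field_simps)
        then show ?thesis using norm_cblinfun_apply[of g "V f"] \<kappa>0
          by (simp add: norm_divide divide_right_mono mult.commute)
      qed
      then show ?thesis by blast
    qed
    then show ?thesis using bounded_of_weakly_bounded[of W, OF Wscale] that by blast
  qed
  define V' where "V' = cblinfun_of_fun V"
  define R' where "R' = cblinfun_of_fun R"
  define U' where "U' = cblinfun_of_fun T"
  define W' where "W' = cblinfun_of_fun W"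
  have M'': "norm (R u) \<le> norm u * M'" and N'': "norm (T x) \<le> norm x * N" for u x
    using M'[of u] N[of x] by (simp_all add: mult.commute)
  have V': "V' f = V f" and R': "R' u = R u" and U': "U' x = T x" and W': "W' g = W g" for f u x g
    unfolding V'_def R'_def U'_def W'_def
    by (simp_all add: cblinfun_of_fun_apply[OF Vadd Vscale M] cblinfun_of_fun_apply[OF Radd Rscale M'']
        cblinfun_of_fun_apply[OF Tadd Tscale N''] cblinfun_of_fun_apply[OF Wadd Wscale N'])
  have inv: "is_inverse_operator V' R'" "is_inverse_operator U' W'"
    unfolding is_inverse_operator_def by (auto intro!: cblinfun_eqI simp: V' R' VR RV U' W' TW WT)
  have main: "f (\<theta>1 i x) = \<kappa> * f (W' (U' x o\<^sub>C \<theta>2 i))" if i: "i \<in> I" and fx: "f x = 0" for i x and f :: "'a dual"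
  proof -
    have "f (\<theta>1 i x) = T x (\<theta>2 i (V f))"
    proof (cases "x = 0 \<or> f = 0")
      case False
      then have nz: "x \<noteq> 0" "f \<noteq> 0" by auto
      obtain u g where ug: "u \<noteq> 0" "g \<noteq> 0" "trace_equiv I \<theta>1 \<theta>2 x f u g" using fwd[OF nz fx] by blast
      then obtain c where c: "u = c *\<^sub>C V f" "T x = c *\<^sub>C g" using par[OF fx ug(3,1,2)] by blast
      then show ?thesis using ug(3) i by (simp add: trace_equiv_def)
    qed (auto simp: V0 T0)
    then show ?thesis by (simp add: V' U' W' \<kappa>W)
  qed
  have UV: "U' x (V' f) = \<kappa> * f x" for x and f :: "'a dual" by (simp add: U' V' \<kappa>)
  \<comment> \<open>\<open>R'\<close> turns \<open>\<phi>\<close> into a functional on the second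
    space, and every such functional is some \<open>T x\<close>.\<close>
  have refl1: "reflexive_space TYPE('a)"
  proof -
    have "\<exists>x. canonical_embedding x = \<phi>" for \<phi> :: "'a dual dual"
    proof -
      obtain x where x: "T x = \<phi> o\<^sub>C R'" using Tsurj by blast
      have "\<phi> f = f (\<kappa> *\<^sub>C x)" for f
        using cblinfun_cong[OF x, of "V f"] by (simp add: R' RV \<kappa>)
      then show ?thesis by (intro exI[of _ "\<kappa> *\<^sub>C x"] cblinfun_eqI) simp
    qed
    then show ?thesis unfolding reflexive_space_def surj_def by metis
  qed
  \<comment> \<open>\<open>U'\<close> pulls \<open>\<psi>\<close> back to a functional on the first
    space, which \<open>V\<close> turns into a vector of the second.\<close>
  have refl2: "reflexive_space TYPE('b)"
  proof -
    have "\<exists>u. canonical_embedding u = \<psi>" for \<psi> :: "'b dual dual"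
    proof -
      define f where "f = \<psi> o\<^sub>C U'"
      have "\<psi> g = g (inverse \<kappa> *\<^sub>C V f)" for g
      proof -
        have "\<psi> g = f (W g)" by (simp add: f_def U' TW)
        then show ?thesis using \<kappa>W[of f g] \<kappa>0 by (simp add: field_simps)
      qed
      then show ?thesis by (intro exI[of _ "inverse \<kappa> *\<^sub>C V f"] cblinfun_eqI) simp
    qed
    then show ?thesis unfolding reflexive_space_def surj_def by metis
  qed
  show ?thesis
    by (intro conjI exI[of _ V'] exI[of _ R'] exI[of _ U'] exI[of _ W'] exI[of _ \<kappa>] ballI allI impI)
      (rule refl1 refl2 inv \<kappa>0 UV | (rule main; assumption))+
qed

section \<open>Two-variable Jordan products\<close>

text \<open>Powers are words in one letter, so the words of the generalized Jordan product can be
  cut into powers directly.\<close>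

definition opow :: "('a::complex_normed_vector \<Rightarrow>\<^sub>B 'a) \<Rightarrow> nat \<Rightarrow> 'a \<Rightarrow>\<^sub>B 'a"
  where "opow B n = operator_product (replicate n B)"

lemma opow_0 [simp]: "opow B 0 = cblinfun_id"
  by (simp add: opow_def operator_product_def)

lemma opow_Suc: "opow B (Suc n) = B o\<^sub>C opow B n"
  by (simp add: opow_def operator_product_def)

lemma opow_add_apply: "opow B (m + n) x = opow B m (opow B n x)"
  by (induction m) (simp_all add: opow_Suc)

lemma opow_commute_apply: "opow B m (opow B n x) = opow B n (opow B m x)"
  by (metis add.commute opow_add_apply)

lemma opow_funpow: "cblinfun_apply (opow B n) x = (cblinfun_apply B ^^ n) x"
  by (induction n) (simp_all add: opow_Suc)

definition jordan ::
  "nat \<Rightarrow> nat \<Rightarrow> ('a::complex_normed_vector \<Rightarrow>\<^sub>B 'a) \<Rightarrow> ('a \<Rightarrow>\<^sub>B 'a) \<Rightarrow> 'a \<Rightarrow>\<^sub>B 'a"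
  where "jordan r s A B = opow B r o\<^sub>C A o\<^sub>C opow B s + opow B s o\<^sub>C A o\<^sub>C opow B r"

lemma jordan_commute: "jordan r s = jordan s r"
  by (intro ext) (simp add: jordan_def add.commute)

text \<open>With a root \<open>\<zeta>\<close> of \<open>\<zeta>^r = - 1\<close> this realises a
  rank-two operator with eigenvalues 1 and -1 as an \<open>r\<close>-th power.\<close>

lemma opow_biorthogonal:
  assumes "h1 e1 = 1" "h1 e2 = 0" "h2 e1 = 0" "h2 e2 = 1" "h1 = cblinfun_apply H1" "h2 = cblinfun_apply H2"
  shows "opow (rank_one e1 H1 + rank_one e2 (\<zeta> *\<^sub>C H2)) (Suc n) = rank_one e1 H1 + rank_one e2 (\<zeta> ^ Suc n *\<^sub>C H2)"
proof (induction n)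
  case (Suc n)
  show ?case
    by (subst opow_Suc, subst Suc.IH, rule cblinfun_eqI) (use assms in \<open>simp add: mult.assoc\<close>)
qed (simp add: opow_Suc)

lemma opow_idempotent:
  assumes "\<And>x. cblinfun_apply B (cblinfun_apply B x) = cblinfun_apply B x"
  shows "opow B (Suc n) = B"
  by (induction n) (auto simp: opow_Suc intro!: cblinfun_eqI simp: assms)

lemma rank_one_add_0 [simp]: "A + rank_one x 0 = A" "A + rank_one 0 g = A"
  by (rule cblinfun_eqI, simp)+

text \<open>The contradictions below come from two distinct peripheral values, so having at most one
  element is the useful part of being a singleton.\<close>

definition subsingleton :: "'a set \<Rightarrow> bool"
  where "subsingleton S \<longleftrightarrow> (\<forall>x\<in>S. \<forall>y\<in>S. x = y)"

lemma subsingletonD: "subsingleton S \<Longrightarrow> x \<in> S \<Longrightarrow> y \<in> S \<Longrightarrow> x = y"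
  by (auto simp: subsingleton_def)

lemma exists_root: "n > 0 \<Longrightarrow> \<exists>z :: complex. z ^ n = c"
proof -
  assume n: "n > 0"
  show ?thesis
  proof (cases "c = 0")
    case True
    then show ?thesis using n by (intro exI[of _ 0]) simp
  next
    case False
    then have "exp (Ln c / of_nat n) ^ n = c" using n by (simp add: exp_of_nat_mult[symmetric])
    then show ?thesis by blast
  qed
qed

text \<open>In \<open>B^r x \<otimes> f + x \<otimes> f B^r\<close> the condition
  \<open>f x = 0\<close> kills one off-diagonal entry of the 2 by 2 matrix, so both eigenvalues are
  the common diagonal entry.\<close>

lemma peripheral_jordan_nilpotent:
  assumes dim: "complex_dim_ge TYPE('a::complex_normed_vector) 3"
    and "cblinfun_apply f (x :: 'a::complex_normed_vector) = (0 :: complex)"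
  shows "peripheral_spectrum (jordan r 0 (rank_one x f) B) = {f (opow B r x)}"
proof -
  have "jordan r 0 (rank_one x f) B = rank_one (opow B r x) f + rank_one x (f o\<^sub>C opow B r)"
    by (rule cblinfun_eqI) (simp add: jordan_def)
  from peripheral_rank_two[OF dim this, of "f (opow B r x)" "f (opow B r x)"] show ?thesis
    using assms(2) by simp
qed

section \<open>Recognition of rank-one nilpotents for \<open>s = 0\<close>\<close>

lemma jordan_singleton_imp_quadratic:
  assumes dim: "complex_dim_ge TYPE('a::complex_normed_vector) 3" and r: "r > 0"
    and single: "\<And>u1 g1 u2 g2. subsingleton (peripheral_spectrum (jordan r 0 A (rank_one u1 g1 + rank_one u2 g2)))"
  shows "cblinfun_apply A (cblinfun_apply A x) \<in> complex_vector.span {cblinfun_apply A (x :: 'a::complex_normed_vector)}"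
proof (rule ccontr)
  assume n: "A (A x) \<notin> complex_vector.span {A x}"
  have "x \<notin> complex_vector.span {A x}"
  proof
    assume "x \<in> complex_vector.span {A x}"
    then obtain c where c: "x = c *\<^sub>C A x" by (auto simp: span_singleton_iff)
    then have c': "A x = c *\<^sub>C A (A x)" by (metis cblinfun_apply_scaleC)
    have "c \<noteq> 0" using c n by (auto simp: complex_vector.span_zero)
    then have "A (A x) = inverse c *\<^sub>C A x" by (subst c') simp
    then show False using n span_singleton_iff by blast
  qed
  then obtain g :: "'a dual" where g: "g (A x) = 0" "g x \<noteq> 0" "g (A (A x)) \<noteq> 0"
    using three_vectors n by blast
  \<comment> \<open>For the idempotent \<open>x \<otimes> k\<close> the 2 by 2 matrix has trace
    \<open>2 k (A x) = 0\<close> and determinant \<open>- k (A (A x))\<close>, so the eigenvalues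
    are opposite and nonzero.\<close>
  define k where "k = inverse (g x) *\<^sub>C g"
  have k: "k (A x) = 0" "k x = 1" "k (A (A x)) \<noteq> 0" using g by (simp_all add: k_def)
  define e where "e = csqrt (k (A (A x)))"
  have e: "e * e = k (A (A x))" "e \<noteq> 0" using k(3) by (auto simp: e_def simp flip: power2_eq_square)
  obtain n where rn: "r = Suc n" using r gr0_implies_Suc by blast
  have p: "opow (rank_one x k + rank_one 0 0) r = rank_one x k"
    using opow_idempotent[of "rank_one x k" n] by (simp add: rn k)
  have "jordan r 0 A (rank_one x k + rank_one 0 0) = rank_one x (k o\<^sub>C A) + rank_one (A x) k"
    unfolding jordan_def p by (rule cblinfun_eqI) simp
  from peripheral_rank_two[OF dim this, of e "- e"]
  have "peripheral_spectrum (jordan r 0 A (rank_one x k + rank_one 0 0)) = {e, - e}"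
    using k e by simp
  then show False using subsingletonD[OF single[of x k 0 0], of e "- e"] e by auto
qed

text \<open>For \<open>c \<noteq> 0\<close> the operator \<open>A / c\<close> is idempotent. A test
  operator whose \<open>r\<close>-th power has eigenvalues 1 and -1 then produces opposite
  peripheral values; its plane lies inside the range of \<open>A\<close> if the rank is at least
  two, and across the range if it is one.\<close>

lemma jordan_singleton_imp_not_idempotent_multiple:
  assumes dim: "complex_dim_ge TYPE('a::complex_normed_vector) 3" and r: "r > 0"
    and single: "\<And>u1 g1 u2 g2. subsingleton (peripheral_spectrum (jordan r 0 A (rank_one u1 g1 + rank_one u2 g2)))"
    and c: "\<And>x. cblinfun_apply A (cblinfun_apply A x) = c *\<^sub>C cblinfun_apply A (x :: 'a::complex_normed_vector)"
    and A: "A \<noteq> 0"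
  shows "c = 0"
proof (rule ccontr)
  assume c0: "c \<noteq> 0"
  obtain \<zeta> :: complex where \<zeta>: "\<zeta> ^ r = - 1" using exists_root[OF r] by blast
  obtain n where rn: "r = Suc n" using r gr0_implies_Suc by blast
  obtain u where u: "A u \<noteq> 0" using A by (metis cblinfun_apply_zero cblinfun_eqI)
  define x1 where "x1 = A u"
  have x1: "x1 \<noteq> 0" "A x1 = c *\<^sub>C x1" using u c by (auto simp: x1_def)
  have contra: False if "peripheral_spectrum (jordan r 0 A (rank_one u1 g1 + rank_one u2 g2)) = {a, - a}" "a \<noteq> 0"
    for u1 g1 u2 g2 a
    using subsingletonD[OF single[of u1 g1 u2 g2], of a "- a"] that by auto
  show False
  proof (cases "\<exists>v. A v \<notin> complex_vector.span {x1}")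
    case True
    then obtain v where v: "A v \<notin> complex_vector.span {x1}" by blast
    define x2 where "x2 = A v"
    have x2: "x2 \<notin> complex_vector.span {x1}" "A x2 = c *\<^sub>C x2" using v c by (auto simp: x2_def)
    obtain \<phi> \<psi> :: "'a dual" where p: "\<phi> x1 = 1" "\<phi> x2 = 0" "\<psi> x1 = 0" "\<psi> x2 = 1"
      using biorthogonal_pair[OF x1(1) x2(1)] by blast
    \<comment> \<open>Composition with \<open>A / c\<close> makes \<open>g1\<close> and
      \<open>g2\<close> left eigenvectors of \<open>A\<close>.\<close>
    define g1 where "g1 = inverse c *\<^sub>C (\<phi> o\<^sub>C A)"
    define g2 where "g2 = inverse c *\<^sub>C (\<psi> o\<^sub>C A)"
    have g: "g1 x1 = 1" "g1 x2 = 0" "g2 x1 = 0" "g2 x2 = 1" "g1 (A z) = c * g1 z" "g2 (A z) = c * g2 z" for z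
      using c0 by (simp_all add: g1_def g2_def x1 x2 p c)
    have op: "opow (rank_one x1 g1 + rank_one x2 (\<zeta> *\<^sub>C g2)) r = rank_one x1 g1 + rank_one x2 ((- 1) *\<^sub>C g2)"
      unfolding rn by (subst opow_biorthogonal[OF g(1-4) refl refl]) (use \<zeta> rn in simp)
    have J: "jordan r 0 A (rank_one x1 g1 + rank_one x2 (\<zeta> *\<^sub>C g2))
        = rank_one x1 ((2 * c) *\<^sub>C g1) + rank_one x2 ((- 2 * c) *\<^sub>C g2)"
      unfolding jordan_def op by (rule cblinfun_eqI) (simp add: g x1 x2 algebra_simps flip: scaleC_add_left)
    have "peripheral_spectrum (jordan r 0 A (rank_one x1 g1 + rank_one x2 (\<zeta> *\<^sub>C g2))) = {2 * c, - (2 * c)}"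
      using peripheral_rank_two[OF dim J, of "2 * c" "- (2 * c)"] by (simp add: g)
    from contra[OF this] show False using c0 by simp
  next
    case False
    obtain \<phi> :: "'a dual" where \<phi>: "\<phi> x1 = 1" using separate0[OF x1(1)] by blast
    define g1 where "g1 = inverse c *\<^sub>C (\<phi> o\<^sub>C A)"
    have Av: "A v = (c * g1 v) *\<^sub>C x1" for v
    proof -
      obtain d where d: "A v = d *\<^sub>C x1" using False by (auto simp: span_singleton_iff)
      then show ?thesis using c0 \<phi> by (simp add: g1_def)
    qed
    have g1x1: "g1 x1 = 1" using c0 \<phi> by (simp add: g1_def x1)
    obtain x2 and g2 :: "'a dual" where g: "g1 x2 = 0" "g2 x1 = 0" "g2 x2 = 1"
      using biorthogonal_triple[OF dim g1x1] by metis
    \<comment> \<open>Eigenvectors of the exchange of \<open>x1\<close> and \<open>x2\<close>, which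
      is thereby an \<open>r\<close>-th power. The Jordan product of
      \<open>A = c x1 \<otimes> g1\<close> with it is \<open>c\<close> times the same
      exchange.\<close>
    define e1 where "e1 = x1 + x2"
    define e2 where "e2 = x1 - x2"
    define h1 where "h1 = (1/2) *\<^sub>C (g1 + g2)"
    define h2 where "h2 = (1/2) *\<^sub>C (g1 - g2)"
    have h: "h1 e1 = 1" "h1 e2 = 0" "h2 e1 = 0" "h2 e2 = 1"
      by (simp_all add: h1_def h2_def e1_def e2_def g g1x1)
    have op: "opow (rank_one e1 h1 + rank_one e2 (\<zeta> *\<^sub>C h2)) r = rank_one x1 g2 + rank_one x2 g1"
    proof -
      have "rank_one e1 h1 v + rank_one e2 ((- 1) *\<^sub>C h2) v = rank_one x1 g2 v + rank_one x2 g1 v" for v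
      proof -
        have "g2 v = h1 v - h2 v" "g1 v = h1 v + h2 v"
          by (simp_all add: h1_def h2_def field_simps)
        then show ?thesis
          by (simp add: e1_def e2_def scaleC_add_right scaleC_add_left
              complex_vector.scale_right_diff_distrib complex_vector.scale_left_diff_distrib)
      qed
      then show ?thesis
        unfolding rn using \<zeta> rn by (subst opow_biorthogonal[OF h refl refl]) (auto intro!: cblinfun_eqI)
    qed
    have J: "jordan r 0 A (rank_one e1 h1 + rank_one e2 (\<zeta> *\<^sub>C h2)) = rank_one x2 (c *\<^sub>C g1) + rank_one x1 (c *\<^sub>C g2)"
      unfolding jordan_def op by (rule cblinfun_eqI) (simp add: Av g g1x1 mult.commute)
    have "peripheral_spectrum (jordan r 0 A (rank_one e1 h1 + rank_one e2 (\<zeta> *\<^sub>C h2))) = {c, - c}"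
      using peripheral_rank_two[OF dim J, of c "- c"] by (simp add: g g1x1)
    from contra[OF this] show False using c0 by simp
  qed
qed

text \<open>First \<open>A^2 = c A\<close>, then \<open>c = 0\<close>. When \<open>A^2 = 0\<close>,
  the product with an idempotent \<open>e \<otimes> h\<close> has the double eigenvalue
  \<open>h (A e)\<close>; for rank at least two, idempotents in two complementary blocks can be
  given the values 1 and -1.\<close>

lemma jordan_singleton_imp_nilpotent_rank_one:
  assumes dim: "complex_dim_ge TYPE('a::complex_normed_vector) 3" and r: "r > 0"
    and single: "\<And>u1 g1 u2 g2. subsingleton (peripheral_spectrum (jordan r 0 A (rank_one u1 g1 + rank_one u2 g2)))"
  shows "\<exists>x f. cblinfun_apply f (x :: 'a::complex_normed_vector) = (0 :: complex) \<and> A = rank_one x f"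
proof (cases "A = 0")
  case True
  then show ?thesis by (intro exI[of _ 0]) (auto intro!: cblinfun_eqI)
next
  case A0: False
  have V: "complex_vector.subspace (range (cblinfun_apply A))"
  proof (auto simp: complex_vector.subspace_def)
    show "0 \<in> range A" by (rule range_eqI[of _ _ 0]) simp
    show "A x + A y \<in> range A" for x y by (rule range_eqI[of _ _ "x + y"]) simp
    show "c *\<^sub>C A x \<in> range A" for c x by (rule range_eqI[of _ _ "c *\<^sub>C x"]) simp
  qed
  have loc: "\<exists>c. A y = c *\<^sub>C y" if "y \<in> range A" for y
    using that jordan_singleton_imp_quadratic[OF dim r single] by (auto simp: span_singleton_iff)
  obtain c where "\<And>y. y \<in> range A \<Longrightarrow> A y = c *\<^sub>C y"
    using scalar_of_locally_scalar[OF V loc] by blast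
  then have "A (A x) = c *\<^sub>C A x" for x by blast
  moreover from jordan_singleton_imp_not_idempotent_multiple[OF dim r single this A0] have "c = 0" .
  ultimately have AA: "A (A x) = 0" for x by simp
  obtain x1 where x1: "A x1 \<noteq> 0" using A0 by (metis cblinfun_apply_zero cblinfun_eqI)
  define y1 where "y1 = A x1"
  have y1: "y1 \<noteq> 0" "A y1 = 0" using x1 AA by (auto simp: y1_def)
  show ?thesis
  proof (cases "\<exists>x2. A x2 \<notin> complex_vector.span {y1}")
    case False
    obtain \<phi> :: "'a dual" where \<phi>: "\<phi> y1 = 1" using separate0[OF y1(1)] by blast
    have "A v = \<phi> (A v) *\<^sub>C y1" for v
    proof -
      obtain d where d: "A v = d *\<^sub>C y1" using False by (auto simp: span_singleton_iff)
      then show ?thesis using \<phi> by simp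
    qed
    then have "A = rank_one y1 (\<phi> o\<^sub>C A)" by (intro cblinfun_eqI) simp
    moreover have "(\<phi> o\<^sub>C A) y1 = 0" using y1 by simp
    ultimately show ?thesis by blast
  next
    case True
    then obtain x2 where x2: "A x2 \<notin> complex_vector.span {y1}" by blast
    define y2 where "y2 = A x2"
    have y2: "y2 \<notin> complex_vector.span {y1}" "A y2 = 0" using x2 AA by (auto simp: y2_def)
    obtain \<phi>1 \<phi>2 :: "'a dual" where p: "\<phi>1 y1 = 1" "\<phi>1 y2 = 0" "\<phi>2 y1 = 0" "\<phi>2 y2 = 1"
      using biorthogonal_pair[OF y1(1) y2(1)] by blast
    define \<xi>1 where "\<xi>1 = \<phi>1 o\<^sub>C A"
    define \<xi>2 where "\<xi>2 = \<phi>2 o\<^sub>C A"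
    have \<xi>: "\<xi>1 x1 = 1" "\<xi>1 x2 = 0" "\<xi>2 x1 = 0" "\<xi>2 x2 = 1" "\<xi>1 y1 = 0" "\<xi>1 y2 = 0" "\<xi>2 y1 = 0" "\<xi>2 y2 = 0"
      "\<xi>1 (A z) = 0" "\<xi>2 (A z) = 0" for z
      using p y1 y2 AA by (simp_all add: \<xi>1_def \<xi>2_def flip: y1_def y2_def)
    \<comment> \<open>Together with \<open>\<xi>1\<close> and \<open>\<xi>2\<close> these form the
      system dual to \<open>x1\<close>, \<open>x2\<close>, \<open>y1\<close>,
      \<open>y2\<close>.\<close>
    define \<eta>1 where "\<eta>1 = \<phi>1 - \<phi>1 x1 *\<^sub>C \<xi>1 - \<phi>1 x2 *\<^sub>C \<xi>2"
    define \<eta>2 where "\<eta>2 = \<phi>2 - \<phi>2 x1 *\<^sub>C \<xi>1 - \<phi>2 x2 *\<^sub>C \<xi>2"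
    have \<eta>: "\<eta>1 x1 = 0" "\<eta>1 x2 = 0" "\<eta>2 x1 = 0" "\<eta>2 x2 = 0" "\<eta>1 y1 = 1" "\<eta>1 y2 = 0" "\<eta>2 y1 = 0" "\<eta>2 y2 = 1"
      by (simp_all add: \<eta>1_def \<eta>2_def \<xi> p)
    have \<eta>A: "\<eta>1 (A z) = \<xi>1 z" "\<eta>2 (A z) = \<xi>2 z" for z
      by (simp_all add: \<eta>1_def \<eta>2_def \<xi>, simp_all add: \<xi>1_def \<xi>2_def)
    \<comment> \<open>The halves make \<open>h1 e1 = h2 e2 = 1\<close>, while
      \<open>h1 (A e1) = 1\<close> and \<open>h2 (A e2) = - 1\<close>.\<close>
    define e1 where "e1 = x1 + (1/2) *\<^sub>C y1"
    define e2 where "e2 = (1/2) *\<^sub>C y2 - x2"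
    define h1 where "h1 = (1/2) *\<^sub>C \<xi>1 + \<eta>1"
    define h2 where "h2 = \<eta>2 - (1/2) *\<^sub>C \<xi>2"
    have h: "h1 e1 = 1" "h1 e2 = 0" "h2 e1 = 0" "h2 e2 = 1" "h1 y1 = 1" "h1 y2 = 0" "h2 y1 = 0" "h2 y2 = 1"
      "\<xi>1 e1 = 1" "\<xi>1 e2 = 0" "\<xi>2 e1 = 0" "\<xi>2 e2 = - 1"
      by (simp_all add: h1_def h2_def e1_def e2_def \<xi> \<eta>)
    have hA: "h1 (A z) = \<xi>1 z" "h2 (A z) = \<xi>2 z" for z
      by (simp_all add: h1_def h2_def \<xi> \<eta>A)
    have Ae: "A e1 = y1" "A e2 = - y2"
      by (simp_all add: e1_def e2_def y1 y2 flip: y1_def y2_def)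
    define B where "B = rank_one e1 h1 + rank_one e2 h2"
    obtain n where rn: "r = Suc n" using r gr0_implies_Suc by blast
    have op: "opow B r = B"
      unfolding rn by (rule opow_idempotent) (simp add: B_def h)
    define F1 where "F1 = rank_one y1 h1 + rank_one e1 \<xi>1"
    define F2 where "F2 = rank_one (- y2) h2 + rank_one e2 \<xi>2"
    have J: "jordan r 0 A B = F1 + F2"
      unfolding jordan_def op by (rule cblinfun_eqI) (simp add: B_def F1_def F2_def hA Ae)
    have F12: "F1 o\<^sub>C F2 = 0" "F2 o\<^sub>C F1 = 0"
      by (rule cblinfun_eqI, simp add: F1_def F2_def h \<xi>)+
    have sp: "z = 0 \<or> z = 1 \<or> z = - 1" if "z \<in> operator_spectrum (jordan r 0 A B)" for z
    proof (cases "z = 0")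
      case False
      have "z \<in> operator_spectrum F1 \<or> z \<in> operator_spectrum F2"
        using spectrum_block[OF F12 False] that by (simp add: J)
      then show ?thesis
        using spectrum_rank_two[OF F1_def False] spectrum_rank_two[OF F2_def False]
        by (auto simp: h \<xi> eq_neg_iff_add_eq_0)
    qed simp
    have 1: "1 \<in> operator_spectrum (jordan r 0 A B)"
      by (rule eigenvalue_in_spectrum[of _ y1]) (simp_all add: J F1_def F2_def h \<xi> y1)
    have m1: "- 1 \<in> operator_spectrum (jordan r 0 A B)"
      by (rule eigenvalue_in_spectrum[of _ y2])
        (use not_in_span_swap(2)[OF y1(1) y2(1)] in \<open>simp_all add: J F1_def F2_def h \<xi>\<close>)
    have "peripheral_spectrum (jordan r 0 A B) = {z \<in> operator_spectrum (jordan r 0 A B). cmod z = cmod 1}"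
      by (rule peripheral_spectrumI[OF 1]) (use sp in fastforce)
    then have "1 \<in> peripheral_spectrum (jordan r 0 A B)" "- 1 \<in> peripheral_spectrum (jordan r 0 A B)"
      using 1 m1 by auto
    then show ?thesis using subsingletonD[OF single[of e1 h1 e2 h2], of 1 "- 1"] by (simp add: B_def)
  qed
qed

text \<open>Writing \<open>D = Q^(r-s)\<close> and \<open>K = Q^(2s)\<close>, testing with \<open>A\<close> of rank one gives \<open>D K = c K\<close> with
  \<open>c \<noteq> 0\<close>; the nonzero spectrum of the Jordan product is then that of \<open>2 c A K\<close>, and \<open>K\<close> has rank one.\<close>

lemma jordan_singleton_imp_trace_functional:
  assumes dim: "complex_dim_ge TYPE('a::complex_normed_vector) 3" and s: "s > 0" and rs: "s \<le> r"
    and single: "\<And>u1 g1 u2 g2. subsingleton (peripheral_spectrum (jordan r s (rank_one u1 g1 + rank_one u2 g2) Q))"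
    and nonnil: "\<And>n. opow Q n \<noteq> 0"
  shows "\<exists>y h. cblinfun_apply h (y :: 'a::complex_normed_vector) \<noteq> (0 :: complex) \<and>
    (\<forall>A t. peripheral_spectrum (jordan r s A Q) = {t} \<longrightarrow> t = 2 * h (cblinfun_apply A y))"
proof -
  define K where "K = opow Q (2 * s)"
  define D where "D = opow Q (r - s)"
  have rs': "r = s + (r - s)" "r = (r - s) + s" using rs by auto
  have qr: "opow Q r x = opow Q s (D x)" "opow Q r x = D (opow Q s x)" for x
    unfolding D_def using opow_add_apply[of Q s "r - s" x] opow_add_apply[of Q "r - s" s x] rs by simp_all
  have ss: "opow Q s (opow Q s x) = K x" for x
    unfolding K_def by (simp add: mult_2 opow_add_apply)
  have DK: "D (K x) = K (D x)" for x
    unfolding D_def K_def by (rule opow_commute_apply)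
  have Ds: "D (opow Q s x) = opow Q s (D x)" for x
    unfolding D_def by (rule opow_commute_apply)
  \<comment> \<open>All entries of the 2 by 2 matrix are expressed through \<open>D\<close> and
    \<open>K\<close>. The empty summand brings \<open>x \<otimes> f\<close> into the shape required
    by \<open>single\<close>.\<close>
  have eig: "peripheral_spectrum (jordan r s (rank_one x f + rank_one 0 0) Q) = peripheral_pair (f (D (K x)) + e) (f (D (K x)) - e)"
    if "e * e = f (K x) * f (D (D (K x)))" for x e and f :: "'a dual"
  proof (rule peripheral_rank_two[OF dim])
    show "jordan r s (rank_one x f + rank_one 0 0) Q
      = rank_one (opow Q r x) (f o\<^sub>C opow Q s) + rank_one (opow Q s x) (f o\<^sub>C opow Q r)"
      by (rule cblinfun_eqI) (simp add: jordan_def)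
    have 1: "opow Q s (opow Q r x) = D (K x)" "opow Q r (opow Q s x) = D (K x)" "opow Q r (opow Q r x) = D (D (K x))"
      by (simp_all add: qr(1) ss Ds[symmetric] DK)
    show "f (D (K x)) + e + (f (D (K x)) - e) = (f o\<^sub>C opow Q s) (opow Q r x) + (f o\<^sub>C opow Q r) (opow Q s x)"
      by (simp add: 1)
    show "(f (D (K x)) + e) * (f (D (K x)) - e) = (f o\<^sub>C opow Q s) (opow Q r x) * (f o\<^sub>C opow Q r) (opow Q s x) -
        (f o\<^sub>C opow Q s) (opow Q s x) * (f o\<^sub>C opow Q r) (opow Q r x)"
      using that by (simp add: 1 ss algebra_simps)
  qed
  have a1: "f (K x) = 0 \<or> f (D (D (K x))) = 0" if "f (D (K x)) = 0" for x and f :: "'a dual"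
  proof (rule ccontr)
    define e where "e = csqrt (f (K x) * f (D (D (K x))))"
    assume "\<not> ?thesis"
    then have "e * e = f (K x) * f (D (D (K x)))" "e \<noteq> 0"
      by (auto simp: e_def simp flip: power2_eq_square)
    then show False
      using eig[of e f x] that subsingletonD[OF single[of x f 0 0], of e "- e"] by simp
  qed
  \<comment> \<open>The values \<open>1 + \<i>\<close> and \<open>1 - \<i>\<close> are distinct and
    of equal modulus. This covers functionals that do not vanish at \<open>D (K x)\<close>, about
    which \<open>a1\<close> says nothing.\<close>
  have a2: "f (K x) * f (D (D (K x))) \<noteq> - 1" if "f (D (K x)) = 1" for x and f :: "'a dual"
  proof
    assume "f (K x) * f (D (D (K x))) = - 1"
    then have "peripheral_spectrum (jordan r s (rank_one x f + rank_one 0 0) Q) = peripheral_pair (1 + \<i>) (1 - \<i>)"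
      using eig[of \<i> f x] that by simp
    also have "\<dots> = {1 + \<i>, 1 - \<i>}" by (rule peripheral_pair_eq) (simp add: cmod_def)
    finally show False
      using subsingletonD[OF single[of x f 0 0], of "1 + \<i>" "1 - \<i>"] by (simp add: complex_eq_iff)
  qed
  have b: "\<exists>c. c \<noteq> 0 \<and> D (K x) = c *\<^sub>C K x" if nz: "D (D (K x)) \<noteq> 0" for x
  proof -
    have "K x \<in> complex_vector.span {D (K x)}"
    proof (rule ccontr)
      assume n: "K x \<notin> complex_vector.span {D (K x)}"
      have "D (D (K x)) \<in> complex_vector.span {D (K x)}"
        using three_vectors[OF n, of "D (D (K x))"] a1 by metis
      then obtain c where c: "D (D (K x)) = c *\<^sub>C D (K x)" by (auto simp: span_singleton_iff)
      have c0: "c \<noteq> 0" "D (K x) \<noteq> 0" using c nz by auto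
      obtain \<phi> :: "'a dual" where \<phi>: "\<phi> (K x) = 1" "\<phi> (D (K x)) = 0" using separate1[OF n] by blast
      obtain \<psi> :: "'a dual" where \<psi>: "\<psi> (D (K x)) = 1" using separate0[OF c0(2)] by blast
      \<comment> \<open>The multiple of \<open>\<phi>\<close> keeps \<open>f (D (K x)) = 1\<close>
        and sets \<open>f (K x) = - 1 / c\<close>; as \<open>f (D (D (K x))) = c\<close>, the
        product is the forbidden -1.\<close>
      define f where "f = \<psi> + (- (1 / c) - \<psi> (K x)) *\<^sub>C \<phi>"
      have "f (D (K x)) = 1" "f (K x) * f (D (D (K x))) = - 1"
        using c0 by (simp_all add: f_def c \<phi> \<psi>)
      then show False using a2 by blast
    qed
    then obtain c where c: "K x = c *\<^sub>C D (K x)" by (auto simp: span_singleton_iff)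
    have "c \<noteq> 0" using c nz by auto
    moreover have "inverse c *\<^sub>C K x = inverse c *\<^sub>C (c *\<^sub>C D (K x))" using c by (rule arg_cong)
    ultimately show ?thesis by (intro exI[of _ "inverse c"]) simp
  qed
  have "opow Q (2 * r) \<noteq> 0" by (rule nonnil)
  then obtain x0 where "opow Q (2 * r) x0 \<noteq> 0" by (metis cblinfun_apply_zero cblinfun_eqI)
  moreover have "opow Q (2 * r) x0 = D (D (K x0))"
    by (simp add: mult_2 opow_add_apply qr(1) ss Ds[symmetric] DK)
  ultimately have x0: "D (D (K x0)) \<noteq> 0" by simp
  then obtain c where c: "c \<noteq> 0" "D (K x0) = c *\<^sub>C K x0" using b by blast
  have y0: "K x0 \<noteq> 0" using x0 by auto
  \<comment> \<open>\<open>b\<close> is silent where \<open>D (D (K x)) = 0\<close>. Applied to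
    \<open>x + x0\<close> it excludes this case off the line of \<open>K x0\<close> and forces the
    same factor everywhere.\<close>
  have DKc: "D (K x) = c *\<^sub>C K x" for x
  proof (cases "K x \<in> complex_vector.span {K x0}")
    case True
    then show ?thesis using c by (auto simp: span_singleton_iff mult.commute)
  next
    case False
    obtain \<phi> \<psi> :: "'a dual" where p: "\<phi> (K x0) = 1" "\<phi> (K x) = 0" "\<psi> (K x0) = 0" "\<psi> (K x) = 1"
      using biorthogonal_pair[OF y0 False] by blast
    have ex: "\<exists>c2. c2 \<noteq> 0 \<and> D (K x) + c *\<^sub>C K x0 = c2 *\<^sub>C K x + c2 *\<^sub>C K x0"
      if nz: "D (D (K x)) + (c * c) *\<^sub>C K x0 \<noteq> 0"
      using b[of "x + x0"] nz by (simp add: c scaleC_add_right)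
    show ?thesis
    proof (cases "D (D (K x)) = 0")
      case True
      have "(c * c) *\<^sub>C K x0 \<noteq> 0" using c(1) y0 by simp
      then obtain c2 where c2: "c2 \<noteq> 0" "D (K x) + c *\<^sub>C K x0 = c2 *\<^sub>C K x + c2 *\<^sub>C K x0"
        using ex True by auto
      have e1: "D (K x) = c2 *\<^sub>C K x + (c2 - c) *\<^sub>C K x0"
        using c2(2) by (simp add: complex_vector.scale_left_diff_distrib algebra_simps)
      have "D (D (K x)) = c2 *\<^sub>C D (K x) + ((c2 - c) * c) *\<^sub>C K x0"
        using arg_cong[OF e1, of D] by (simp add: c)
      then have "0 = \<psi> (c2 *\<^sub>C D (K x) + ((c2 - c) * c) *\<^sub>C K x0)" using True by simp
      then have "c2 * c2 = 0" using e1 p by simp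
      then show ?thesis using c2(1) by simp
    next
      case False
      then obtain c1 where c1: "c1 \<noteq> 0" "D (K x) = c1 *\<^sub>C K x" using b by blast
      have "\<phi> (D (D (K x)) + (c * c) *\<^sub>C K x0) \<noteq> 0" using c(1) p by (simp add: c1)
      then have "D (D (K x)) + (c * c) *\<^sub>C K x0 \<noteq> 0" by (metis cblinfun_linear_simps(4))
      then obtain c2 where c2: "D (K x) + c *\<^sub>C K x0 = c2 *\<^sub>C K x + c2 *\<^sub>C K x0"
        using ex by blast
      have "c1 = c2" "c = c2"
        using arg_cong[OF c2, of \<psi>] arg_cong[OF c2, of \<phi>] p by (simp_all add: c1)
      then show ?thesis using c1 by simp
    qed
  qed
  \<comment> \<open>A cyclic exchange brings the two factors \<open>Q^s\<close> together and leaves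
    \<open>(D + c) A K\<close>; a second one turns \<open>D + c\<close> into
    \<open>2 c\<close>.\<close>
  have spec: "z \<in> operator_spectrum (jordan r s A Q) \<longleftrightarrow> z \<in> operator_spectrum ((2 * c) *\<^sub>C (A o\<^sub>C K))" if z: "z \<noteq> 0" for z A
  proof -
    have "jordan r s A Q = opow Q s o\<^sub>C ((D o\<^sub>C A + A o\<^sub>C D) o\<^sub>C opow Q s)"
      by (rule cblinfun_eqI) (simp add: jordan_def qr(1) Ds)
    then have "z \<in> operator_spectrum (jordan r s A Q) \<longleftrightarrow>
        z \<in> operator_spectrum (((D o\<^sub>C A + A o\<^sub>C D) o\<^sub>C opow Q s) o\<^sub>C opow Q s)"
      using spectrum_swap[OF z] by simp
    also have "((D o\<^sub>C A + A o\<^sub>C D) o\<^sub>C opow Q s) o\<^sub>C opow Q s = (D + c *\<^sub>C cblinfun_id) o\<^sub>C (A o\<^sub>C K)"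
      by (rule cblinfun_eqI) (simp add: ss DKc)
    also have "z \<in> operator_spectrum ((D + c *\<^sub>C cblinfun_id) o\<^sub>C (A o\<^sub>C K)) \<longleftrightarrow>
        z \<in> operator_spectrum ((A o\<^sub>C K) o\<^sub>C (D + c *\<^sub>C cblinfun_id))"
      using spectrum_swap[OF z] .
    also have "(A o\<^sub>C K) o\<^sub>C (D + c *\<^sub>C cblinfun_id) = (2 * c) *\<^sub>C (A o\<^sub>C K)"
      by (rule cblinfun_eqI) (simp add: DK[symmetric] DKc flip: scaleC_add_left)
    finally show ?thesis .
  qed
  define y where "y = K x0"
  have K1: "K x \<in> complex_vector.span {y}" for x
  proof (rule ccontr)
    assume n: "K x \<notin> complex_vector.span {y}"
    obtain \<phi> \<psi> :: "'a dual" where p: "\<phi> (K x0) = 1" "\<phi> (K x) = 0" "\<psi> (K x0) = 0" "\<psi> (K x) = 1"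
      using biorthogonal_pair[OF y0] n unfolding y_def by blast
    \<comment> \<open>\<open>A K\<close> fixes \<open>x0\<close> and negates \<open>x\<close>, which
      gives the two peripheral values \<open>2 c\<close> and \<open>- 2 c\<close>.\<close>
    define A where "A = rank_one x0 \<phi> + rank_one x (- \<psi>)"
    have e: "(2 * c) *\<^sub>C (A o\<^sub>C K) = rank_one x0 ((2 * c) *\<^sub>C (\<phi> o\<^sub>C K)) + rank_one x ((- (2 * c)) *\<^sub>C (\<psi> o\<^sub>C K))"
      by (rule cblinfun_eqI) (simp add: A_def complex_vector.scale_right_diff_distrib)
    have sp: "z \<in> operator_spectrum (jordan r s A Q) \<longleftrightarrow> z = 2 * c \<or> z = - (2 * c)" if z: "z \<noteq> 0" for z
      unfolding spec[OF z] spectrum_rank_two[OF e z] by (simp add: p eq_neg_iff_add_eq_0)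
    have "peripheral_spectrum (jordan r s A Q) = {z \<in> operator_spectrum (jordan r s A Q). cmod z = cmod (2 * c)}"
    proof (rule peripheral_spectrumI)
      show "2 * c \<in> operator_spectrum (jordan r s A Q)" using sp[of "2 * c"] c(1) by simp
      show "cmod z \<le> cmod (2 * c)" if "z \<in> operator_spectrum (jordan r s A Q)" for z
        using sp[of z] that by (cases "z = 0") auto
    qed
    then have "2 * c \<in> peripheral_spectrum (jordan r s A Q)" "- (2 * c) \<in> peripheral_spectrum (jordan r s A Q)"
      using sp[of "2 * c"] sp[of "- (2 * c)"] c(1) by auto
    then have "2 * c = - (2 * c)"
      using subsingletonD[OF single[of x0 \<phi> x "- \<psi>"]] unfolding A_def by blast
    then show False using c(1) by simp
  qed
  obtain \<phi> :: "'a dual" where \<phi>: "\<phi> y = 1" using separate0 y0 unfolding y_def by blast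
  define h where "h = \<phi> o\<^sub>C K"
  have Kh: "K x = h x *\<^sub>C y" for x
  proof -
    obtain d where d: "K x = d *\<^sub>C y" using K1 by (auto simp: span_singleton_iff)
    then show ?thesis using \<phi> by (simp add: h_def)
  qed
  \<comment> \<open>Otherwise \<open>K^2 = 0\<close>, that is \<open>Q^(4 s) = 0\<close>.\<close>
  have hy: "h y \<noteq> 0"
  proof
    assume "h y = 0"
    have "opow Q (2 * s + 2 * s) x = K (K x)" for x unfolding K_def by (rule opow_add_apply)
    moreover have "K (K x) = 0" for x using \<open>h y = 0\<close> by (simp add: Kh)
    ultimately have "opow Q (2 * s + 2 * s) = 0" by (intro cblinfun_eqI) (simp only: cblinfun_apply_zero)
    then show False using nonnil by blast
  qed
  have "t = 2 * (c *\<^sub>C h) (A y)" if t: "peripheral_spectrum (jordan r s A Q) = {t}" for A t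
  proof -
    define w where "w = 2 * c * h (A y)"
    have e: "(2 * c) *\<^sub>C (A o\<^sub>C K) = rank_one (A y) ((2 * c) *\<^sub>C h) + rank_one 0 0"
      by (rule cblinfun_eqI) (simp add: Kh)
    have sp: "z \<in> operator_spectrum (jordan r s A Q) \<longleftrightarrow> z = w" if z: "z \<noteq> 0" for z
      unfolding spec[OF z] spectrum_rank_two[OF e z] using z by (simp add: w_def)
    have ts: "t \<in> operator_spectrum (jordan r s A Q)"
      using t by (auto simp: peripheral_spectrum_def)
    have "t = w"
    proof (cases "w = 0")
      case True
      then show ?thesis using sp ts by blast
    next
      case False
      have "peripheral_spectrum (jordan r s A Q) = {z \<in> operator_spectrum (jordan r s A Q). cmod z = cmod w}"
      proof (rule peripheral_spectrumI)
        show "w \<in> operator_spectrum (jordan r s A Q)" using sp[of w] False by simp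
        show "cmod z \<le> cmod w" if "z \<in> operator_spectrum (jordan r s A Q)" for z
          using sp[of z] that by (cases "z = 0") auto
      qed
      then have "w \<in> {t}" using t sp[OF False] by auto
      then show ?thesis by simp
    qed
    then show ?thesis by (simp add: w_def)
  qed
  then show ?thesis
    using hy c(1) by (intro exI[of _ y] exI[of _ "c *\<^sub>C h"]) simp
qed

section \<open>Preservers between operators on one space\<close>

lemma opow_scaleC: "opow (c *\<^sub>C B) n = c ^ n *\<^sub>C opow B n"
  by (induction n) (auto simp: opow_Suc intro!: cblinfun_eqI)

lemma opow_rank_one:
  assumes "cblinfun_apply f x = 1" "n > 0"
  shows "opow (rank_one x f) n = rank_one x f"
proof -
  obtain k where "n = Suc k" using assms(2) gr0_implies_Suc by blast
  then show ?thesis using opow_idempotent[of "rank_one x f" k] assms(1) by simp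
qed

text \<open>Between two factors \<open>x \<otimes> f\<close> the operator \<open>A\<close> collapses
  to the number \<open>f (A x)\<close>. For \<open>s = 0\<close> one side stays free, and a rank-two
  operator with eigenvalues \<open>f (A x) \<plusminus> \<delta>\<close> remains.\<close>

lemma peripheral_jordan_idempotent:
  assumes dim: "complex_dim_ge TYPE('a::complex_normed_vector) 3"
    and f: "cblinfun_apply f (x :: 'a::complex_normed_vector) = 1" and r: "r > 0"
  shows "s > 0 \<Longrightarrow> peripheral_spectrum (jordan r s A (rank_one x f)) = {2 * f (A x)}"
    and "\<delta> * \<delta> = f (A (A x)) \<Longrightarrow>
      peripheral_spectrum (jordan r 0 A (rank_one x f)) = peripheral_pair (f (A x) + \<delta>) (f (A x) - \<delta>)"
proof -
  show "peripheral_spectrum (jordan r s A (rank_one x f)) = {2 * f (A x)}" if "s > 0"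
  proof -
    have "jordan r s A (rank_one x f) = rank_one x ((2 * f (A x)) *\<^sub>C f)"
      unfolding jordan_def opow_rank_one[OF f r] opow_rank_one[OF f that]
      by (rule cblinfun_eqI) (simp add: algebra_simps flip: scaleC_add_left)
    then show ?thesis by (simp add: peripheral_rank_one[OF dim] f)
  qed
  show "peripheral_spectrum (jordan r 0 A (rank_one x f)) = peripheral_pair (f (A x) + \<delta>) (f (A x) - \<delta>)"
    if "\<delta> * \<delta> = f (A (A x))"
  proof (rule peripheral_rank_two[OF dim])
    show "jordan r 0 A (rank_one x f) = rank_one x (f o\<^sub>C A) + rank_one (A x) f"
      unfolding jordan_def opow_rank_one[OF f r] by (rule cblinfun_eqI) simp
  qed (use that f in \<open>simp_all add: algebra_simps\<close>)
qed

text \<open>A common scalar enters once for each letter of the word; this turns the scalar found at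
  the end into a root of unity.\<close>

lemma peripheral_jordan_scaled_idempotent:
  assumes dim: "complex_dim_ge TYPE('a::complex_normed_vector) 3"
    and f: "cblinfun_apply f (x :: 'a::complex_normed_vector) = 1" and r: "r > 0"
  shows "peripheral_spectrum (jordan r s (c *\<^sub>C rank_one x f) (c *\<^sub>C rank_one x f)) = {2 * c ^ (r + s + 1)}"
proof -
  have "jordan r s (c *\<^sub>C rank_one x f) (c *\<^sub>C rank_one x f) = rank_one x ((2 * c ^ (r + s + 1)) *\<^sub>C f)"
  proof (cases "s = 0")
    case True
    then show ?thesis
      unfolding jordan_def opow_scaleC opow_rank_one[OF f r]
      by (intro cblinfun_eqI) (simp add: f algebra_simps power_add flip: scaleC_add_left)
  next
    case False
    then have s: "s > 0" by simp
    show ?thesis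
      unfolding jordan_def opow_scaleC opow_rank_one[OF f r] opow_rank_one[OF f s]
      by (rule cblinfun_eqI) (simp add: f algebra_simps power_add flip: scaleC_add_left)
  qed
  then show ?thesis by (simp add: peripheral_rank_one[OF dim] f)
qed

text \<open>If \<open>W x\<close> left the line of \<open>x\<close>, a functional vanishing at
  \<open>x\<close> but not at \<open>W x\<close> would contradict the hypothesis. Multiples of the
  identity are exactly what traces at nilpotents cannot see.\<close>

lemma scalar_of_nilpotent_traces:
  fixes W :: "'a::complex_normed_vector \<Rightarrow>\<^sub>B 'a"
  assumes "\<And>x f. cblinfun_apply f x = (0 :: complex) \<Longrightarrow> f (W x) = 0"
  obtains c where "\<And>x. W x = c *\<^sub>C x"
proof -
  have loc: "\<exists>c. W x = c *\<^sub>C x" for x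
  proof (rule ccontr)
    assume "\<nexists>c. W x = c *\<^sub>C x"
    then have "W x \<notin> complex_vector.span {x}" by (simp add: span_singleton_iff)
    then show False using separate1 assms by (metis zero_neq_one)
  qed
  show ?thesis
  proof (rule scalar_of_locally_scalar[OF complex_vector.subspace_UNIV loc])
    fix c assume H: "\<And>y. y \<in> UNIV \<Longrightarrow> W y = c *\<^sub>C y"
    show ?thesis by (rule that, rule H, rule UNIV_I)
  qed
qed

lemma zero_of_idempotent_traces:
  fixes W :: "'a::complex_normed_vector \<Rightarrow>\<^sub>B 'a"
  assumes "\<And>x f. cblinfun_apply f x = (1 :: complex) \<Longrightarrow> f (W x) = 0"
  shows "W = 0"
proof (rule cblinfun_eqI)
  fix x
  show "W x = (0 :: 'a \<Rightarrow>\<^sub>B 'a) x"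
  proof (cases "x = 0")
    case False
    then obtain g :: "'a dual" where g: "g x = 1" using separate0 by blast
    have "f (W x) = f 0" for f :: "'a dual"
      using assms[of "f + (1 - f x) *\<^sub>C g" x] assms[OF g] g by simp
    then have "W x = 0" by (rule dual_separates)
    then show ?thesis by simp
  qed simp
qed

section \<open>Cube roots of unity as peripheral values\<close>

definition cube_root_unity :: complex ("\<omega>")
  where "\<omega> = Complex (- 1 / 2) (sqrt 3 / 2)"

lemma cube_root_unity: "\<omega> ^ 3 = 1" "(\<omega>\<^sup>2) ^ 3 = 1" "\<omega> \<noteq> 1" "\<omega>\<^sup>2 \<noteq> 1" "\<omega> \<noteq> \<omega>\<^sup>2"
proof -
  show 1: "\<omega> ^ 3 = 1"
    by (simp add: cube_root_unity_def power3_eq_cube complex_eq_iff)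
  then show "(\<omega>\<^sup>2) ^ 3 = 1" by (metis power_mult mult.commute power_one)
  show "\<omega> \<noteq> 1" "\<omega>\<^sup>2 \<noteq> 1" "\<omega> \<noteq> \<omega>\<^sup>2"
    by (simp_all add: cube_root_unity_def power2_eq_square complex_eq_iff)
qed

text \<open>\<open>F^4 = F\<close> confines the spectrum to 0 and the cube roots of unity, so these
  roots are peripheral as soon as they are eigenvalues.\<close>

lemma three_peripheral_values:
  fixes F :: "'a::complex_normed_vector \<Rightarrow>\<^sub>B 'a"
  assumes F: "\<And>x. F (F (F (F x))) = F x"
    and ev: "\<And>l. l ^ 3 = 1 \<Longrightarrow> \<exists>v. v \<noteq> 0 \<and> F v = l *\<^sub>C v"
  shows "{1, \<omega>, \<omega>\<^sup>2} \<subseteq> peripheral_spectrum F"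
proof -
  have sp: "l \<in> operator_spectrum F" if "l ^ 3 = 1" for l
    using ev[OF that] eigenvalue_in_spectrum by blast
  have norm1: "cmod l = 1" if "l ^ 3 = 1" for l
  proof -
    have "cmod l ^ 3 = 1" using that by (metis norm_one norm_power)
    then show ?thesis using power_eq_imp_eq_base[of "cmod l" 3 1] by simp
  qed
  have le: "cmod z \<le> 1" if "z \<in> operator_spectrum F" for z
  proof -
    have "z ^ 4 = z" using spectrum_cubic[OF F that] .
    then have "z * (z ^ 3 - 1) = 0" by (simp add: algebra_simps power_numeral_reduce)
    then show ?thesis using norm1[of z] by auto
  qed
  have "peripheral_spectrum F = {z \<in> operator_spectrum F. cmod z = cmod 1}"
    by (rule peripheral_spectrumI) (use sp[of 1] le in auto)
  then show ?thesis using sp norm1 cube_root_unity(1,2) by auto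
qed

lemma rank_two_not_three_peripheral_values:
  assumes "F = rank_one u1 g1 + rank_one u2 g2"
  shows "\<not> {1, \<omega>, \<omega>\<^sup>2} \<subseteq> peripheral_spectrum F"
proof
  assume H: "{1, \<omega>, \<omega>\<^sup>2} \<subseteq> peripheral_spectrum F"
  obtain a b where ab: "\<forall>z\<in>operator_spectrum F. z = 0 \<or> z = a \<or> z = b"
    using spectrum_rank_two_subset[OF assms] by blast
  have "1 \<in> operator_spectrum F" "\<omega> \<in> operator_spectrum F" "\<omega>\<^sup>2 \<in> operator_spectrum F"
    using H by (auto simp: peripheral_spectrum_def)
  moreover have "\<omega> \<noteq> 0" using cube_root_unity(1) by auto
  ultimately show False using ab cube_root_unity(3-5) by (metis power_not_zero zero_neq_one)
qed

text \<open>For the idempotent \<open>P\<close> alone, \<open>P A + A P\<close> has rank at most two and thus at most two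
  nonzero eigenvalues; a nonzero scalar summand allows three peripheral values, the cube roots of unity.\<close>

lemma idempotent_plus_scalar_three_values:
  assumes dim: "complex_dim_ge TYPE('a::complex_normed_vector) 3"
    and f: "cblinfun_apply f (x :: 'a::complex_normed_vector) = 1" and \<gamma>: "\<gamma> \<noteq> 0" and \<kappa>: "\<kappa> \<noteq> 0"
    and C: "\<And>v. cblinfun_apply C v = \<kappa> *\<^sub>C rank_one x f v + \<gamma> *\<^sub>C v"
  shows "\<exists>u1 g1 u2 g2 u3 g3 A. A = rank_one u1 g1 + rank_one u2 g2 + rank_one u3 g3 \<and>
    {1, \<omega>, \<omega>\<^sup>2} \<subseteq> peripheral_spectrum (C o\<^sub>C A + A o\<^sub>C C)"
proof -
  obtain y z :: 'a and g h :: "'a dual" where b: "f y = 0" "f z = 0" "g x = 0" "g y = 1" "g z = 0"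
    "h x = 0" "h y = 0" "h z = 1"
    using biorthogonal_triple[OF dim f] by metis
  have Cb: "C x = (\<kappa> + \<gamma>) *\<^sub>C x" "C y = \<gamma> *\<^sub>C y" "C z = \<gamma> *\<^sub>C z"
    "f (C v) = (\<kappa> + \<gamma>) * f v" "g (C v) = \<gamma> * g v" "h (C v) = \<gamma> * h v" for v
    by (simp_all add: C b f scaleC_add_left algebra_simps)
  have collect: "(p *\<^sub>C x + q *\<^sub>C y + t *\<^sub>C z) + (p' *\<^sub>C x + q' *\<^sub>C y + t' *\<^sub>C z)
      = (p + p') *\<^sub>C x + (q + q') *\<^sub>C y + (t + t') *\<^sub>C z" for p q t p' q' t'
    by (simp add: scaleC_add_left)
  show ?thesis
  proof (cases "\<kappa> + 2 * \<gamma> = 0")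
    case False
    \<comment> \<open>On \<open>x\<close>, \<open>y\<close>, \<open>z\<close> the operator
      \<open>C\<close> is diagonal with entries \<open>\<kappa> + \<gamma>\<close>,
      \<open>\<gamma>\<close>, \<open>\<gamma>\<close>, so \<open>C A + A C\<close> arises from
      \<open>A\<close> by scaling each matrix entry with a sum of two of these. The constants undo
      the scaling and leave a cyclic permutation of the basis.\<close>
    define a where "a = inverse (\<kappa> + 2 * \<gamma>)"
    define b' where "b' = inverse (2 * \<gamma>)"
    have ab: "\<kappa> * a + 2 * (\<gamma> * a) = 1" "2 * (\<gamma> * b') = 1"
    proof -
      have "\<kappa> * a + 2 * (\<gamma> * a) = (\<kappa> + 2 * \<gamma>) * a" by algebra
      then show "\<kappa> * a + 2 * (\<gamma> * a) = 1" using False by (simp add: a_def)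
      show "2 * (\<gamma> * b') = 1" using \<gamma> by (simp add: b'_def)
    qed
    define A where "A = rank_one x (a *\<^sub>C g) + rank_one y (b' *\<^sub>C h) + rank_one z (a *\<^sub>C f)"
    have F: "(C o\<^sub>C A + A o\<^sub>C C) v = g v *\<^sub>C x + h v *\<^sub>C y + f v *\<^sub>C z" for v
    proof -
      have "(C o\<^sub>C A + A o\<^sub>C C) v
          = ((a * g v * (\<kappa> + \<gamma>)) *\<^sub>C x + (b' * h v * \<gamma>) *\<^sub>C y + (a * f v * \<gamma>) *\<^sub>C z)
            + ((a * (\<gamma> * g v)) *\<^sub>C x + (b' * (\<gamma> * h v)) *\<^sub>C y + (a * ((\<kappa> + \<gamma>) * f v)) *\<^sub>C z)"
        by (simp add: A_def Cb)
      also have "\<dots> = g v *\<^sub>C x + h v *\<^sub>C y + f v *\<^sub>C z"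
      proof -
        have "a * g v * (\<kappa> + \<gamma>) + a * (\<gamma> * g v) = (\<kappa> * a + 2 * (\<gamma> * a)) * g v"
          "b' * h v * \<gamma> + b' * (\<gamma> * h v) = (2 * (\<gamma> * b')) * h v"
          "a * f v * \<gamma> + a * ((\<kappa> + \<gamma>) * f v) = (\<kappa> * a + 2 * (\<gamma> * a)) * f v" by algebra+
        then show ?thesis unfolding collect by (simp only: ab mult_1)
      qed
      finally show ?thesis .
    qed
    have "{1, \<omega>, \<omega>\<^sup>2} \<subseteq> peripheral_spectrum (C o\<^sub>C A + A o\<^sub>C C)"
    proof (rule three_peripheral_values)
      show "(C o\<^sub>C A + A o\<^sub>C C) ((C o\<^sub>C A + A o\<^sub>C C) ((C o\<^sub>C A + A o\<^sub>C C) ((C o\<^sub>C A + A o\<^sub>C C) v))) = (C o\<^sub>C A + A o\<^sub>C C) v" for v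
        unfolding F by (simp add: b f algebra_simps)
      fix l :: complex assume l: "l ^ 3 = 1"
      define v where "v = x + l *\<^sub>C y + (l * l) *\<^sub>C z"
      have "f v = 1" by (simp add: v_def b f)
      then have "v \<noteq> 0" by auto
      moreover have "(C o\<^sub>C A + A o\<^sub>C C) v = l *\<^sub>C v"
        unfolding F using l by (simp add: v_def b f scaleC_add_right power3_eq_cube mult.assoc)
      ultimately show "\<exists>v. v \<noteq> 0 \<and> (C o\<^sub>C A + A o\<^sub>C C) v = l *\<^sub>C v" by blast
    qed
    then show ?thesis using A_def by blast
  next
    case True
    then have \<kappa>': "\<kappa> = - (2 * \<gamma>)" by (simp add: eq_neg_iff_add_eq_0)
    \<comment> \<open>Now \<open>C\<close> is \<open>\<gamma>\<close> times a reflection, and the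
      entries of \<open>A\<close> joining \<open>x\<close> to \<open>y\<close> or \<open>z\<close>
      are killed. Diagonal entries survive, so the three roots are placed on the diagonal
      instead.\<close>
    define \<nu> where "\<nu> = \<omega>\<^sup>2"
    have \<nu>3: "\<nu> ^ 3 = 1" unfolding \<nu>_def by (rule cube_root_unity)
    define b' where "b' = inverse (2 * \<gamma>)"
    have ab: "2 * (\<gamma> * b') = 1" using \<gamma> by (simp add: b'_def)
    define A where "A = rank_one x (- b' *\<^sub>C f) + rank_one y ((b' * \<omega>) *\<^sub>C g) + rank_one z ((b' * \<nu>) *\<^sub>C h)"
    have F: "(C o\<^sub>C A + A o\<^sub>C C) v = f v *\<^sub>C x + (\<omega> * g v) *\<^sub>C y + (\<nu> * h v) *\<^sub>C z" for v
    proof -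
      have "(C o\<^sub>C A + A o\<^sub>C C) v
          = ((- b' * f v * (\<kappa> + \<gamma>)) *\<^sub>C x + (b' * \<omega> * g v * \<gamma>) *\<^sub>C y + (b' * \<nu> * h v * \<gamma>) *\<^sub>C z)
            + ((- b' * ((\<kappa> + \<gamma>) * f v)) *\<^sub>C x + (b' * \<omega> * (\<gamma> * g v)) *\<^sub>C y + (b' * \<nu> * (\<gamma> * h v)) *\<^sub>C z)"
        by (simp add: A_def Cb)
      also have "\<dots> = f v *\<^sub>C x + (\<omega> * g v) *\<^sub>C y + (\<nu> * h v) *\<^sub>C z"
      proof -
        have "- b' * f v * (\<kappa> + \<gamma>) + - b' * ((\<kappa> + \<gamma>) * f v) = (2 * (\<gamma> * b')) * f v"
          "b' * \<omega> * g v * \<gamma> + b' * \<omega> * (\<gamma> * g v) = (2 * (\<gamma> * b')) * (\<omega> * g v)"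
          "b' * \<nu> * h v * \<gamma> + b' * \<nu> * (\<gamma> * h v) = (2 * (\<gamma> * b')) * (\<nu> * h v)"
          unfolding \<kappa>' by algebra+
        then show ?thesis unfolding collect by (simp only: ab mult_1)
      qed
      finally show ?thesis .
    qed
    have "{1, \<omega>, \<omega>\<^sup>2} \<subseteq> peripheral_spectrum (C o\<^sub>C A + A o\<^sub>C C)"
    proof (rule three_peripheral_values)
      have w: "\<omega> * (\<omega> * (\<omega> * (\<omega> * t))) = \<omega> * t" "\<nu> * (\<nu> * (\<nu> * (\<nu> * t))) = \<nu> * t" for t
      proof -
        have "\<omega> * (\<omega> * (\<omega> * (\<omega> * t))) = \<omega> ^ 3 * (\<omega> * t)" "\<nu> * (\<nu> * (\<nu> * (\<nu> * t))) = (\<nu>) ^ 3 * (\<nu> * t)"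
          by (simp_all add: power3_eq_cube)
        then show "\<omega> * (\<omega> * (\<omega> * (\<omega> * t))) = \<omega> * t" "\<nu> * (\<nu> * (\<nu> * (\<nu> * t))) = \<nu> * t"
          by (simp_all only: cube_root_unity \<nu>3 mult_1)
      qed
      show "(C o\<^sub>C A + A o\<^sub>C C) ((C o\<^sub>C A + A o\<^sub>C C) ((C o\<^sub>C A + A o\<^sub>C C) ((C o\<^sub>C A + A o\<^sub>C C) v))) = (C o\<^sub>C A + A o\<^sub>C C) v" for v
        unfolding F by (simp add: b f w)
      fix l :: complex assume l: "l ^ 3 = 1"
      have "(l - 1) * ((l - \<omega>) * (l - \<nu>)) = l ^ 3 - 1"
      proof -
        have s: "1 + \<omega> + \<nu> = 0" by (simp add: \<nu>_def cube_root_unity_def power2_eq_square complex_eq_iff)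
        have c: "\<omega> * \<nu> = 1" using cube_root_unity(1) by (simp add: \<nu>_def power3_eq_cube power2_eq_square mult.assoc)
        have "(l - 1) * ((l - w) * (l - w2)) = l ^ 3 - (1 + w + w2) * l\<^sup>2 + (w * w2 + (w + w2 + 1) - 1) * l - w * w2"
          for w w2 :: complex by (simp add: algebra_simps power3_eq_cube power2_eq_square)
        from this[of \<omega> "\<nu>"] show ?thesis using s c by (simp add: add.commute add.left_commute)
      qed
      then have "l = 1 \<or> l = \<omega> \<or> l = \<nu>" using l by auto
      moreover have "x \<noteq> 0" "y \<noteq> 0" "z \<noteq> 0" using b f by auto
      ultimately show "\<exists>v. v \<noteq> 0 \<and> (C o\<^sub>C A + A o\<^sub>C C) v = l *\<^sub>C v"
        unfolding F using b f by (elim disjE) (rule exI[of _ x] exI[of _ y] exI[of _ z]; simp; fail)+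
    qed
    then show ?thesis using A_def by blast
  qed
qed

lemma zero_of_small_bounds:
  fixes a C :: real
  assumes "\<And>t. 0 < t \<Longrightarrow> t \<le> 1 \<Longrightarrow> a \<le> t * C" "a \<ge> 0"
  shows "a = 0"
proof (rule ccontr)
  assume "a \<noteq> 0"
  then have a: "a > 0" using assms(2) by simp
  define t where "t = a / (a + \<bar>C\<bar> + 1)"
  have d: "a + \<bar>C\<bar> + 1 > 0" using a by linarith
  have t: "0 < t" "t \<le> 1" using a d by (auto simp: t_def)
  have "a \<le> t * \<bar>C\<bar>" using assms(1)[OF t] mult_left_mono[of C "\<bar>C\<bar>" t] t by linarith
  then have "a * (a + \<bar>C\<bar> + 1) \<le> a * \<bar>C\<bar>" using d by (simp add: t_def field_simps)
  then have "a * (a + 1) \<le> 0" by (simp add: algebra_simps)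
  then show False using a mult_pos_pos[of a "a + 1"] by linarith
qed

text \<open>Letting \<open>f x\<close> tend to \<open>0\<close> in the eigenvalues \<open>f (E x) \<pm> sqrt (f x f (E (E x)))\<close> recovers
  \<open>f (E x)\<close> for \<open>f x = 0\<close>.\<close>

lemma jordan_idempotents_determine:
  fixes E E' :: "'a::complex_normed_vector \<Rightarrow>\<^sub>B 'a"
  assumes dim: "complex_dim_ge TYPE('a) 3" and r: "r > 0"
    and eq: "\<And>x f. cblinfun_apply f x = (1 :: complex) \<Longrightarrow>
      peripheral_spectrum (jordan r 0 E (rank_one x f)) = peripheral_spectrum (jordan r 0 E' (rank_one x f))"
  shows "E = E'"
proof -
  \<comment> \<open>A common peripheral value is one of two eigenvalues on either side; the signs of
    the roots \<open>d\<close> and \<open>d'\<close> are chosen to match it.\<close>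
  have ex: "\<exists>d d'. d * d = f (E (E x)) \<and> d' * d' = f (E' (E' x)) \<and> f (E x) + d = f (E' x) + d'"
    if f: "f x = 1" for x and f :: "'a dual"
  proof -
    define d where "d = csqrt (f (E (E x)))"
    define d' where "d' = csqrt (f (E' (E' x)))"
    have d: "d * d = f (E (E x))" "d' * d' = f (E' (E' x))"
      by (simp_all add: d_def d'_def flip: power2_eq_square)
    obtain z where "z \<in> peripheral_pair (f (E x) + d) (f (E x) - d)"
      using peripheral_pair_nonempty by blast
    moreover from this have "z \<in> peripheral_pair (f (E' x) + d') (f (E' x) - d')"
      using peripheral_jordan_idempotent(2)[OF dim f r] d eq[OF f] by blast
    ultimately have "z = f (E x) + d \<or> z = f (E x) + (- d)" "z = f (E' x) + d' \<or> z = f (E' x) + (- d')"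
      using peripheral_pair_subset by fastforce+
    moreover have "(- d) * (- d) = f (E (E x))" "(- d') * (- d') = f (E' (E' x))" using d by simp_all
    ultimately show ?thesis using d by metis
  qed
  have nil: "f0 (E x) = f0 (E' x)" if f0: "f0 x = 0" for x and f0 :: "'a dual"
  proof (cases "x = 0")
    case False
    then obtain g :: "'a dual" where g: "g x = 1" using separate0 by blast
    define q where "q = f0 (E x) - f0 (E' x)"
    define q1 where "q1 = g (E x) - g (E' x)"
    define C where "C = cmod (f0 (E (E x))) + cmod (g (E (E x)))"
    define C' where "C' = cmod (f0 (E' (E' x))) + cmod (g (E' (E' x)))"
    have "cmod q \<le> t * (sqrt C + sqrt C' + cmod q1)" if t: "0 < t" "t \<le> 1" for t
    proof -
      \<comment> \<open>With \<open>f = f0 / \<tau> + g\<close> and \<open>\<tau> = t^2\<close> the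
        roots are of order \<open>1 / t\<close>. After multiplication by \<open>\<tau>\<close> they
        are of order \<open>t\<close>, while \<open>\<tau> f (E x)\<close> tends to
        \<open>f0 (E x)\<close>.\<close>
      define \<tau> where "\<tau> = complex_of_real (t * t)"
      have \<tau>0: "\<tau> \<noteq> 0" using t by (simp add: \<tau>_def)
      have tt: "t * t \<le> t" "t * t \<le> 1" using t by (simp_all add: mult_left_le mult_le_one)
      define f where "f = inverse \<tau> *\<^sub>C (f0 + \<tau> *\<^sub>C g)"
      have fx: "f x = 1" using \<tau>0 f0 g by (simp add: f_def)
      have tf: "\<tau> * f v = f0 v + \<tau> * g v" for v using \<tau>0 by (simp add: f_def)
      obtain d d' where d: "d * d = f (E (E x))" "d' * d' = f (E' (E' x))" "f (E x) + d = f (E' x) + d'"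
        using ex[OF fx] by blast
      have bound: "cmod (\<tau> * e) \<le> t * sqrt (cmod (f0 w) + cmod (g w))" if "e * e = f w" for e w
      proof -
        have "(\<tau> * e) * (\<tau> * e) = \<tau> * (\<tau> * f w)" unfolding that[symmetric] by (simp add: algebra_simps)
        also have "\<dots> = \<tau> * (f0 w + \<tau> * g w)" by (simp add: tf)
        finally have "(cmod (\<tau> * e))\<^sup>2 = (t * t) * cmod (f0 w + \<tau> * g w)"
          using t by (metis \<tau>_def abs_of_nonneg less_eq_real_def mult_nonneg_nonneg norm_mult norm_of_real power2_eq_square)
        also have "cmod (f0 w + \<tau> * g w) \<le> cmod (f0 w) + (t * t) * cmod (g w)"
          using norm_triangle_ineq[of "f0 w" "\<tau> * g w"] t by (simp add: \<tau>_def norm_mult)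
        also have "(t * t) * cmod (g w) \<le> cmod (g w)" using tt by (simp add: mult_left_le_one_le)
        finally have "(cmod (\<tau> * e))\<^sup>2 \<le> (t * t) * (cmod (f0 w) + cmod (g w))"
          using t by (simp add: mult_left_mono)
        then have "sqrt ((cmod (\<tau> * e))\<^sup>2) \<le> sqrt ((t * t) * (cmod (f0 w) + cmod (g w)))"
          by (rule real_sqrt_le_mono)
        then show ?thesis using t by (simp add: real_sqrt_mult)
      qed
      have "q + \<tau> * q1 = \<tau> * (f (E x) - f (E' x))"
        by (simp add: right_diff_distrib tf, simp add: q_def q1_def algebra_simps)
      also have "f (E x) - f (E' x) = d' - d" using d(3) by (simp add: algebra_simps)
      finally have "q = \<tau> * d' - \<tau> * d - \<tau> * q1" by (simp add: algebra_simps)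
      then have "cmod q \<le> cmod (\<tau> * d') + cmod (\<tau> * d) + cmod (\<tau> * q1)"
        using norm_triangle_ineq4[of "\<tau> * d' - \<tau> * d" "\<tau> * q1"] norm_triangle_ineq4[of "\<tau> * d'" "\<tau> * d"] by simp
      moreover have "cmod (\<tau> * d') \<le> t * sqrt C'" "cmod (\<tau> * d) \<le> t * sqrt C"
        using bound[OF d(1)] bound[OF d(2)] by (simp_all add: C_def C'_def)
      moreover have "cmod (\<tau> * q1) \<le> t * cmod q1"
        using t tt by (simp add: \<tau>_def norm_mult mult_right_mono)
      ultimately show ?thesis by (simp add: algebra_simps)
    qed
    then have "cmod q = 0" by (rule zero_of_small_bounds) simp_all
    then show ?thesis by (simp add: q_def)
  qed simp
  have nil': "f ((E' - E) x) = 0" if "f x = 0" for x and f :: "'a dual"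
    using nil[OF that] by simp
  obtain \<alpha> where \<alpha>: "\<And>x. (E' - E) x = \<alpha> *\<^sub>C x"
    using scalar_of_nilpotent_traces[OF nil'] by blast
  have E': "E' x = E x + \<alpha> *\<^sub>C x" for x using \<alpha>[of x] by (simp add: algebra_simps)
  have "\<alpha> = 0"
  proof (cases "\<exists>x. E x \<notin> complex_vector.span {x}")
    case True
    then obtain x where n: "E x \<notin> complex_vector.span {x}" by blast
    then have "x \<noteq> 0" by (auto simp: complex_vector.span_zero)
    then obtain f0 g :: "'a dual" where b: "f0 x = 1" "f0 (E x) = 0" "g x = 0" "g (E x) = 1"
      using biorthogonal_pair[OF _ n] by metis
    define q where "q = f0 (E (E x))"
    define p where "p = g (E (E x))"
    show ?thesis
    proof (rule ccontr)
      assume a: "\<alpha> \<noteq> 0"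
      \<comment> \<open>Along the functionals \<open>f0 + n g\<close> a nonzero
        \<open>\<alpha>\<close> forces \<open>d' = - (n + \<alpha>)\<close>, and hence a quadratic
        equation for every \<open>n\<close>, which cannot hold at all of 0, 1 and 2.\<close>
      have sq: "n * n = q + n * p" for n
      proof -
        have "(f0 + n *\<^sub>C g) x = 1" using b by simp
        from ex[OF this] obtain d d' where e: "d * d = (f0 + n *\<^sub>C g) (E (E x))"
          "d' * d' = (f0 + n *\<^sub>C g) (E' (E' x))" "(f0 + n *\<^sub>C g) (E x) + d = (f0 + n *\<^sub>C g) (E' x) + d'"
          by blast
        have d: "d * d = q + n * p" "d' * d' = q + n * p + 2 * \<alpha> * n + \<alpha> * \<alpha>" "n + d = n + \<alpha> + d'"
          using e by (simp_all add: E' b q_def p_def algebra_simps)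
        have "d = \<alpha> + d'" using d(3) by simp
        then have "\<alpha> * (d' + (n + \<alpha>)) = 0" using d(1,2) by algebra
        then have "d' + (n + \<alpha>) = 0" using a by simp
        then have "d' = - (n + \<alpha>)" by (simp only: eq_neg_iff_add_eq_0)
        then show ?thesis using d(2) by algebra
      qed
      show False using sq[of 0] sq[of 1] sq[of 2] by simp
    qed
  next
    case False
    then have loc: "\<exists>c. E x = c *\<^sub>C x" for x by (simp add: span_singleton_iff)
    obtain \<epsilon> where H: "\<And>x. x \<in> UNIV \<Longrightarrow> E x = \<epsilon> *\<^sub>C x"
      using scalar_of_locally_scalar[OF complex_vector.subspace_UNIV loc] by blast
    have \<epsilon>: "E x = \<epsilon> *\<^sub>C x" for x by (rule H, rule UNIV_I)
    obtain x :: 'a where "x \<notin> complex_vector.span {}" using not_in_span_of_dim[OF dim, of "{}"] by auto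
    then have "x \<noteq> 0" by simp
    then obtain f :: "'a dual" where f: "f x = 1" using separate0 by blast
    have "peripheral_spectrum (jordan r 0 E (rank_one x f)) = {2 * \<epsilon>}"
      using peripheral_jordan_idempotent(2)[OF dim f r, of \<epsilon> E] by (simp add: \<epsilon> f)
    moreover have "peripheral_spectrum (jordan r 0 E' (rank_one x f)) = {2 * (\<epsilon> + \<alpha>)}"
      using peripheral_jordan_idempotent(2)[OF dim f r, of "\<epsilon> + \<alpha>" E'] by (simp add: E' \<epsilon> f algebra_simps)
    ultimately show ?thesis using eq[OF f] by simp
  qed
  then show ?thesis using E' by (intro cblinfun_eqI) simp
qed

text \<open>The traces fix a preimage \<open>B\<close> of a rank-one idempotent, or
  \<open>B^r\<close> when \<open>s = 0\<close>, up to a summand \<open>\<gamma>\<close> times the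
  identity, and a spectral test gives \<open>\<gamma> = 0\<close>. Products with these
  \<open>B\<close> then determine \<open>\<Psi> A\<close>, and a single idempotent yields the root
  of unity.\<close>

theorem jordan_preserver_scalar:
  fixes \<A> :: "('a::complex_normed_vector \<Rightarrow>\<^sub>B 'a) set" and \<Psi> :: "('a \<Rightarrow>\<^sub>B 'a) \<Rightarrow> 'a \<Rightarrow>\<^sub>B 'a"
  assumes dim: "complex_dim_ge TYPE('a) 3" and r: "r > 0"
    and mem: "\<And>u1 g1 u2 g2 u3 g3. rank_one u1 g1 + rank_one u2 g2 + rank_one u3 g3 \<in> \<A>"
    and pres: "\<And>A B. A \<in> \<A> \<Longrightarrow> B \<in> \<A> \<Longrightarrow>
      peripheral_spectrum (jordan r s (\<Psi> A) (\<Psi> B)) = peripheral_spectrum (jordan r s A B)"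
    and surj: "\<And>x f. cblinfun_apply f x = (1 :: complex) \<Longrightarrow> \<exists>B\<in>\<A>. \<Psi> B = rank_one x f"
    and \<kappa>: "\<kappa> \<noteq> 0"
    and tr: "\<And>A x f. A \<in> \<A> \<Longrightarrow> cblinfun_apply f x = (0 :: complex) \<Longrightarrow>
      (if s = 0 then f (opow A r x) = \<kappa> * f (opow (\<Psi> A) r x) else f (A x) = \<kappa> * f (\<Psi> A x))"
  shows "\<exists>c. c ^ (r + s + 1) = 1 \<and> (\<forall>A\<in>\<A>. \<Psi> A = c *\<^sub>C A)"
proof -
  have mem1: "rank_one u g \<in> \<A>" for u g using mem[of u g 0 0 0 0] by simp
  have "\<exists>c. \<forall>A\<in>\<A>. \<Psi> A = c *\<^sub>C A"
  proof (cases "s = 0")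
    case s: True
    have key: "\<exists>B\<in>\<A>. \<Psi> B = rank_one x f \<and> opow B r = \<kappa> *\<^sub>C rank_one x f" if f: "f x = 1" for x and f :: "'a dual"
    proof -
      obtain B where B: "B \<in> \<A>" "\<Psi> B = rank_one x f" using surj[OF f] by blast
      have "f' ((opow B r - \<kappa> *\<^sub>C rank_one x f) x') = 0" if "f' x' = 0" for x' and f' :: "'a dual"
        using tr[OF B(1) that] s by (simp add: B(2) opow_rank_one[OF f r])
      then obtain \<gamma> where "\<And>v. (opow B r - \<kappa> *\<^sub>C rank_one x f) v = \<gamma> *\<^sub>C v"
        using scalar_of_nilpotent_traces by blast
      then have \<gamma>: "opow B r v = \<kappa> *\<^sub>C rank_one x f v + \<gamma> *\<^sub>C v" for v by (simp add: algebra_simps)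
      \<comment> \<open>The Jordan product with the idempotent \<open>\<Psi> B\<close> has rank at
        most two, too small for three nonzero peripheral values.\<close>
      have "\<gamma> = 0"
      proof (rule ccontr)
        assume "\<gamma> \<noteq> 0"
        then obtain A where A: "A \<in> \<A>" "{1, \<omega>, \<omega>\<^sup>2} \<subseteq> peripheral_spectrum (opow B r o\<^sub>C A + A o\<^sub>C opow B r)"
          using idempotent_plus_scalar_three_values[OF dim f _ \<kappa> \<gamma>] mem by metis
        have "jordan r s A B = opow B r o\<^sub>C A + A o\<^sub>C opow B r"
          by (simp add: jordan_def s)
        moreover have "jordan r s (\<Psi> A) (\<Psi> B) = rank_one x (f o\<^sub>C \<Psi> A) + rank_one (\<Psi> A x) f"
          by (simp add: jordan_def s B(2) opow_rank_one[OF f r] compose_rank_one rank_one_compose)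
        ultimately show False
          using A(2) pres[OF A(1) B(1)] rank_two_not_three_peripheral_values by metis
      qed
      then have "opow B r = \<kappa> *\<^sub>C rank_one x f" using \<gamma> by (intro cblinfun_eqI) simp
      then show ?thesis using B by blast
    qed
    have "\<Psi> A = \<kappa> *\<^sub>C A" if A: "A \<in> \<A>" for A
    proof (rule jordan_idempotents_determine[OF dim r])
      fix x and f :: "'a dual" assume f: "f x = 1"
      obtain B where B: "B \<in> \<A>" "\<Psi> B = rank_one x f" "opow B r = \<kappa> *\<^sub>C rank_one x f" using key[OF f] by blast
      have "jordan r 0 (\<kappa> *\<^sub>C A) (rank_one x f) = jordan r 0 A B"
        unfolding jordan_def B(3) opow_rank_one[OF f r] by (rule cblinfun_eqI) (simp add: mult.commute)
      then show "peripheral_spectrum (jordan r 0 (\<Psi> A) (rank_one x f)) =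
          peripheral_spectrum (jordan r 0 (\<kappa> *\<^sub>C A) (rank_one x f))"
        using pres[OF A B(1)] B(2) s by simp
    qed
    then show ?thesis by blast
  next
    case False
    then have s: "s > 0" by simp
    have key: "\<exists>B\<in>\<A>. \<Psi> B = rank_one x f \<and> B = \<kappa> *\<^sub>C rank_one x f" if f: "f x = 1" for x and f :: "'a dual"
    proof -
      obtain B where B: "B \<in> \<A>" "\<Psi> B = rank_one x f" using surj[OF f] by blast
      have "f' ((B - \<kappa> *\<^sub>C rank_one x f) x') = 0" if "f' x' = 0" for x' and f' :: "'a dual"
        using tr[OF B(1) that] s by (simp add: B(2))
      then obtain \<gamma> where "\<And>v. (B - \<kappa> *\<^sub>C rank_one x f) v = \<gamma> *\<^sub>C v"
        using scalar_of_nilpotent_traces by blast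
      then have \<gamma>: "B v = \<kappa> *\<^sub>C rank_one x f v + \<gamma> *\<^sub>C v" for v by (simp add: algebra_simps)
      have "\<gamma> = 0"
      proof (rule ccontr)
        assume g0: "\<gamma> \<noteq> 0"
        obtain y z :: 'a and g h :: "'a dual" where b: "f y = 0" "f z = 0" "g x = 0" "g y = 1" "g z = 0"
          "h x = 0" "h y = 0" "h z = 1"
          using biorthogonal_triple[OF dim f] by metis
        \<comment> \<open>\<open>B\<close> acts as \<open>\<gamma>\<close> on \<open>y\<close> and
          \<open>z\<close>, so the product has two opposite peripheral values there, whereas the
          product with the idempotent \<open>\<Psi> B\<close> has only one.\<close>
        define A where "A = rank_one y g + rank_one z (- h)"
        have A: "A \<in> \<A>" using mem[of y g z "- h" 0 0] by (simp add: A_def)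
        have p: "opow B n y = \<gamma> ^ n *\<^sub>C y" "opow B n z = \<gamma> ^ n *\<^sub>C z"
          "g (opow B n v) = \<gamma> ^ n * g v" "h (opow B n v) = \<gamma> ^ n * h v" for n v
          by (induction n) (simp_all add: opow_Suc \<gamma> b)
        define a where "a = 2 * \<gamma> ^ (r + s)"
        have J: "jordan r s A B = rank_one y (a *\<^sub>C g) + rank_one z (- a *\<^sub>C h)"
        proof (rule cblinfun_eqI)
          fix v
          have "jordan r s A B v
              = ((\<gamma> ^ s * g v * \<gamma> ^ r) *\<^sub>C y + (- (\<gamma> ^ s * h v) * \<gamma> ^ r) *\<^sub>C z)
                + ((\<gamma> ^ r * g v * \<gamma> ^ s) *\<^sub>C y + (- (\<gamma> ^ r * h v) * \<gamma> ^ s) *\<^sub>C z)"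
            by (simp add: jordan_def A_def p)
          also have "\<dots> = (\<gamma> ^ s * g v * \<gamma> ^ r + \<gamma> ^ r * g v * \<gamma> ^ s) *\<^sub>C y
              + (- (\<gamma> ^ s * h v) * \<gamma> ^ r + - (\<gamma> ^ r * h v) * \<gamma> ^ s) *\<^sub>C z"
            by (simp only: scaleC_add_left ac_simps)
          also have "\<gamma> ^ s * g v * \<gamma> ^ r + \<gamma> ^ r * g v * \<gamma> ^ s = a * g v"
            by (simp add: a_def power_add)
          also have "- (\<gamma> ^ s * h v) * \<gamma> ^ r + - (\<gamma> ^ r * h v) * \<gamma> ^ s = - a * h v"
            by (simp add: a_def power_add)
          finally show "jordan r s A B v = (rank_one y (a *\<^sub>C g) + rank_one z (- a *\<^sub>C h)) v" by simp
        qed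
        have p1: "peripheral_spectrum (jordan r s A B) = {a, - a}"
          using peripheral_rank_two[OF dim J, of a "- a"] by (simp add: b)
        have p2: "peripheral_spectrum (jordan r s A B) = {2 * f (\<Psi> A x)}"
          using peripheral_jordan_idempotent(1)[OF dim f r s] pres[OF A B(1)] B(2) by simp
        from trans[OF p1[symmetric] p2] have "a \<in> {2 * f (\<Psi> A x)}" "- a \<in> {2 * f (\<Psi> A x)}" by blast+
        then have "a = - a" by (metis singletonD)
        then show False using g0 by (simp add: a_def)
      qed
      then have "B = \<kappa> *\<^sub>C rank_one x f" using \<gamma> by (intro cblinfun_eqI) simp
      then show ?thesis using B by blast
    qed
    \<comment> \<open>\<open>B\<close> occurs \<open>r + s\<close> times in each word, which
      explains the exponent.\<close>
    have "\<Psi> A - \<kappa> ^ (r + s) *\<^sub>C A = 0" if A: "A \<in> \<A>" for A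
    proof (rule zero_of_idempotent_traces)
      fix x and f :: "'a dual" assume f: "f x = 1"
      obtain B where B: "B \<in> \<A>" "\<Psi> B = rank_one x f" "B = \<kappa> *\<^sub>C rank_one x f" using key[OF f] by blast
      have "jordan r s (\<kappa> ^ (r + s) *\<^sub>C A) (rank_one x f) = jordan r s A B"
        unfolding jordan_def B(3) opow_scaleC by (rule cblinfun_eqI) (simp add: power_add mult.commute)
      then have "{2 * f ((\<kappa> ^ (r + s) *\<^sub>C A) x)} = {2 * f (\<Psi> A x)}"
        using peripheral_jordan_idempotent(1)[OF dim f r s] pres[OF A B(1)] B(2) by metis
      then show "f ((\<Psi> A - \<kappa> ^ (r + s) *\<^sub>C A) x) = 0" by simp
    qed
    then show ?thesis by (metis eq_iff_diff_eq_0)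
  qed
  then obtain c where c: "\<And>A. A \<in> \<A> \<Longrightarrow> \<Psi> A = c *\<^sub>C A" by blast
  obtain x :: 'a where "x \<notin> complex_vector.span {}" using not_in_span_of_dim[OF dim, of "{}"] by auto
  then have "x \<noteq> 0" by simp
  then obtain f :: "'a dual" where f: "f x = 1" using separate0 by blast
  have "{2 * c ^ (r + s + 1)} = {2 * 1 ^ (r + s + 1)}"
    using pres[OF mem1[of x f] mem1[of x f]] peripheral_jordan_scaled_idempotent[OF dim f r, of s c]
      peripheral_jordan_scaled_idempotent[OF dim f r, of s 1] c[OF mem1[of x f]] by simp
  then have "c ^ (r + s + 1) = 1" by simp
  then show ?thesis using c by blast
qed

section \<open>From the preserver to a correspondence\<close>

lemma operator_product_Nil [simp]: "operator_product [] = cblinfun_id"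
  by (simp add: operator_product_def)

lemma operator_product_Cons [simp]: "operator_product (T # Ts) = T o\<^sub>C operator_product Ts"
  by (simp add: operator_product_def)

lemma operator_product_append: "operator_product (xs @ ys) = operator_product xs o\<^sub>C operator_product ys"
  by (induction xs) (simp_all add: cblinfun_compose_assoc)

text \<open>Positions count from 0: \<open>p\<close> letters precede the unrepeated one and
  \<open>length idx - 1 - p\<close> follow it.\<close>

lemma generalized_jordan_product_two_operators:
  assumes p: "p < length idx" "\<And>q. q < length idx \<Longrightarrow> q \<noteq> p \<Longrightarrow> idx ! p \<noteq> idx ! q"
  shows "generalized_jordan_product idx (\<lambda>j. if j = idx ! p then A else B) =
    jordan p (length idx - 1 - p) A B"
proof -
  define n where "n = length idx"
  have m: "map (\<lambda>j. if j = idx ! p then A else B) idx = replicate p B @ A # replicate (n - 1 - p) B"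
  proof (rule nth_equalityI)
    fix i assume i: "i < length (map (\<lambda>j. if j = idx ! p then A else B) idx)"
    then have "i \<noteq> p \<Longrightarrow> idx ! i \<noteq> idx ! p" using p(2)[of i] by auto
    with i show "map (\<lambda>j. if j = idx ! p then A else B) idx ! i = (replicate p B @ A # replicate (n - 1 - p) B) ! i"
      using p(1) by (cases i p rule: linorder_cases) (auto simp: nth_append n_def nth_Cons')
  qed (use p(1) in \<open>simp add: n_def\<close>)
  show ?thesis
    unfolding generalized_jordan_product_def rev_map[symmetric] m jordan_def opow_def n_def[symmetric]
    by (simp add: operator_product_append cblinfun_compose_assoc)
qed

lemma opow_jordan_self:
  fixes Q :: "'a::complex_normed_vector \<Rightarrow>\<^sub>B 'a"
  shows "cblinfun_apply (opow (jordan r s Q Q) n) x = 2 ^ n *\<^sub>C cblinfun_apply (opow Q (n * (r + s + 1))) x"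
proof (induction n)
  case (Suc n)
  have J: "jordan r s Q Q y = 2 *\<^sub>C opow Q (r + s + 1) y" for y
  proof -
    have "opow Q r (Q (opow Q s y)) = opow Q (r + s + 1) y" "opow Q s (Q (opow Q r y)) = opow Q (r + s + 1) y"
      using opow_add_apply[of Q r "Suc s" y] opow_add_apply[of Q s "Suc r" y]
      by (simp_all add: opow_Suc add.commute)
    moreover have "2 *\<^sub>C w = w + w" for w :: 'a using scaleC_add_left[of 1 1 w] by simp
    ultimately show ?thesis by (simp add: jordan_def)
  qed
  have e: "Suc n * (r + s + 1) = (r + s + 1) + n * (r + s + 1)" by simp
  have "opow Q (Suc n * (r + s + 1)) x = opow Q (r + s + 1) (opow Q (n * (r + s + 1)) x)"
    unfolding e by (rule opow_add_apply)
  then show ?case by (simp only: opow_Suc cblinfun_compose_apply Suc J cblinfun_apply_scaleC) simp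
qed simp

text \<open>The product of \<open>Q\<close> with itself is \<open>2 Q^(r + s + 1)\<close>; for
  nilpotent \<open>Q\<close> its spectrum could not contain 2.\<close>

lemma nonnilpotent_of_peripheral_jordan:
  assumes "peripheral_spectrum (jordan r s Q Q) = {2}"
  shows "opow Q n \<noteq> 0"
proof
  assume 0: "opow Q n = 0"
  have e: "n * (r + s + 1) = n * (r + s) + n" by simp
  have "opow Q (n * (r + s + 1)) x = 0" for x
    unfolding e opow_add_apply 0 by simp
  then have "opow (jordan r s Q Q) n x = 0" for x by (simp add: opow_jordan_self)
  then have "(cblinfun_apply (jordan r s Q Q) ^^ n) x = 0" for x by (simp flip: opow_funpow)
  moreover have "2 \<in> operator_spectrum (jordan r s Q Q)"
    using assms by (auto simp: peripheral_spectrum_def)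
  ultimately have "(2::complex) = 0" by (rule spectrum_nilpotent)
  then show False by simp
qed

text \<open>The two indexed families serve both directions: \<open>\<beta>\<close> is
  \<open>\<Phi>\<close> for images of idempotents and the identity for preimages, with
  \<open>\<alpha>\<close> the other one.\<close>

lemma trace_functional_of_idempotent:
  fixes \<alpha> :: "'i \<Rightarrow> 'a::complex_normed_vector \<Rightarrow>\<^sub>B 'a" and \<beta> :: "'i \<Rightarrow> 'b::complex_normed_vector \<Rightarrow>\<^sub>B 'b"
  assumes dim1: "complex_dim_ge TYPE('a) 3" and dim2: "complex_dim_ge TYPE('b) 3"
    and s: "s > 0" "s \<le> r" and f: "cblinfun_apply f x = (1 :: complex)"
    and range: "\<And>u1 g1 u2 g2. rank_one u1 g1 + rank_one u2 g2 \<in> \<beta> ` I"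
    and eq: "\<And>i. i \<in> I \<Longrightarrow>
      peripheral_spectrum (jordan r s (\<beta> i) Q) = peripheral_spectrum (jordan r s (\<alpha> i) (rank_one x f))"
    and Q: "peripheral_spectrum (jordan r s Q Q) = {2}"
  shows "\<exists>u g. cblinfun_apply g u \<noteq> (0 :: complex) \<and> (\<forall>i\<in>I. f (\<alpha> i x) = g (cblinfun_apply (\<beta> i) u))"
proof -
  have r: "r > 0" using s by simp
  have t: "peripheral_spectrum (jordan r s (\<beta> i) Q) = {2 * f (\<alpha> i x)}" if "i \<in> I" for i
    using eq[OF that] peripheral_jordan_idempotent(1)[OF dim1 f r s(1)] by simp
  have "subsingleton (peripheral_spectrum (jordan r s (rank_one u1 g1 + rank_one u2 g2) Q))" for u1 g1 u2 g2
  proof -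
    obtain i where "i \<in> I" "rank_one u1 g1 + rank_one u2 g2 = \<beta> i" using range by blast
    then show ?thesis using t[of i] by (simp add: subsingleton_def)
  qed
  from jordan_singleton_imp_trace_functional[OF dim2 s this nonnilpotent_of_peripheral_jordan[OF Q]]
  obtain u g where ug: "cblinfun_apply g u \<noteq> (0 :: complex)"
    "\<And>A t. peripheral_spectrum (jordan r s A Q) = {t} \<Longrightarrow> t = 2 * g (cblinfun_apply A u)" by blast
  have "f (\<alpha> i x) = g (\<beta> i u)" if "i \<in> I" for i using ug(2)[OF t[OF that]] by simp
  then show ?thesis using ug(1) by blast
qed

text \<open>For \<open>s = 0\<close> singleton spectra recognise the nilpotents in both directions.
  For \<open>s > 0\<close> they recognise trace functionals of rank-one tensors with nonzero trace,
  and the nilpotents are recovered as differences.\<close>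

lemma preserver_correspondence:
  fixes \<A> :: "('a::complex_normed_vector \<Rightarrow>\<^sub>B 'a) set" and \<Phi> :: "('a \<Rightarrow>\<^sub>B 'a) \<Rightarrow> 'b::complex_normed_vector \<Rightarrow>\<^sub>B 'b"
  assumes dim1: "complex_dim_ge TYPE('a) 3" and dim2: "complex_dim_ge TYPE('b) 3"
    and r: "r > 0" "s \<le> r"
    and mem: "\<And>u1 g1 u2 g2 u3 g3. rank_one u1 g1 + rank_one u2 g2 + rank_one u3 g3 \<in> \<A>"
    and range: "\<And>u1 g1 u2 g2. rank_one u1 g1 + rank_one u2 g2 \<in> \<Phi> ` \<A>"
    and pres: "\<And>A B. A \<in> \<A> \<Longrightarrow> B \<in> \<A> \<Longrightarrow>
      peripheral_spectrum (jordan r s (\<Phi> A) (\<Phi> B)) = peripheral_spectrum (jordan r s A B)"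
  defines "\<theta>1 \<equiv> (\<lambda>A. if s = 0 then opow A r else A)" and "\<theta>2 \<equiv> (\<lambda>A. if s = 0 then opow (\<Phi> A) r else \<Phi> A)"
  shows "covers_idempotents \<A> \<theta>1" and "covers_idempotents \<A> \<theta>2"
    and "nilpotents_correspond \<A> \<theta>1 \<theta>2" and "nilpotents_correspond \<A> \<theta>2 \<theta>1"
proof -
  have mem1: "rank_one x f \<in> \<A>" for x f using mem[of x f 0 0 0 0] by simp
  have mem2: "rank_one u1 g1 + rank_one u2 g2 \<in> \<A>" for u1 g1 u2 g2 using mem[of u1 g1 u2 g2 0 0] by simp
  have range1: "\<exists>A\<in>\<A>. \<Phi> A = rank_one u g" for u g using range[of u g 0 0] by auto
  show cov1: "covers_idempotents \<A> \<theta>1"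
    unfolding covers_idempotents_def \<theta>1_def using mem1 opow_rank_one r(1) by metis
  show cov2: "covers_idempotents \<A> \<theta>2"
    unfolding covers_idempotents_def \<theta>2_def using range1 opow_rank_one r(1) by metis
  have "nilpotents_correspond \<A> \<theta>1 \<theta>2 \<and> nilpotents_correspond \<A> \<theta>2 \<theta>1"
  proof (cases "s = 0")
    case s: True
    have te: "trace_equiv \<A> \<theta>1 \<theta>2 x f u g"
      if N: "rank_one x f \<in> \<A>" "\<Phi> (rank_one x f) = rank_one u g" "f x = 0" "g u = 0"
      for x u and f :: "'a dual" and g :: "'b dual"
      unfolding trace_equiv_def
    proof
      fix A assume A: "A \<in> \<A>"
      have "{f (opow A r x)} = {g (opow (\<Phi> A) r u)}"
        using pres[OF N(1) A] peripheral_jordan_nilpotent[OF dim1 N(3)] peripheral_jordan_nilpotent[OF dim2 N(4)]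
        by (simp add: s N(2))
      then show "f (\<theta>1 A x) = g (\<theta>2 A u)" by (simp add: \<theta>1_def \<theta>2_def s)
    qed
    show ?thesis
      unfolding nilpotents_correspond_def
    proof (intro conjI allI impI; elim conjE)
      fix x :: 'a and f :: "'a dual" assume xf: "x \<noteq> 0" "f \<noteq> 0" "f x = 0"
      have "subsingleton (peripheral_spectrum (jordan r 0 (\<Phi> (rank_one x f)) (rank_one u1 g1 + rank_one u2 g2)))" for u1 g1 u2 g2
      proof -
        obtain B where B: "B \<in> \<A>" "rank_one u1 g1 + rank_one u2 g2 = \<Phi> B" using range by blast
        show ?thesis
          using pres[OF mem1[of x f] B(1)] peripheral_jordan_nilpotent[OF dim1 xf(3)] by (simp add: s B(2) subsingleton_def)
      qed
      from jordan_singleton_imp_nilpotent_rank_one[OF dim2 r(1) this]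
      obtain u g where ug: "cblinfun_apply g u = (0 :: complex)" "\<Phi> (rank_one x f) = rank_one u g" by blast
      have "trace_equiv \<A> \<theta>1 \<theta>2 x f u g" using te[OF mem1 ug(2) xf(3) ug(1)] .
      then show "\<exists>u g. u \<noteq> 0 \<and> g \<noteq> 0 \<and> cblinfun_apply g u = (0 :: complex) \<and> trace_equiv \<A> \<theta>1 \<theta>2 x f u g"
        using trace_equiv_nonzero[OF _ cov1 xf(1,2)] ug(1) by blast
    next
      fix u :: 'b and g :: "'b dual" assume ug: "u \<noteq> 0" "g \<noteq> 0" "g u = 0"
      obtain N where N: "N \<in> \<A>" "\<Phi> N = rank_one u g" using range1 by blast
      have "subsingleton (peripheral_spectrum (jordan r 0 N (rank_one u1 g1 + rank_one u2 g2)))" for u1 g1 u2 g2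
        unfolding pres[OF N(1) mem2, symmetric, unfolded s] N(2) peripheral_jordan_nilpotent[OF dim2 ug(3)]
        by (simp add: subsingleton_def)
      from jordan_singleton_imp_nilpotent_rank_one[OF dim1 r(1) this]
      obtain x f where xf: "cblinfun_apply f x = (0 :: complex)" "N = rank_one x f" by blast
      have t: "trace_equiv \<A> \<theta>1 \<theta>2 x f u g" using te[OF _ _ xf(1) ug(3)] N xf(2) by simp
      then have t': "trace_equiv \<A> \<theta>2 \<theta>1 u g x f" using trace_equiv_commute by blast
      then show "\<exists>x f. x \<noteq> 0 \<and> f \<noteq> 0 \<and> cblinfun_apply f x = (0 :: complex) \<and> trace_equiv \<A> \<theta>2 \<theta>1 u g x f"
        using trace_equiv_nonzero[OF t' cov2 ug(1,2)] xf(1) by blast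
    qed
  next
    case False
    then have s: "s > 0" by simp
    have \<theta>: "\<theta>1 A = A" "\<theta>2 A = \<Phi> A" for A using s by (simp_all add: \<theta>1_def \<theta>2_def)
    have fwd: "\<exists>u g. cblinfun_apply g u \<noteq> (0 :: complex) \<and> trace_equiv \<A> \<theta>1 \<theta>2 x f u g" if fx: "f x \<noteq> 0"
      for x and f :: "'a dual"
    proof -
      define y where "y = inverse (f x) *\<^sub>C x"
      have f1: "f y = 1" and x: "x = f x *\<^sub>C y" using fx by (simp_all add: y_def)
      have "peripheral_spectrum (jordan r s (\<Phi> (rank_one y f)) (\<Phi> (rank_one y f))) = {2}"
        using pres[OF mem1 mem1, of y f y f] peripheral_jordan_idempotent(1)[OF dim1 f1 r(1) s] f1 by simp
      from trace_functional_of_idempotent[OF dim1 dim2 s r(2) f1 range pres[OF _ mem1] this]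
      obtain u g where ug: "cblinfun_apply g u \<noteq> (0 :: complex)" "\<And>A. A \<in> \<A> \<Longrightarrow> f (A y) = g (\<Phi> A u)" by blast
      have "f (A x) = f x * f (A y)" for A :: "'a \<Rightarrow>\<^sub>B 'a" using fx by (simp add: y_def)
      then have "trace_equiv \<A> \<theta>1 \<theta>2 x f u (f x *\<^sub>C g)" using ug(2) by (simp add: trace_equiv_def \<theta>)
      moreover have "(f x *\<^sub>C g) u \<noteq> 0" using fx ug(1) by simp
      ultimately show ?thesis by blast
    qed
    have bwd: "\<exists>x f. cblinfun_apply f x \<noteq> (0 :: complex) \<and> trace_equiv \<A> \<theta>1 \<theta>2 x f u g" if gu: "g u \<noteq> 0"
      for u and g :: "'b dual"
    proof -
      define v where "v = inverse (g u) *\<^sub>C u"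
      have g1: "g v = 1" using gu by (simp add: v_def)
      obtain Q where Q: "Q \<in> \<A>" "\<Phi> Q = rank_one v g" using range1 by blast
      have Q2: "peripheral_spectrum (jordan r s Q Q) = {2}"
        using pres[OF Q(1) Q(1)] peripheral_jordan_idempotent(1)[OF dim2 g1 r(1) s] g1 by (simp add: Q(2))
      have im: "rank_one u1 g1 + rank_one u2 g2 \<in> (\<lambda>A. A) ` \<A>" for u1 g1 u2 g2 using mem2 by simp
      have "peripheral_spectrum (jordan r s A Q) = peripheral_spectrum (jordan r s (\<Phi> A) (rank_one v g))"
        if "A \<in> \<A>" for A using pres[OF that Q(1)] Q(2) by simp
      from trace_functional_of_idempotent[OF dim2 dim1 s r(2) g1 im this Q2]
      obtain x f where xf: "cblinfun_apply f x \<noteq> (0 :: complex)" "\<And>A. A \<in> \<A> \<Longrightarrow> g (\<Phi> A v) = f (A x)" by blast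
      have "g (B u) = g u * g (B v)" for B :: "'b \<Rightarrow>\<^sub>B 'b" using gu by (simp add: v_def)
      then have "trace_equiv \<A> \<theta>1 \<theta>2 x (g u *\<^sub>C f) u g" using xf(2) by (simp add: trace_equiv_def \<theta>)
      moreover have "(g u *\<^sub>C f) x \<noteq> 0" using gu xf(1) by simp
      ultimately show ?thesis by blast
    qed
    have bwd': "\<exists>x f. cblinfun_apply f x \<noteq> (0 :: complex) \<and> trace_equiv \<A> \<theta>2 \<theta>1 u g x f" if "g u \<noteq> 0"
      for u and g :: "'b dual" using bwd[OF that] trace_equiv_commute by blast
    have fwd': "\<exists>u g. cblinfun_apply g u \<noteq> (0 :: complex) \<and> trace_equiv \<A> \<theta>2 \<theta>1 u g x f" if "f x \<noteq> 0"
      for x and f :: "'a dual" using fwd[OF that] trace_equiv_commute by blast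
    show ?thesis
      using nilpotent_correspondence_of_idempotents[OF cov1 cov2 fwd bwd]
        nilpotent_correspondence_of_idempotents[OF cov2 cov1 bwd' fwd'] by blast
  qed
  then show "nilpotents_correspond \<A> \<theta>1 \<theta>2" "nilpotents_correspond \<A> \<theta>2 \<theta>1" by auto
qed

section \<open>Similarities and adjoints\<close>

lemma is_inverse_operatorD:
  assumes "is_inverse_operator T S"
  shows "cblinfun_apply T (cblinfun_apply S x) = x" "cblinfun_apply S (cblinfun_apply T y) = y"
  using assms unfolding is_inverse_operator_def by (metis cblinfun_compose_apply cblinfun_id_apply)+

lemma is_inverse_operator_sym: "is_inverse_operator T S \<Longrightarrow> is_inverse_operator S T"
  by (simp add: is_inverse_operator_def)

lemma opow_similar:
  assumes "is_inverse_operator T S"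
  shows "opow (T o\<^sub>C A o\<^sub>C S) n = T o\<^sub>C opow A n o\<^sub>C S"
  by (induction n) (auto simp: opow_Suc is_inverse_operatorD[OF assms] intro!: cblinfun_eqI)

lemma jordan_similar:
  assumes "is_inverse_operator T S"
  shows "jordan r s (T o\<^sub>C A o\<^sub>C S) (T o\<^sub>C B o\<^sub>C S) = T o\<^sub>C jordan r s A B o\<^sub>C S"
  unfolding jordan_def opow_similar[OF assms]
  by (rule cblinfun_eqI) (simp add: is_inverse_operatorD[OF assms])

section \<open>Adjoints and reflexivity\<close>

declare adjoint_operator_apply [simp]

lemma adjoint_compose: "adjoint_operator (A o\<^sub>C B) = adjoint_operator B o\<^sub>C adjoint_operator A"
  by (intro cblinfun_eqI) simp

lemma adjoint_add: "adjoint_operator (A + B) = adjoint_operator A + adjoint_operator B"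
  by (intro cblinfun_eqI) simp

lemma adjoint_diff: "adjoint_operator (A - B) = adjoint_operator A - adjoint_operator B"
  by (intro cblinfun_eqI) simp

lemma adjoint_scaleC: "adjoint_operator (c *\<^sub>C A) = c *\<^sub>C adjoint_operator A"
  by (intro cblinfun_eqI) simp

lemma adjoint_id: "adjoint_operator cblinfun_id = cblinfun_id"
  by (intro cblinfun_eqI) simp

lemma opow_Suc': "opow B (Suc n) = opow B n o\<^sub>C B"
  by (rule cblinfun_eqI) (metis One_nat_def Suc_eq_plus1 cblinfun_compose_apply cblinfun_compose_id(1) opow_0 opow_Suc opow_add_apply)

lemma adjoint_opow: "adjoint_operator (opow A n) = opow (adjoint_operator A) n"
  by (induction n) (simp_all add: adjoint_id opow_Suc' adjoint_compose, simp add: opow_Suc' flip: opow_Suc)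

lemma adjoint_jordan: "adjoint_operator (jordan r s A B) = jordan r s (adjoint_operator A) (adjoint_operator B)"
  unfolding jordan_def
  by (simp add: adjoint_add adjoint_compose adjoint_opow cblinfun_compose_assoc add.commute)

text \<open>On a reflexive space an inverse \<open>B\<close> of the adjoint has a predual:
  \<open>canonical_embedding x\<close> composed with \<open>B\<close> is evaluation at some
  \<open>C x\<close>. The map \<open>C\<close> is weakly bounded, hence bounded, and inverts
  \<open>A\<close>.\<close>

lemma invertible_adjoint_iff:
  fixes A :: "'a::complex_banach \<Rightarrow>\<^sub>B 'a"
  assumes refl: "reflexive_space TYPE('a)"
  shows "invertible_operator (adjoint_operator A) \<longleftrightarrow> invertible_operator A"
proof
  assume "invertible_operator A"
  then obtain B where B: "is_inverse_operator A B" unfolding invertible_operator_def by blast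
  have "A o\<^sub>C B = cblinfun_id" "B o\<^sub>C A = cblinfun_id" using B by (simp_all add: is_inverse_operator_def)
  then have "adjoint_operator B o\<^sub>C adjoint_operator A = cblinfun_id"
    "adjoint_operator A o\<^sub>C adjoint_operator B = cblinfun_id"
    by (simp_all flip: adjoint_compose add: adjoint_id)
  then show "invertible_operator (adjoint_operator A)"
    unfolding invertible_operator_def is_inverse_operator_def by blast
next
  assume "invertible_operator (adjoint_operator A)"
  then obtain B where B: "is_inverse_operator (adjoint_operator A) B" unfolding invertible_operator_def by blast
  have AB: "B f o\<^sub>C A = f" "B (f o\<^sub>C A) = f" for f :: "'a dual"
    using is_inverse_operatorD[OF B] by (metis adjoint_operator_apply)+
  have "\<exists>y. \<forall>f :: 'a dual. cblinfun_apply f y = B f x" for x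
  proof -
    obtain y where y: "canonical_embedding y = canonical_embedding x o\<^sub>C B"
      using refl unfolding reflexive_space_def by (metis surjD)
    have "f y = B f x" for f :: "'a dual"
      using cblinfun_cong[OF y, of f] by simp
    then show ?thesis by blast
  qed
  then obtain C where C: "\<And>x f. cblinfun_apply f (C x) = cblinfun_apply (B f) x" by metis
  have Cadd: "C (x + y) = C x + C y" for x y by (rule dual_separates) (simp add: C)
  have Cscale: "C (c *\<^sub>C x) = c *\<^sub>C C x" for c x by (rule dual_separates) (simp add: C)
  obtain M where M: "\<And>x. norm (C x) \<le> norm x * M"
  proof -
    have "\<exists>K. \<forall>x. norm (f (C x)) \<le> K * norm x" for f :: "'a dual"
      using norm_cblinfun_apply[of "B f"] by (auto simp: C)
    then show ?thesis using bounded_of_weakly_bounded[of C, OF Cscale] that by blast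
  qed
  have C': "cblinfun_of_fun C x = C x" for x
    by (simp add: cblinfun_of_fun_apply[OF Cadd Cscale M])
  show "invertible_operator A"
  proof (rule invertible_operatorI[of _ "cblinfun_of_fun C"])
    fix x
    show "A (cblinfun_of_fun C x) = x"
    proof (rule dual_separates)
      fix f :: "'a dual"
      have "f (A (C x)) = (f o\<^sub>C A) (C x)" by simp
      also have "\<dots> = f x" by (simp only: C AB)
      finally show "f (A (cblinfun_of_fun C x)) = f x" by (simp add: C')
    qed
    show "cblinfun_of_fun C (A x) = x"
    proof (rule dual_separates)
      fix f :: "'a dual"
      have "f (C (A x)) = (B f o\<^sub>C A) x" by (simp add: C)
      also have "\<dots> = f x" by (simp only: AB)
      finally show "f (cblinfun_of_fun C (A x)) = f x" by (simp add: C')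
    qed
  qed
qed

lemma spectrum_adjoint:
  fixes A :: "'a::complex_banach \<Rightarrow>\<^sub>B 'a"
  assumes "reflexive_space TYPE('a)"
  shows "operator_spectrum (adjoint_operator A) = operator_spectrum A"
  unfolding operator_spectrum_def invertible_adjoint_iff[OF assms, symmetric]
  by (simp add: adjoint_diff adjoint_scaleC adjoint_id)

section \<open>Generalized Jordan products under similarities and adjoints\<close>

lemma operator_product_similar:
  assumes "is_inverse_operator T S"
  shows "operator_product (map (\<lambda>j. c *\<^sub>C (T o\<^sub>C A j o\<^sub>C S)) is)
    = c ^ length is *\<^sub>C (T o\<^sub>C operator_product (map A is) o\<^sub>C S)"
  by (induction "is") (auto simp: is_inverse_operatorD[OF assms] intro!: cblinfun_eqI)

lemma generalized_jordan_product_similar: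
  assumes "is_inverse_operator T S" "c ^ length is = 1"
  shows "generalized_jordan_product is (\<lambda>j. c *\<^sub>C (T o\<^sub>C A j o\<^sub>C S)) = T o\<^sub>C generalized_jordan_product is A o\<^sub>C S"
  unfolding generalized_jordan_product_def operator_product_similar[OF assms(1)] length_rev assms(2)
  by (rule cblinfun_eqI) simp

lemma operator_product_adjoint:
  "operator_product (map (\<lambda>j. adjoint_operator (A j)) is) = adjoint_operator (operator_product (map A (rev is)))"
  by (induction "is") (simp_all add: adjoint_id operator_product_append adjoint_compose)

lemma generalized_jordan_product_adjoint:
  "generalized_jordan_product is (\<lambda>j. adjoint_operator (A j)) = adjoint_operator (generalized_jordan_product is A)"
  unfolding generalized_jordan_product_def operator_product_adjoint
  by (simp add: adjoint_add add.commute)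

lemma generalized_jordan_product_cong:
  "(\<And>j. j \<in> set is \<Longrightarrow> A j = B j) \<Longrightarrow> generalized_jordan_product is A = generalized_jordan_product is B"
  unfolding generalized_jordan_product_def
  by (metis (mono_tags, lifting) map_cong set_rev)

section \<open>The characterisation\<close>

text \<open>Both alternatives are brought back to the first space by
  \<open>A \<mapsto> R (\<Phi> A) U\<close> or by \<open>W\<close>, the adjoint of
  \<open>\<Phi> A\<close>, and \<open>U\<close>. The adjoint reverses products, but the Jordan
  product is symmetric under reversal.\<close>

theorem jordan_preserver_form:
  fixes \<A> :: "('a::complex_banach \<Rightarrow>\<^sub>B 'a) set" and \<Phi> :: "('a \<Rightarrow>\<^sub>B 'a) \<Rightarrow> 'b::complex_banach \<Rightarrow>\<^sub>B 'b"
  assumes dim1: "complex_dim_ge TYPE('a) 3" and dim2: "complex_dim_ge TYPE('b) 3"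
    and r: "r > 0" "s \<le> r"
    and mem: "\<And>u1 g1 u2 g2 u3 g3. rank_one u1 g1 + rank_one u2 g2 + rank_one u3 g3 \<in> \<A>"
    and range: "\<And>u1 g1 u2 g2. rank_one u1 g1 + rank_one u2 g2 \<in> \<Phi> ` \<A>"
    and pres_all: "\<forall>A\<in>\<A>. \<forall>B\<in>\<A>.
      peripheral_spectrum (jordan r s (\<Phi> A) (\<Phi> B)) = peripheral_spectrum (jordan r s A B)"
  shows "(\<exists>(c::complex) (T :: 'a \<Rightarrow>\<^sub>B 'b) S. c ^ (r + s + 1) = 1 \<and> is_inverse_operator T S \<and>
      (\<forall>A\<in>\<A>. \<Phi> A = c *\<^sub>C (T o\<^sub>C A o\<^sub>C S)))
    \<or> (reflexive_space TYPE('a) \<and> reflexive_space TYPE('b) \<and>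
      (\<exists>(c::complex) (T :: 'a dual \<Rightarrow>\<^sub>B 'b) S. c ^ (r + s + 1) = 1 \<and> is_inverse_operator T S \<and>
        (\<forall>A\<in>\<A>. \<Phi> A = c *\<^sub>C (T o\<^sub>C adjoint_operator A o\<^sub>C S))))"
proof -
  have pres: "peripheral_spectrum (jordan r s (\<Phi> A) (\<Phi> B)) = peripheral_spectrum (jordan r s A B)"
    if "A \<in> \<A>" "B \<in> \<A>" for A B using pres_all that by blast
  define \<theta>1 where "\<theta>1 = (\<lambda>A :: 'a \<Rightarrow>\<^sub>B 'a. if s = 0 then opow A r else A)"
  define \<theta>2 where "\<theta>2 = (\<lambda>A :: 'a \<Rightarrow>\<^sub>B 'a. if s = 0 then opow (\<Phi> A) r else \<Phi> A)"
  have corr: "covers_idempotents \<A> \<theta>1" "covers_idempotents \<A> \<theta>2"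
      "nilpotents_correspond \<A> \<theta>1 \<theta>2" "nilpotents_correspond \<A> \<theta>2 \<theta>1"
    unfolding \<theta>1_def \<theta>2_def by (rule preserver_correspondence[OF dim1 dim2 r mem range pres]; assumption)+
  have range1: "\<exists>A\<in>\<A>. \<Phi> A = rank_one u g" for u g using range[of u g 0 0] by auto
  from trace_equiv_structure[OF dim1 corr] show ?thesis
  proof (elim disjE exE conjE)
    fix S :: "'a dual \<Rightarrow> 'b dual" and T :: "'a \<Rightarrow> 'b dual dual"
    assume "\<forall>f g. S (f + g) = S f + S g" "\<forall>c f. S (c *\<^sub>C f) = c *\<^sub>C S f"
      "\<forall>x y. T (x + y) = T x + T y" "\<forall>c x. T (c *\<^sub>C x) = c *\<^sub>C T x"
      "\<forall>x f u g v h. cblinfun_apply f x = 0 \<longrightarrow> trace_equiv \<A> \<theta>1 \<theta>2 x f u g \<longrightarrow>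
        cblinfun_apply g v * cblinfun_apply h u = cblinfun_apply (S f) v * cblinfun_apply (T x) h"
    note ST = this[rule_format]
    from correspondence_operator[OF dim1 dim2 corr(3,4) ST]
    obtain U :: "'a \<Rightarrow>\<^sub>B 'b" and R \<kappa> where
      U: "is_inverse_operator U R" "\<kappa> \<noteq> 0" "\<And>A x f. A \<in> \<A> \<Longrightarrow> cblinfun_apply f x = (0 :: complex) \<Longrightarrow>
        f (\<theta>1 A x) = \<kappa> * f (R (\<theta>2 A (U x)))"
      by blast
    have RU: "is_inverse_operator R U" using U(1) by (rule is_inverse_operator_sym)
    have "\<exists>c. c ^ (r + s + 1) = 1 \<and> (\<forall>A\<in>\<A>. R o\<^sub>C \<Phi> A o\<^sub>C U = c *\<^sub>C A)"
    proof (rule jordan_preserver_scalar[OF dim1 r(1) mem])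
      show "peripheral_spectrum (jordan r s (R o\<^sub>C \<Phi> A o\<^sub>C U) (R o\<^sub>C \<Phi> B o\<^sub>C U)) = peripheral_spectrum (jordan r s A B)"
        if "A \<in> \<A>" "B \<in> \<A>" for A B
        unfolding jordan_similar[OF RU] pres[OF that, symmetric]
        by (rule peripheral_spectrum_cong, rule spectrum_similar[OF RU])
      show "\<exists>B\<in>\<A>. R o\<^sub>C \<Phi> B o\<^sub>C U = rank_one x f" if "cblinfun_apply f x = (1 :: complex)" for x f
      proof -
        obtain B where "B \<in> \<A>" "\<Phi> B = rank_one (U x) (f o\<^sub>C R)" using range1 by blast
        then show ?thesis by (intro bexI[of _ B] cblinfun_eqI) (simp_all add: is_inverse_operatorD[OF RU])
      qed
      show "if s = 0 then f (opow A r x) = \<kappa> * f (opow (R o\<^sub>C \<Phi> A o\<^sub>C U) r x) else f (A x) = \<kappa> * f ((R o\<^sub>C \<Phi> A o\<^sub>C U) x)"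
        if "A \<in> \<A>" "cblinfun_apply f x = (0 :: complex)" for A x f
        by (cases "s = 0") (use U(3)[OF that] in \<open>simp_all add: \<theta>1_def \<theta>2_def opow_similar[OF RU]\<close>)
    qed (rule U(2))
    then obtain c where c: "c ^ (r + s + 1) = 1" "\<And>A. A \<in> \<A> \<Longrightarrow> R o\<^sub>C \<Phi> A o\<^sub>C U = c *\<^sub>C A" by blast
    have "\<Phi> A = c *\<^sub>C (U o\<^sub>C A o\<^sub>C R)" if "A \<in> \<A>" for A
    proof (rule cblinfun_eqI)
      fix w
      have "R (\<Phi> A w) = c *\<^sub>C A (R w)"
        using cblinfun_cong[OF c(2)[OF that], of "R w"] by (simp add: is_inverse_operatorD[OF RU])
      then have "U (R (\<Phi> A w)) = U (c *\<^sub>C A (R w))" by (rule arg_cong)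
      then show "\<Phi> A w = (c *\<^sub>C (U o\<^sub>C A o\<^sub>C R)) w" by (simp add: is_inverse_operatorD[OF RU])
    qed
    then show ?thesis using c(1) U(1) by blast
  next
    fix S :: "'a dual \<Rightarrow> 'b dual dual" and T :: "'a \<Rightarrow> 'b dual"
    assume "\<forall>f g. S (f + g) = S f + S g" "\<forall>c f. S (c *\<^sub>C f) = c *\<^sub>C S f"
      "\<forall>x y. T (x + y) = T x + T y" "\<forall>c x. T (c *\<^sub>C x) = c *\<^sub>C T x"
      "\<forall>x f u g v h. cblinfun_apply f x = 0 \<longrightarrow> trace_equiv \<A> \<theta>1 \<theta>2 x f u g \<longrightarrow>
        cblinfun_apply g v * cblinfun_apply h u = cblinfun_apply (S f) h * cblinfun_apply (T x) v"
    note ST = this[rule_format]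
    from correspondence_adjoint[OF dim1 dim2 corr(3,4) ST]
    obtain V :: "'a dual \<Rightarrow>\<^sub>B 'b" and R and U :: "'a \<Rightarrow>\<^sub>B 'b dual" and W \<kappa> where
      refl: "reflexive_space TYPE('a)" "reflexive_space TYPE('b)" and
      VR: "is_inverse_operator V R" and UW: "is_inverse_operator U W" and \<kappa>: "\<kappa> \<noteq> 0" and
      UV: "\<And>x f. U x (V f) = \<kappa> * cblinfun_apply f x" and
      tr: "\<And>A x f. A \<in> \<A> \<Longrightarrow> cblinfun_apply f x = 0 \<Longrightarrow> f (\<theta>1 A x) = \<kappa> * f (W (U x o\<^sub>C \<theta>2 A))"
      by blast
    have WU: "is_inverse_operator W U" using UW by (rule is_inverse_operator_sym)
    have "\<exists>c. c ^ (r + s + 1) = 1 \<and> (\<forall>A\<in>\<A>. W o\<^sub>C adjoint_operator (\<Phi> A) o\<^sub>C U = c *\<^sub>C A)"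
    proof (rule jordan_preserver_scalar[OF dim1 r(1) mem])
      show "peripheral_spectrum (jordan r s (W o\<^sub>C adjoint_operator (\<Phi> A) o\<^sub>C U) (W o\<^sub>C adjoint_operator (\<Phi> B) o\<^sub>C U))
          = peripheral_spectrum (jordan r s A B)"
        if "A \<in> \<A>" "B \<in> \<A>" for A B
        unfolding jordan_similar[OF WU] pres[OF that, symmetric]
        by (rule peripheral_spectrum_cong)
          (simp add: spectrum_similar[OF WU] spectrum_adjoint[OF refl(2)] flip: adjoint_jordan)
      show "\<exists>B\<in>\<A>. W o\<^sub>C adjoint_operator (\<Phi> B) o\<^sub>C U = rank_one x f" if "cblinfun_apply f x = (1 :: complex)" for x f
      proof -
        \<comment> \<open>Chosen so that its adjoint becomes \<open>x \<otimes> f\<close> under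
          \<open>W\<close> and \<open>U\<close>; the inverse of \<open>\<kappa>\<close> cancels the
          factor in \<open>UV\<close>.\<close>
        obtain B where B: "B \<in> \<A>" "\<Phi> B = rank_one (inverse \<kappa> *\<^sub>C V f) (U x)" using range1 by blast
        have "U y o\<^sub>C rank_one (inverse \<kappa> *\<^sub>C V f) (U x) = f y *\<^sub>C U x" for y
          using \<kappa> by (intro cblinfun_eqI) (simp add: UV mult.commute)
        then show ?thesis using B by (intro bexI[of _ B] cblinfun_eqI) (simp_all add: is_inverse_operatorD[OF WU])
      qed
      show "if s = 0 then f (opow A r x) = \<kappa> * f (opow (W o\<^sub>C adjoint_operator (\<Phi> A) o\<^sub>C U) r x)
          else f (A x) = \<kappa> * f ((W o\<^sub>C adjoint_operator (\<Phi> A) o\<^sub>C U) x)"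
        if "A \<in> \<A>" "cblinfun_apply f x = (0 :: complex)" for A x f
        by (cases "s = 0")
          (use tr[OF that] in \<open>simp_all add: \<theta>1_def \<theta>2_def opow_similar[OF WU] flip: adjoint_opow\<close>)
    qed (rule \<kappa>)
    then obtain c where c: "c ^ (r + s + 1) = 1" "\<And>A. A \<in> \<A> \<Longrightarrow> W o\<^sub>C adjoint_operator (\<Phi> A) o\<^sub>C U = c *\<^sub>C A" by blast
    have "\<Phi> A = c *\<^sub>C (V o\<^sub>C adjoint_operator A o\<^sub>C R)" if "A \<in> \<A>" for A
    proof (rule cblinfun_eqI)
      fix w
      define f where "f = R w"
      have w: "w = V f" by (simp add: f_def is_inverse_operatorD[OF VR])
      show "\<Phi> A w = (c *\<^sub>C (V o\<^sub>C adjoint_operator A o\<^sub>C R)) w"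
      proof (rule dual_separates)
        fix g :: "'b dual"
        define x where "x = W g"
        have g: "g = U x" by (simp add: x_def is_inverse_operatorD[OF UW])
        have "W (U x o\<^sub>C \<Phi> A) = c *\<^sub>C A x" using cblinfun_cong[OF c(2)[OF that], of x] by simp
        then have "U (W (U x o\<^sub>C \<Phi> A)) = U (c *\<^sub>C A x)" by (rule arg_cong)
        then have "U x o\<^sub>C \<Phi> A = c *\<^sub>C U (A x)" by (simp add: is_inverse_operatorD[OF UW])
        from cblinfun_cong[OF this, of "V f"] have "g (\<Phi> A w) = c * (\<kappa> * f (A x))"
          by (simp add: g w UV)
        also have "\<dots> = g ((c *\<^sub>C (V o\<^sub>C adjoint_operator A o\<^sub>C R)) w)"
          by (simp add: g f_def[symmetric] UV)
        finally show "g (\<Phi> A w) = g ((c *\<^sub>C (V o\<^sub>C adjoint_operator A o\<^sub>C R)) w)" .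
      qed
    qed
    then show ?thesis using c(1) VR refl by blast
  qed
qed

lemma rank_one_sum_finite_rank:
  assumes "A = rank_one u1 g1 + rank_one u2 g2 + rank_one u3 g3"
  shows "finite_rank A" "operator_rank A \<le> 3"
proof -
  have sub: "range A \<subseteq> complex_vector.span {u1, u2, u3}"
    unfolding assms
    by (auto intro!: complex_vector.span_add complex_vector.span_scale intro: complex_vector.span_base)
  then show "finite_rank A" unfolding finite_rank_def by (intro exI[of _ "{u1, u2, u3}"]) simp
  have "operator_rank A \<le> card {u1, u2, u3}"
    unfolding operator_rank_def by (rule complex_vector.dim_le_card[OF sub]) simp
  also have "\<dots> \<le> 3" by (simp add: card_insert_if)
  finally show "operator_rank A \<le> 3" .
qed

theorem theorem1p2:
  fixes \<A>\<^sub>1 :: "('a::complex_banach \<Rightarrow>\<^sub>B 'a) set"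
    and \<A>\<^sub>2 :: "('b::complex_banach \<Rightarrow>\<^sub>B 'b) set"
    and k :: nat
    and idx :: "nat list"
    and \<Phi> :: "('a \<Rightarrow>\<^sub>B 'a) \<Rightarrow> ('b \<Rightarrow>\<^sub>B 'b)"
  assumes "complex_dim_ge TYPE('a) 3"
    and "complex_dim_ge TYPE('b) 3"
    and "standard_operator_algebra \<A>\<^sub>1"
    and "standard_operator_algebra \<A>\<^sub>2"
    and "k \<ge> 2"
    and "set idx = {1..k}"
    and "\<exists>p<length idx. \<forall>q<length idx. q \<noteq> p \<longrightarrow> idx ! p \<noteq> idx ! q"
    and "\<Phi> ` \<A>\<^sub>1 \<subseteq> \<A>\<^sub>2"
    and "{B \<in> \<A>\<^sub>2. finite_rank B \<and> operator_rank B \<le> 3} \<subseteq> \<Phi> ` \<A>\<^sub>1"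
  shows "(\<forall>A :: nat \<Rightarrow> 'a \<Rightarrow>\<^sub>B 'a. (\<forall>j\<in>{1..k}. A j \<in> \<A>\<^sub>1) \<longrightarrow>
            peripheral_spectrum (generalized_jordan_product idx (\<lambda>j. \<Phi> (A j))) =
            peripheral_spectrum (generalized_jordan_product idx A))
    \<longleftrightarrow>
      (\<exists>(c::complex) (T :: 'a \<Rightarrow>\<^sub>B 'b). c ^ length idx = 1 \<and> invertible_operator T \<and>
          (\<forall>A\<in>\<A>\<^sub>1. \<Phi> A = c *\<^sub>C (T o\<^sub>C A o\<^sub>C inverse_operator T)))
    \<or> (reflexive_space TYPE('a) \<and> reflexive_space TYPE('b) \<and>
        (\<exists>(c::complex) (T :: 'a dual \<Rightarrow>\<^sub>B 'b). c ^ length idx = 1 \<and> invertible_operator T \<and>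
          (\<forall>A\<in>\<A>\<^sub>1. \<Phi> A = c *\<^sub>C (T o\<^sub>C adjoint_operator A o\<^sub>C inverse_operator T))))"
    (is "?pres \<longleftrightarrow> ?form1 \<or> ?form2")
proof
  assume pres: ?pres
  obtain p where p: "p < length idx" "\<And>q. q < length idx \<Longrightarrow> q \<noteq> p \<Longrightarrow> idx ! p \<noteq> idx ! q"
    using assms(7) by blast
  define p' where "p' = length idx - 1 - p"
  have "card (set idx) \<le> length idx" by (rule card_length)
  \<comment> \<open>Two different letters force length at least 2, so some letter stands beside
    position \<open>p\<close>, which gives \<open>r > 0\<close>.\<close>
  then have len: "length idx \<ge> 2" using assms(5,6) by simp
  \<comment> \<open>Exchanging the numbers of letters before and after \<open>p\<close> does not
    change the product, so they may be ordered.\<close>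
  define r where "r = max p p'"
  define s where "s = min p p'"
  have rs: "r > 0" "s \<le> r" "r + s + 1 = length idx"
    using p(1) len by (auto simp: r_def s_def p'_def)
  have J: "(jordan p p' :: ('a \<Rightarrow>\<^sub>B 'a) \<Rightarrow> _) = jordan r s" "(jordan p p' :: ('b \<Rightarrow>\<^sub>B 'b) \<Rightarrow> _) = jordan r s"
    by (cases "p \<le> p'") (simp_all add: r_def s_def max_def min_def jordan_commute)
  have pres2: "peripheral_spectrum (jordan r s (\<Phi> A) (\<Phi> B)) = peripheral_spectrum (jordan r s A B)"
    if AB: "A \<in> \<A>\<^sub>1" "B \<in> \<A>\<^sub>1" for A B
  proof -
    define C where "C = (\<lambda>j. if j = idx ! p then A else B)"
    have \<Phi>C: "(\<lambda>j. \<Phi> (C j)) = (\<lambda>j. if j = idx ! p then \<Phi> A else \<Phi> B)" by (auto simp: C_def)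
    have "\<forall>j\<in>{1..k}. C j \<in> \<A>\<^sub>1" using AB by (simp add: C_def)
    with pres have "peripheral_spectrum (generalized_jordan_product idx (\<lambda>j. \<Phi> (C j))) =
        peripheral_spectrum (generalized_jordan_product idx C)" by blast
    moreover have "generalized_jordan_product idx (\<lambda>j. \<Phi> (C j)) = jordan p p' (\<Phi> A) (\<Phi> B)"
      unfolding \<Phi>C p'_def by (rule generalized_jordan_product_two_operators) (use p in auto)
    moreover have "generalized_jordan_product idx C = jordan p p' A B"
      unfolding C_def p'_def by (rule generalized_jordan_product_two_operators) (use p in auto)
    ultimately show ?thesis by (simp add: J)
  qed
  have mem: "rank_one u1 g1 + rank_one u2 g2 + rank_one u3 g3 \<in> \<A>\<^sub>1" for u1 g1 u2 g2 u3 g3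
    using assms(3) rank_one_sum_finite_rank(1)[OF refl] unfolding standard_operator_algebra_def by blast
  have range: "rank_one u1 g1 + rank_one u2 g2 \<in> \<Phi> ` \<A>\<^sub>1" for u1 g1 u2 g2
    using assms(4,9) rank_one_sum_finite_rank[of "rank_one u1 g1 + rank_one u2 g2" u1 g1 u2 g2 0 0]
    unfolding standard_operator_algebra_def by auto
  have "\<forall>A\<in>\<A>\<^sub>1. \<forall>B\<in>\<A>\<^sub>1.
      peripheral_spectrum (jordan r s (\<Phi> A) (\<Phi> B)) = peripheral_spectrum (jordan r s A B)"
    using pres2 by blast
  from jordan_preserver_form[OF assms(1,2) rs(1,2) mem range this]
  show "?form1 \<or> ?form2"
    unfolding rs(3)
  proof (elim disjE exE conjE)
    fix c and T :: "'a \<Rightarrow>\<^sub>B 'b" and S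
    assume "c ^ length idx = 1" "is_inverse_operator T S" "\<forall>A\<in>\<A>\<^sub>1. \<Phi> A = c *\<^sub>C (T o\<^sub>C A o\<^sub>C S)"
    then show ?thesis
      using inverse_operator_eqI[of T S] unfolding invertible_operator_def by blast
  next
    fix c and T :: "'a dual \<Rightarrow>\<^sub>B 'b" and S
    assume "reflexive_space TYPE('a)" "reflexive_space TYPE('b)"
      "c ^ length idx = 1" "is_inverse_operator T S" "\<forall>A\<in>\<A>\<^sub>1. \<Phi> A = c *\<^sub>C (T o\<^sub>C adjoint_operator A o\<^sub>C S)"
    then show ?thesis
      using inverse_operator_eqI[of T S] unfolding invertible_operator_def by blast
  qed
next
  \<comment> \<open>Conversely, the scalar enters each word with exponent \<open>length idx\<close>
    and becomes 1; similarities preserve spectra, and so do adjoints on a reflexive space.\<close>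
  assume "?form1 \<or> ?form2"
  then show ?pres
  proof (elim disjE exE conjE)
    fix c and T :: "'a \<Rightarrow>\<^sub>B 'b"
    assume c: "c ^ length idx = 1" and T: "invertible_operator T"
      and \<Phi>: "\<forall>A\<in>\<A>\<^sub>1. \<Phi> A = c *\<^sub>C (T o\<^sub>C A o\<^sub>C inverse_operator T)"
    obtain S where S: "is_inverse_operator T S" using T unfolding invertible_operator_def by blast
    show ?pres
    proof (intro allI impI)
      fix A :: "nat \<Rightarrow> 'a \<Rightarrow>\<^sub>B 'a" assume A: "\<forall>j\<in>{1..k}. A j \<in> \<A>\<^sub>1"
      have "generalized_jordan_product idx (\<lambda>j. \<Phi> (A j))
          = generalized_jordan_product idx (\<lambda>j. c *\<^sub>C (T o\<^sub>C A j o\<^sub>C S))"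
        by (rule generalized_jordan_product_cong)
          (use A \<Phi> assms(6) in \<open>simp add: inverse_operator_eqI[OF S]\<close>)
      then show "peripheral_spectrum (generalized_jordan_product idx (\<lambda>j. \<Phi> (A j))) =
          peripheral_spectrum (generalized_jordan_product idx A)"
        unfolding generalized_jordan_product_similar[OF S c]
        by (simp add: peripheral_spectrum_cong[OF spectrum_similar[OF S]])
    qed
  next
    fix c and T :: "'a dual \<Rightarrow>\<^sub>B 'b"
    assume refl: "reflexive_space TYPE('a)" and c: "c ^ length idx = 1" and T: "invertible_operator T"
      and \<Phi>: "\<forall>A\<in>\<A>\<^sub>1. \<Phi> A = c *\<^sub>C (T o\<^sub>C adjoint_operator A o\<^sub>C inverse_operator T)"
    obtain S where S: "is_inverse_operator T S" using T unfolding invertible_operator_def by blast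
    show ?pres
    proof (intro allI impI)
      fix A :: "nat \<Rightarrow> 'a \<Rightarrow>\<^sub>B 'a" assume A: "\<forall>j\<in>{1..k}. A j \<in> \<A>\<^sub>1"
      have "generalized_jordan_product idx (\<lambda>j. \<Phi> (A j))
          = generalized_jordan_product idx (\<lambda>j. c *\<^sub>C (T o\<^sub>C adjoint_operator (A j) o\<^sub>C S))"
        by (rule generalized_jordan_product_cong)
          (use A \<Phi> assms(6) in \<open>simp add: inverse_operator_eqI[OF S]\<close>)
      then show "peripheral_spectrum (generalized_jordan_product idx (\<lambda>j. \<Phi> (A j))) =
          peripheral_spectrum (generalized_jordan_product idx A)"
        unfolding generalized_jordan_product_similar[OF S c] generalized_jordan_product_adjoint
        by (simp add: peripheral_spectrum_cong[OF trans[OF spectrum_similar[OF S] spectrum_adjoint[OF refl]]])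
    qed
  qed
qed

end
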